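(* Let $(M,\mathcal{F}_0)$ and $(N,\mathcal{F}_1)$ be closed oriented manifolds with Riemannian foliations and bundle-like metrics, let $f,g:(M,\mathcal{F}_0)\to(N,\mathcal{F}_1)$ be foliated homotopic maps, and let $\omega\in\Omega^{0,1}(N,\mathcal{F}_1)$ be a leafwise closed $1$-form on $(N,\mathcal{F}_1)$. Then there exists a positive function $h:M\to\mathbb{R}$ such that, for all $\ell,k$, $$f^{*}=h\,g^{*}:H^{\ell,k}_{\omega}(N,d_{\mathcal{F}_{1}})\rightarrow H^{\ell,k}_{f^{*}\omega}(M,d_{\mathcal{F}_{0}}).$$
   Context: All manifolds, foliations, maps, functions and forms are smooth. A bundle-like metric on a foliated manifold is a Riemannian metric such that a geodesic orthogonal to the leaf at one point is orthogonal to every leaf it meets; a foliation is Riemannian if such a metric exists. For a foliated Riemannian manifold $(M,\mathcal{F})$, let $N^*\mathcal{F}\subset T^*M$ be the covectors vanishing on $T\mathcal{F}$, and identify $T^*\mathcal{F}$ with the covectors vanishing on $N\mathcal{F}=T\mathcal{F}^{\perp}$. Put $\Omega^{u,v}(M,\mathcal{F})=\Gamma(\Lambda^uN^*\mathcal{F}\wedge\Lambda^vT^*\mathcal{F})$. The exterior derivative decomposes as $d=d_{0,1}+d_{1,0}+d_{2,-1}$ with $d_{i,j}$ of bidegree $(i,j)$, and $d_{\mathcal{F}}=d_{0,1}$ satisfies $d_{\mathcal{F}}^2=0$; $\omega\in\Omega^{0,1}(M,\mathcal{F})$ is leafwise closed if $d_{\mathcal{F}}\omega=0$. The general leafwise Morse-Novikov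 cohomology is the cohomology of $d^{\omega}_{\mathcal{F}}=d_{\mathcal{F}}+\omega\wedge$: $$H^{u,v}_{\omega}(M,d_{\mathcal{F}})=\frac{\ker(d_{\mathcal{F}}^{\omega}:\Omega^{u,v}\to\Omega^{u,v+1})}{\mathrm{im}(d_{\mathcal{F}}^{\omega}:\Omega^{u,v-1}\to\Omega^{u,v})}.$$ A foliated map is a smooth map sending leaves into leaves. For a foliated map $f$, the map $f^*:\Omega^{\ell,k}(N,\mathcal{F}_1)\to\Omega^{\ell,k}(M,\mathcal{F}_0)$ is the pullback of differential forms followed by projection to the component of bidegree $(\ell,k)$; for $\ell=0$ this is the pullback of leafwise forms. Two foliated maps $f,g:(M,\mathcal{F}_0)\to(N,\mathcal{F}_1)$ are foliated (leafwise) homotopic if there is a smooth map $F:M\times[0,1]\to N$ with $F_0=f$, $F_1=g$, where $F_t=F|_{M\times\{t\}}$, such that each $F_t$ maps leaves of $\mathcal{F}_0$ into leaves of $\mathcal{F}_1$, and for every $x\in M$ and all $t_1,t_2\in[0,1]$ the points $F_{t_1}(x),F_{t_2}(x)$ lie in the same leaf of $\mathcal{F}_1$. The identity $f^*=hg^*$ means $[f^*\alpha]=[h\,g^*\alpha]$ for every $d^{\omega}_{\mathcal{F}_1}$-closed $\alpha\in\Omega^{\ell,k}(N,\mathcal{F}_1)$. *)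

theory Defs
  imports "HOL-Analysis.Analysis"
begin

section \<open>Smooth maps between normed spaces\<close>

text \<open>
  Only used on sets on which the derivative within the set is unique: open subsets of a
  finite-dimensional space \<open>E\<close>, and relatively open subsets of \<open>E \<times> [0,1]\<close>
  (where derivatives at the two ends are one-sided).
\<close>

primrec Ck_on :: "nat \<Rightarrow> 'a::real_normed_vector set \<Rightarrow> ('a \<Rightarrow> 'b::real_normed_vector) \<Rightarrow> bool" where
  "Ck_on 0 = (\<lambda>S f. continuous_on S f)"
| "Ck_on (Suc k) = (\<lambda>S f. \<exists>f'. (\<forall>x\<in>S. (f has_derivative f' x) (at x within S)) \<and>
                             (\<forall>v. Ck_on k S (\<lambda>x. f' x v)))"

definition smooth_on :: "'a::real_normed_vector set \<Rightarrow> ('a \<Rightarrow> 'b::real_normed_vector) \<Rightarrow> bool" where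
  "smooth_on S f \<longleftrightarrow> (\<forall>k. Ck_on k S f)"


section \<open>Charts, foliated manifolds, leaves\<close>

text \<open>
  A manifold is a Hausdorff, second countable topological type \<open>'m\<close> with an atlas.
  A foliated manifold is given by an atlas of foliated charts with values in \<open>'p \<times> 'q\<close>,
  where \<open>'p\<close> models the leaves and \<open>'q\<close> the transverse direction.
  The model spaces are finite-dimensional normed spaces rather than types of class
  \<^class>\<open>euclidean_space\<close>, because that class excludes dimension 0 and with it the foliations
  by points and the foliations with codimension 0.
\<close>

datatype ('m, 'e) chart = Chart (cdom: "'m set") (coord: "'m \<Rightarrow> 'e")

definition chart_inv :: "('m, 'e) chart \<Rightarrow> 'e \<Rightarrow> 'm" where
  "chart_inv c = inv_into (cdom c) (coord c)"

definition crange :: "('m, 'e) chart \<Rightarrow> 'e set" where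
  "crange c = coord c ` cdom c"

definition in_charts :: "('m \<Rightarrow> 'n) \<Rightarrow> ('m, 'd) chart \<Rightarrow> ('n, 'e) chart \<Rightarrow> 'd \<Rightarrow> 'e" where
  "in_charts f c c' = coord c' \<circ> f \<circ> chart_inv c"

definition chart_deriv ::
  "('m \<Rightarrow> 'n) \<Rightarrow> ('m, 'd::real_normed_vector) chart \<Rightarrow> ('n, 'e::real_normed_vector) chart
     \<Rightarrow> 'm \<Rightarrow> 'd \<Rightarrow> 'e" where
  "chart_deriv f c c' x = frechet_derivative (in_charts f c c') (at (coord c x))"

definition finite_dimensional :: "'e::real_vector itself \<Rightarrow> bool" where
  "finite_dimensional _ \<longleftrightarrow> (\<exists>B::'e set. finite B \<and> span B = UNIV)"

definition smooth_atlas ::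
  "('m::{t2_space,second_countable_topology}, 'e::real_normed_vector) chart set \<Rightarrow> bool" where
  "smooth_atlas A \<longleftrightarrow>
     finite_dimensional TYPE('e) \<and>
     (\<Union>c\<in>A. cdom c) = UNIV \<and>
     (\<forall>c\<in>A. open (cdom c) \<and> open (crange c) \<and>
            homeomorphism (cdom c) (crange c) (coord c) (chart_inv c)) \<and>
     (\<forall>c\<in>A. \<forall>c'\<in>A. smooth_on (coord c ` (cdom c \<inter> cdom c')) (in_charts id c c'))"

text \<open>
  Changes of foliated charts have locally the form
  \<open>(a, b) \<mapsto> (\<tau>\<^sub>1 (a, b), \<tau>\<^sub>2 b)\<close>.
\<close>

definition foliated_atlas ::
  "('m::{t2_space,second_countable_topology}, 'p::real_normed_vector \<times> 'q::real_normed_vector) chart set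
     \<Rightarrow> bool" where
  "foliated_atlas A \<longleftrightarrow>
     smooth_atlas A \<and>
     (\<forall>c\<in>A. \<forall>c'\<in>A. \<forall>x \<in> cdom c \<inter> cdom c'.
        \<exists>W. open W \<and> coord c x \<in> W \<and> W \<subseteq> coord c ` (cdom c \<inter> cdom c') \<and>
            (\<forall>z\<in>W. \<forall>z'\<in>W. snd z = snd z' \<longrightarrow>
                snd (in_charts id c c' z) = snd (in_charts id c c' z')))"

text \<open>
  Two points lie in the same plaque of a chart if their coordinates lie in the same connected
  component of a slice of the chart range; leaves are the classes of points joined by finite
  chains of plaques.
\<close>

definition same_plaque ::
  "('m, 'p::real_normed_vector \<times> 'q::real_normed_vector) chart set \<Rightarrow> 'm \<Rightarrow> 'm \<Rightarrow> bool" where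
  "same_plaque A x y \<longleftrightarrow>
     (\<exists>c\<in>A. x \<in> cdom c \<and> y \<in> cdom c \<and>
        connected_component (crange c \<inter> (UNIV \<times> {snd (coord c x)})) (coord c x) (coord c y))"

definition leaf ::
  "('m, 'p::real_normed_vector \<times> 'q::real_normed_vector) chart set \<Rightarrow> 'm \<Rightarrow> 'm set" where
  "leaf A x = {y. (same_plaque A)\<^sup>*\<^sup>* x y}"

definition smooth_map ::
  "('m::topological_space, 'd::real_normed_vector) chart set \<Rightarrow>
   ('n::topological_space, 'e::real_normed_vector) chart set \<Rightarrow> ('m \<Rightarrow> 'n) \<Rightarrow> bool" where
  "smooth_map A B f \<longleftrightarrow>
     continuous_on UNIV f \<and>
     (\<forall>c\<in>A. \<forall>c'\<in>B. smooth_on (coord c ` {x \<in> cdom c. f x \<in> cdom c'}) (in_charts f c c'))"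

definition smooth_function ::
  "('m, 'e::real_normed_vector) chart set \<Rightarrow> ('m \<Rightarrow> real) \<Rightarrow> bool" where
  "smooth_function A h \<longleftrightarrow> (\<forall>c\<in>A. smooth_on (crange c) (h \<circ> chart_inv c))"

definition maps_leaves_into_leaves ::
  "('m, 'p::real_normed_vector \<times> 'q::real_normed_vector) chart set \<Rightarrow>
   ('n, 'r::real_normed_vector \<times> 's::real_normed_vector) chart set \<Rightarrow> ('m \<Rightarrow> 'n) \<Rightarrow> bool" where
  "maps_leaves_into_leaves A B f \<longleftrightarrow> (\<forall>x. \<exists>y. f ` leaf A x \<subseteq> leaf B y)"

definition foliated_map ::
  "('m::topological_space, 'p::real_normed_vector \<times> 'q::real_normed_vector) chart set \<Rightarrow>
   ('n::topological_space, 'r::real_normed_vector \<times> 's::real_normed_vector) chart set \<Rightarrow>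
   ('m \<Rightarrow> 'n) \<Rightarrow> bool" where
  "foliated_map A B f \<longleftrightarrow> smooth_map A B f \<and> maps_leaves_into_leaves A B f"

definition smooth_homotopy ::
  "('m::topological_space, 'd::real_normed_vector) chart set \<Rightarrow>
   ('n::topological_space, 'e::real_normed_vector) chart set \<Rightarrow> ('m \<times> real \<Rightarrow> 'n) \<Rightarrow> bool" where
  "smooth_homotopy A B F \<longleftrightarrow>
     continuous_on (UNIV \<times> {0..1}) F \<and>
     (\<forall>c\<in>A. \<forall>c'\<in>B.
        smooth_on {(coord c x, t) | x t. x \<in> cdom c \<and> t \<in> {0..1} \<and> F (x, t) \<in> cdom c'}
                  (\<lambda>(z, t). coord c' (F (chart_inv c z, t))))"

definition foliated_homotopic ::
  "('m::topological_space, 'p::real_normed_vector \<times> 'q::real_normed_vector) chart set \<Rightarrow>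
   ('n::topological_space, 'r::real_normed_vector \<times> 's::real_normed_vector) chart set \<Rightarrow>
   ('m \<Rightarrow> 'n) \<Rightarrow> ('m \<Rightarrow> 'n) \<Rightarrow> bool" where
  "foliated_homotopic A B f g \<longleftrightarrow>
     (\<exists>F. smooth_homotopy A B F \<and>
          (\<forall>x. F (x, 0) = f x) \<and> (\<forall>x. F (x, 1) = g x) \<and>
          (\<forall>t\<in>{0..1}. maps_leaves_into_leaves A B (\<lambda>x. F (x, t))) \<and>
          (\<forall>x. \<forall>t\<^sub>1\<in>{0..1}. \<forall>t\<^sub>2\<in>{0..1}. F (x, t\<^sub>2) \<in> leaf B (F (x, t\<^sub>1))))"


section \<open>Differential forms\<close>

text \<open>
  The value at \<open>v\<close> of a \<open>k\<close>-linear form uses only \<open>v 0, \<dots>, v (k - 1)\<close>.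
  \<open>\<alpha> c x v\<close> is the value of the form \<open>\<alpha>\<close> at the point \<open>x\<close> on the tangent vectors
  whose coordinates in the chart \<open>c\<close> are \<open>v 0, v 1, \<dots>\<close>. The convention that \<open>\<alpha> c x\<close> vanishes
  unless \<open>c\<close> is a chart of the atlas around \<open>x\<close> makes equality of forms the equality of HOL.
\<close>

type_synonym ('m, 'e) form = "('m, 'e) chart \<Rightarrow> 'm \<Rightarrow> (nat \<Rightarrow> 'e) \<Rightarrow> real"

definition alternating_form :: "nat \<Rightarrow> ((nat \<Rightarrow> 'e::real_vector) \<Rightarrow> real) \<Rightarrow> bool" where
  "alternating_form k a \<longleftrightarrow>
     (\<forall>v w. (\<forall>i<k. v i = w i) \<longrightarrow> a v = a w) \<and>
     (\<forall>v. \<forall>i<k. linear (\<lambda>u. a (v(i := u)))) \<and>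
     (\<forall>v. \<forall>i<k. \<forall>j<k. i \<noteq> j \<and> v i = v j \<longrightarrow> a v = 0)"

definition differential_form ::
  "('m, 'e::real_normed_vector) chart set \<Rightarrow> nat \<Rightarrow> ('m, 'e) form \<Rightarrow> bool" where
  "differential_form A k \<alpha> \<longleftrightarrow>
     (\<forall>c\<in>A. \<forall>x\<in>cdom c. alternating_form k (\<alpha> c x)) \<and>
     (\<forall>c\<in>A. \<forall>c'\<in>A. \<forall>x \<in> cdom c \<inter> cdom c'. \<forall>v.
        \<alpha> c x v = \<alpha> c' x (\<lambda>i. chart_deriv id c c' x (v i))) \<and>
     (\<forall>c\<in>A. \<forall>v. smooth_on (crange c) (\<lambda>z. \<alpha> c (chart_inv c z) v)) \<and>
     (\<forall>c x v. \<not> (c \<in> A \<and> x \<in> cdom c) \<longrightarrow> \<alpha> c x v = 0)"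

definition omit :: "nat \<Rightarrow> (nat \<Rightarrow> 'e) \<Rightarrow> nat \<Rightarrow> 'e" where
  "omit i v = (\<lambda>j. if j < i then v j else v (Suc j))"

definition ext_deriv ::
  "('m, 'e::real_normed_vector) chart set \<Rightarrow> nat \<Rightarrow> ('m, 'e) form \<Rightarrow> ('m, 'e) form" where
  "ext_deriv A k \<alpha> = (\<lambda>c x v.
     if c \<in> A \<and> x \<in> cdom c
     then \<Sum>i\<le>k. (-1) ^ i *
            frechet_derivative (\<lambda>z. \<alpha> c (chart_inv c z) (omit i v)) (at (coord c x)) (v i)
     else 0)"

text \<open>The wedge product \<open>\<omega> \<and> \<alpha>\<close> of a 1-form with a \<open>k\<close>-form.\<close>

definition wedge1 :: "('m, 'e) form \<Rightarrow> nat \<Rightarrow> ('m, 'e) form \<Rightarrow> ('m, 'e) form" where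
  "wedge1 \<omega> k \<alpha> = (\<lambda>c x v. \<Sum>i\<le>k. (-1) ^ i * \<omega> c x (\<lambda>_. v i) * \<alpha> c x (omit i v))"

definition scale_form :: "('m \<Rightarrow> real) \<Rightarrow> ('m, 'e) form \<Rightarrow> ('m, 'e) form" where
  "scale_form h \<alpha> = (\<lambda>c x v. h x * \<alpha> c x v)"

definition zero_form :: "('m, 'e) form" where
  "zero_form = (\<lambda>c x v. 0)"

definition pullback_form ::
  "('m, 'd::real_normed_vector) chart set \<Rightarrow> ('n, 'e::real_normed_vector) chart set \<Rightarrow>
   ('m \<Rightarrow> 'n) \<Rightarrow> ('n, 'e) form \<Rightarrow> ('m, 'd) form" where
  "pullback_form A B f \<alpha> = (\<lambda>c x v.
     if c \<in> A \<and> x \<in> cdom c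
     then let c' = (SOME c'. c' \<in> B \<and> f x \<in> cdom c')
          in \<alpha> c' (f x) (\<lambda>i. chart_deriv f c c' x (v i))
     else 0)"

text \<open>An orientation is represented by a nowhere vanishing form of top degree.\<close>

definition orientation_form :: "('m, 'e::real_normed_vector) chart set \<Rightarrow> ('m, 'e) form \<Rightarrow> bool" where
  "orientation_form A \<mu> \<longleftrightarrow>
     differential_form A (dim (UNIV :: 'e set)) \<mu> \<and>
     (\<forall>c\<in>A. \<forall>x\<in>cdom c. \<exists>v. \<mu> c x v \<noteq> 0)"


section \<open>Riemannian metrics, geodesics, bundle-like metrics\<close>

text \<open>As for forms, \<open>g c x u v\<close> takes the tangent vectors in the coordinates of \<open>c\<close>.\<close>

type_synonym ('m, 'e) metric_field = "('m, 'e) chart \<Rightarrow> 'm \<Rightarrow> 'e \<Rightarrow> 'e \<Rightarrow> real"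

definition riemannian_metric ::
  "('m, 'e::real_normed_vector) chart set \<Rightarrow> ('m, 'e) metric_field \<Rightarrow> bool" where
  "riemannian_metric A g \<longleftrightarrow>
     (\<forall>c\<in>A. \<forall>x\<in>cdom c.
        bilinear (g c x) \<and> (\<forall>u v. g c x u v = g c x v u) \<and> (\<forall>v. v \<noteq> 0 \<longrightarrow> g c x v v > 0)) \<and>
     (\<forall>c\<in>A. \<forall>c'\<in>A. \<forall>x \<in> cdom c \<inter> cdom c'. \<forall>u v.
        g c x u v = g c' x (chart_deriv id c c' x u) (chart_deriv id c c' x v)) \<and>
     (\<forall>c\<in>A. \<forall>u v. smooth_on (crange c) (\<lambda>z. g c (chart_inv c z) u v))"

definition velocity :: "('m, 'e::real_normed_vector) chart \<Rightarrow> (real \<Rightarrow> 'm) \<Rightarrow> real \<Rightarrow> 'e" where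
  "velocity c \<gamma> t = vector_derivative (coord c \<circ> \<gamma>) (at t)"

text \<open>
  The geodesic equation
  \<open>g\<^sub>k\<^sub>j \<gamma>''\<^sup>j + (\<partial>\<^sub>i g\<^sub>k\<^sub>j - 1/2 \<partial>\<^sub>k g\<^sub>i\<^sub>j) \<gamma>'\<^sup>i \<gamma>'\<^sup>j = 0\<close>
  (index of the acceleration lowered, so that no inverse metric is needed), with the terms
  containing \<open>\<gamma>''\<close> and \<open>\<partial>\<^sub>i g\<^sub>k\<^sub>j\<close> collected into the derivative of \<open>g (\<gamma>', w)\<close> along \<open>\<gamma>\<close>,
  for constant coordinate vectors \<open>w\<close>.
\<close>

definition geodesic ::
  "('m::topological_space, 'e::real_normed_vector) chart set \<Rightarrow> ('m, 'e) metric_field \<Rightarrow>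
   real set \<Rightarrow> (real \<Rightarrow> 'm) \<Rightarrow> bool" where
  "geodesic A g I \<gamma> \<longleftrightarrow>
     open I \<and> is_interval I \<and> continuous_on I \<gamma> \<and>
     (\<forall>c\<in>A. smooth_on {t\<in>I. \<gamma> t \<in> cdom c} (coord c \<circ> \<gamma>) \<and>
        (\<forall>t\<in>I. \<gamma> t \<in> cdom c \<longrightarrow> (\<forall>w.
           ((\<lambda>s. g c (\<gamma> s) (velocity c \<gamma> s) w) has_real_derivative
              1/2 * frechet_derivative
                      (\<lambda>z. g c (chart_inv c z) (velocity c \<gamma> t) (velocity c \<gamma> t))
                      (at (coord c (\<gamma> t))) w) (at t))))"

definition tangent_space :: "('p::real_vector \<times> 'q::real_vector) set" where
  "tangent_space = UNIV \<times> {0}"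

definition normal_space ::
  "('m, 'p::real_normed_vector \<times> 'q::real_normed_vector) metric_field \<Rightarrow>
   ('m, 'p \<times> 'q) chart \<Rightarrow> 'm \<Rightarrow> ('p \<times> 'q) set" where
  "normal_space g c x = {w. \<forall>u\<in>tangent_space. g c x u w = 0}"

definition orthogonal_to_leaf ::
  "('m, 'p::real_normed_vector \<times> 'q::real_normed_vector) chart set \<Rightarrow>
   ('m, 'p \<times> 'q) metric_field \<Rightarrow> (real \<Rightarrow> 'm) \<Rightarrow> real \<Rightarrow> bool" where
  "orthogonal_to_leaf A g \<gamma> t \<longleftrightarrow>
     (\<forall>c\<in>A. \<gamma> t \<in> cdom c \<longrightarrow> velocity c \<gamma> t \<in> normal_space g c (\<gamma> t))"

definition bundle_like ::
  "('m::topological_space, 'p::real_normed_vector \<times> 'q::real_normed_vector) chart set \<Rightarrow>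
   ('m, 'p \<times> 'q) metric_field \<Rightarrow> bool" where
  "bundle_like A g \<longleftrightarrow>
     riemannian_metric A g \<and>
     (\<forall>I \<gamma>. geodesic A g I \<gamma> \<and> (\<exists>t\<in>I. orthogonal_to_leaf A g \<gamma> t) \<longrightarrow>
        (\<forall>t\<in>I. orthogonal_to_leaf A g \<gamma> t))"

definition riemannian_foliation ::
  "('m::{t2_space,second_countable_topology}, 'p::real_normed_vector \<times> 'q::real_normed_vector) chart set
     \<Rightarrow> bool" where
  "riemannian_foliation A \<longleftrightarrow> foliated_atlas A \<and> (\<exists>g. bundle_like A g)"


section \<open>The bigrading\<close>

definition annihilator :: "'e::real_vector set \<Rightarrow> ('e \<Rightarrow> real) set" where
  "annihilator V = {\<theta>. linear \<theta> \<and> (\<forall>v\<in>V. \<theta> v = 0)}"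

definition wedge_covectors :: "nat \<Rightarrow> (nat \<Rightarrow> 'e \<Rightarrow> real) \<Rightarrow> (nat \<Rightarrow> 'e) \<Rightarrow> real" where
  "wedge_covectors k \<theta> w =
     (\<Sum>\<sigma> | \<sigma> permutes {..<k}. of_int (sign \<sigma>) * (\<Prod>i<k. \<theta> i (w (\<sigma> i))))"

text \<open>
  For a splitting of the tangent space into \<open>T\<close> and \<open>N\<close>: the span of the products
  \<open>\<xi>\<^sub>1 \<and> \<dots> \<and> \<xi>\<^sub>u \<and> \<eta>\<^sub>1 \<and> \<dots> \<and> \<eta>\<^sub>v\<close> with the \<open>\<xi>\<^sub>i\<close> vanishing on \<open>T\<close> and
  the \<open>\<eta>\<^sub>j\<close> vanishing on \<open>N\<close>.
\<close>

definition bigraded_forms ::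
  "'e::real_vector set \<Rightarrow> 'e set \<Rightarrow> nat \<Rightarrow> nat \<Rightarrow> ((nat \<Rightarrow> 'e) \<Rightarrow> real) set" where
  "bigraded_forms T N u v =
     {a. \<exists>n (r :: nat \<Rightarrow> real) \<theta>.
        (\<forall>m<n. (\<forall>i<u. \<theta> m i \<in> annihilator T) \<and> (\<forall>i\<in>{u..<u+v}. \<theta> m i \<in> annihilator N)) \<and>
        a = (\<lambda>w. \<Sum>m<n. r m * wedge_covectors (u + v) (\<theta> m) w)}"

text \<open>
  The component of bidegree \<open>(u, k - u)\<close> of a \<open>k\<close>-form, where \<open>P\<close> is the projection onto \<open>T\<close>
  along \<open>N\<close>: expand each argument into its parts in \<open>T\<close> and \<open>N\<close> and keep the terms
  with exactly \<open>u\<close> arguments in \<open>N\<close>.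
\<close>

definition component_at ::
  "('e \<Rightarrow> 'e) \<Rightarrow> nat \<Rightarrow> nat \<Rightarrow> ((nat \<Rightarrow> 'e::real_vector) \<Rightarrow> real) \<Rightarrow> (nat \<Rightarrow> 'e) \<Rightarrow> real" where
  "component_at P u k a w =
     (\<Sum>S | S \<subseteq> {..<k} \<and> card S = u. a (\<lambda>i. if i \<in> S then w i - P (w i) else P (w i)))"

text \<open>
  This is the projection that belongs to the direct sum decomposition into bidegrees:
\<close>

lemma component_at_bigraded:
  fixes T N :: "'e::real_vector set"
  assumes a: "a \<in> bigraded_forms T N u v"
    and P: "\<And>w. P w \<in> T" "\<And>w. w - P w \<in> N"
  shows "component_at P u' (u + v) a = (if u' = u then a else (\<lambda>w. 0))"
proof
  fix w :: "nat \<Rightarrow> 'e"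
  let ?k = "u + v"
  let ?Q = "\<lambda>S i. if i \<in> S then w i - P (w i) else P (w i)"
  let ?F = "{S. S \<subseteq> {..<?k} \<and> card S = u'}"
  have finF: "finite ?F" by (rule finite_subset[of _ "Pow {..<?k}"]) auto
  from a obtain n :: nat and r \<theta> where
    \<theta>: "\<forall>m<n. (\<forall>i<u. \<theta> m i \<in> annihilator T) \<and> (\<forall>i\<in>{u..<?k}. \<theta> m i \<in> annihilator N)" and
    aeq: "a = (\<lambda>w. \<Sum>m<n. r m * wedge_covectors ?k (\<theta> m) w)"
    unfolding bigraded_forms_def mem_Collect_eq by (elim exE conjE) (rule that)
  have \<theta>T: "\<theta> m i \<in> annihilator T" if "m < n" "i < u" for m i
    using \<theta> that by simp
  have \<theta>N: "\<theta> m i \<in> annihilator N" if "m < n" "i \<in> {u..<?k}" for m i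
    using \<theta> that by simp
  have key: "(\<Sum>S\<in>?F. \<Prod>i<?k. \<theta> m i (?Q S (\<sigma> i)))
      = (if u' = u then \<Prod>i<?k. \<theta> m i (w (\<sigma> i)) else 0)"
    if m: "m < n" and \<sigma>: "\<sigma> permutes {..<?k}" for m \<sigma>
  proof -
    have lt: "\<sigma> i < ?k \<longleftrightarrow> i < ?k" for i
      using permutes_in_image[OF \<sigma>, of i] by simp
    have inj: "inj \<sigma>" using \<sigma> by (rule permutes_inj)
    have fac1: "\<theta> m i (?Q S (\<sigma> i)) = (if \<sigma> i \<in> S then \<theta> m i (w (\<sigma> i)) else 0)"
      if "i < u" for i S
      using \<theta>T[OF m that] P(1) by (auto simp: annihilator_def linear_diff)
    have fac2: "\<theta> m i (?Q S (\<sigma> i)) = (if \<sigma> i \<in> S then 0 else \<theta> m i (w (\<sigma> i)))"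
      if i: "i \<in> {u..<?k}" for i S
    proof -
      have lin: "linear (\<theta> m i)" and z: "\<theta> m i (x - P x) = 0" for x
        using \<theta>N[OF m i] P(2) by (auto simp: annihilator_def)
      have "\<theta> m i (P x) = \<theta> m i x" for x
        using z[of x] linear_diff[OF lin] by simp
      then show ?thesis using z by simp
    qed
    let ?S0 = "\<sigma> ` {..<u}"
    have S0: "?S0 \<subseteq> {..<?k}"
      by (rule image_subsetI) (simp add: lt)
    have card0: "card ?S0 = u"
      using card_image[OF inj_on_subset[OF inj subset_UNIV], of "{..<u}"] by simp
    have prod: "(\<Prod>i<?k. \<theta> m i (?Q S (\<sigma> i)))
        = (if S = ?S0 then \<Prod>i<?k. \<theta> m i (w (\<sigma> i)) else 0)"
      if S: "S \<subseteq> {..<?k}" for S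
    proof (cases "S = ?S0")
      case True
      have "\<theta> m i (?Q S (\<sigma> i)) = \<theta> m i (w (\<sigma> i))" if "i < ?k" for i
      proof (cases "i < u")
        case iu: True
        then show ?thesis using fac1[OF iu, of S] True by auto
      next
        case False
        then have "\<sigma> i \<notin> S" using True inj by (auto simp: inj_def)
        then show ?thesis using fac2[of i S] False that by auto
      qed
      then show ?thesis using True by (auto intro!: prod.cong)
    next
      case False
      then obtain j where j: "j < ?k" "(j \<in> S) \<noteq> (j \<in> ?S0)" using S S0 by blast
      obtain i where i: "j = \<sigma> i" "i < ?k"
        using permutes_image[OF \<sigma>] j(1) by (metis imageE lessThan_iff)
      have "\<theta> m i (?Q S (\<sigma> i)) = 0"
      proof (cases "i < u")
        case iu: True
        then have "\<sigma> i \<notin> S" using j i by auto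
        then show ?thesis using fac1[OF iu, of S] by auto
      next
        case iu: False
        then have "\<sigma> i \<notin> ?S0" using inj by (auto simp: inj_def)
        then have "\<sigma> i \<in> S" using j i by auto
        then show ?thesis using fac2[of i S] iu i by auto
      qed
      then have "\<exists>i\<in>{..<?k}. \<theta> m i (?Q S (\<sigma> i)) = 0"
        by (rule bexI) (simp add: i(2))
      then have "(\<Prod>i<?k. \<theta> m i (?Q S (\<sigma> i))) = 0"
        by (rule prod_zero[OF finite_lessThan])
      then show ?thesis using False by simp
    qed
    have "(\<Sum>S\<in>?F. \<Prod>i<?k. \<theta> m i (?Q S (\<sigma> i)))
        = (\<Sum>S\<in>?F. if S = ?S0 then \<Prod>i<?k. \<theta> m i (w (\<sigma> i)) else 0)"
      using prod by (intro sum.cong) auto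
    also have "\<dots> = (if ?S0 \<in> ?F then \<Prod>i<?k. \<theta> m i (w (\<sigma> i)) else 0)"
      using finF by (simp add: sum.delta)
    finally show ?thesis using S0 card0 by auto
  qed
  have "component_at P u' ?k a w
      = (\<Sum>S\<in>?F. \<Sum>m<n. r m * (\<Sum>\<sigma> | \<sigma> permutes {..<?k}.
           of_int (sign \<sigma>) * (\<Prod>i<?k. \<theta> m i (?Q S (\<sigma> i)))))"
    unfolding component_at_def aeq wedge_covectors_def by simp
  also have "\<dots> = (\<Sum>m<n. r m * (\<Sum>\<sigma> | \<sigma> permutes {..<?k}.
           of_int (sign \<sigma>) * (\<Sum>S\<in>?F. \<Prod>i<?k. \<theta> m i (?Q S (\<sigma> i)))))"
    unfolding sum_distrib_left
    by (subst sum.swap, rule sum.cong[OF refl], subst sum.swap) (rule refl)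
  also have "\<dots> = (\<Sum>m<n. r m * (\<Sum>\<sigma> | \<sigma> permutes {..<?k}.
           of_int (sign \<sigma>) * (if u' = u then \<Prod>i<?k. \<theta> m i (w (\<sigma> i)) else 0)))"
    by (intro sum.cong refl arg_cong2[where f = "(*)"] key) simp_all
  also have "\<dots> = (if u' = u then a else (\<lambda>w. 0)) w"
    unfolding aeq wedge_covectors_def by simp
  finally show "component_at P u' ?k a w = (if u' = u then a else (\<lambda>w. 0)) w" .
qed

definition tangential_part ::
  "('m, 'p::real_normed_vector \<times> 'q::real_normed_vector) metric_field \<Rightarrow>
   ('m, 'p \<times> 'q) chart \<Rightarrow> 'm \<Rightarrow> 'p \<times> 'q \<Rightarrow> 'p \<times> 'q" where
  "tangential_part g c x w = (THE a. a \<in> tangent_space \<and> w - a \<in> normal_space g c x)"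

definition Omega ::
  "('m, 'p::real_normed_vector \<times> 'q::real_normed_vector) chart set \<Rightarrow>
   ('m, 'p \<times> 'q) metric_field \<Rightarrow> nat \<Rightarrow> nat \<Rightarrow> ('m, 'p \<times> 'q) form set" where
  "Omega A g u v =
     {\<alpha>. differential_form A (u + v) \<alpha> \<and>
         (\<forall>c\<in>A. \<forall>x\<in>cdom c. \<alpha> c x \<in> bigraded_forms tangent_space (normal_space g c x) u v)}"

definition bidegree_part ::
  "('m, 'p::real_normed_vector \<times> 'q::real_normed_vector) metric_field \<Rightarrow> nat \<Rightarrow> nat \<Rightarrow>
   ('m, 'p \<times> 'q) form \<Rightarrow> ('m, 'p \<times> 'q) form" where
  "bidegree_part g u v \<alpha> = (\<lambda>c x. component_at (tangential_part g c x) u (u + v) (\<alpha> c x))"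


section \<open>Leafwise Morse-Novikov cohomology\<close>

text \<open>\<open>d\<^sub>\<F> = d\<^sub>0\<^sub>,\<^sub>1\<close> on forms of bidegree \<open>(u, v)\<close>.\<close>

definition d_leaf ::
  "('m, 'p::real_normed_vector \<times> 'q::real_normed_vector) chart set \<Rightarrow>
   ('m, 'p \<times> 'q) metric_field \<Rightarrow> nat \<Rightarrow> nat \<Rightarrow> ('m, 'p \<times> 'q) form \<Rightarrow> ('m, 'p \<times> 'q) form" where
  "d_leaf A g u v \<alpha> = bidegree_part g u (Suc v) (ext_deriv A (u + v) \<alpha>)"

definition leafwise_closed ::
  "('m, 'p::real_normed_vector \<times> 'q::real_normed_vector) chart set \<Rightarrow>
   ('m, 'p \<times> 'q) metric_field \<Rightarrow> ('m, 'p \<times> 'q) form \<Rightarrow> bool" where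
  "leafwise_closed A g \<omega> \<longleftrightarrow> \<omega> \<in> Omega A g 0 1 \<and> d_leaf A g 0 1 \<omega> = zero_form"

definition d_MN ::
  "('m, 'p::real_normed_vector \<times> 'q::real_normed_vector) chart set \<Rightarrow>
   ('m, 'p \<times> 'q) metric_field \<Rightarrow> ('m, 'p \<times> 'q) form \<Rightarrow> nat \<Rightarrow> nat \<Rightarrow>
   ('m, 'p \<times> 'q) form \<Rightarrow> ('m, 'p \<times> 'q) form" where
  "d_MN A g \<omega> u v \<alpha> = (\<lambda>c x w. d_leaf A g u v \<alpha> c x w + wedge1 \<omega> (u + v) \<alpha> c x w)"

definition MN_cocycles ::
  "('m, 'p::real_normed_vector \<times> 'q::real_normed_vector) chart set \<Rightarrow>
   ('m, 'p \<times> 'q) metric_field \<Rightarrow> ('m, 'p \<times> 'q) form \<Rightarrow> nat \<Rightarrow> nat \<Rightarrow>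
   ('m, 'p \<times> 'q) form set" where
  "MN_cocycles A g \<omega> u v = {\<alpha> \<in> Omega A g u v. d_MN A g \<omega> u v \<alpha> = zero_form}"

definition MN_coboundaries ::
  "('m, 'p::real_normed_vector \<times> 'q::real_normed_vector) chart set \<Rightarrow>
   ('m, 'p \<times> 'q) metric_field \<Rightarrow> ('m, 'p \<times> 'q) form \<Rightarrow> nat \<Rightarrow> nat \<Rightarrow>
   ('m, 'p \<times> 'q) form set" where
  "MN_coboundaries A g \<omega> u v =
     (case v of 0 \<Rightarrow> {zero_form} | Suc v' \<Rightarrow> d_MN A g \<omega> u v' ` Omega A g u v')"

text \<open>The class \<open>[\<alpha>]\<close> as a coset, and the cohomology as the set of all classes.\<close>

definition MN_class ::
  "('m, 'p::real_normed_vector \<times> 'q::real_normed_vector) chart set \<Rightarrow>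
   ('m, 'p \<times> 'q) metric_field \<Rightarrow> ('m, 'p \<times> 'q) form \<Rightarrow> nat \<Rightarrow> nat \<Rightarrow>
   ('m, 'p \<times> 'q) form \<Rightarrow> ('m, 'p \<times> 'q) form set" where
  "MN_class A g \<omega> u v \<alpha> =
     {\<beta> \<in> MN_cocycles A g \<omega> u v. (\<lambda>c x w. \<beta> c x w - \<alpha> c x w) \<in> MN_coboundaries A g \<omega> u v}"

definition MN_cohomology ::
  "('m, 'p::real_normed_vector \<times> 'q::real_normed_vector) chart set \<Rightarrow>
   ('m, 'p \<times> 'q) metric_field \<Rightarrow> ('m, 'p \<times> 'q) form \<Rightarrow> nat \<Rightarrow> nat \<Rightarrow>
   ('m, 'p \<times> 'q) form set set" where
  "MN_cohomology A g \<omega> u v = MN_class A g \<omega> u v ` MN_cocycles A g \<omega> u v"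

text \<open>
  \<open>f\<^sup>*\<close> on forms of bidegree \<open>(u, v)\<close>: pullback followed by projection. It depends on the
  metric of the source only.
\<close>

definition foliated_pullback ::
  "('m, 'p::real_normed_vector \<times> 'q::real_normed_vector) chart set \<Rightarrow>
   ('m, 'p \<times> 'q) metric_field \<Rightarrow>
   ('n, 'r::real_normed_vector \<times> 's::real_normed_vector) chart set \<Rightarrow>
   ('m \<Rightarrow> 'n) \<Rightarrow> nat \<Rightarrow> nat \<Rightarrow> ('n, 'r \<times> 's) form \<Rightarrow> ('m, 'p \<times> 'q) form" where
  "foliated_pullback A g B f u v \<alpha> = bidegree_part g u v (pullback_form A B f \<alpha>)"

text \<open>
  \<open>\<Phi>\<close> on forms induces the map \<open>\<phi>\<close> on cohomology with \<open>\<phi> [\<alpha>] = [\<Phi> \<alpha>]\<close>; in particular \<open>\<Phi>\<close> sends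
  closed forms to closed forms, and \<open>[\<Phi> \<alpha>]\<close> depends on \<open>[\<alpha>]\<close> only.
\<close>

definition induces_on_cohomology ::
  "('n, 'r::real_normed_vector \<times> 's::real_normed_vector) chart set \<Rightarrow>
   ('n, 'r \<times> 's) metric_field \<Rightarrow> ('n, 'r \<times> 's) form \<Rightarrow>
   ('m, 'p::real_normed_vector \<times> 'q::real_normed_vector) chart set \<Rightarrow>
   ('m, 'p \<times> 'q) metric_field \<Rightarrow> ('m, 'p \<times> 'q) form \<Rightarrow> nat \<Rightarrow> nat \<Rightarrow>
   (('n, 'r \<times> 's) form \<Rightarrow> ('m, 'p \<times> 'q) form) \<Rightarrow>
   (('n, 'r \<times> 's) form set \<Rightarrow> ('m, 'p \<times> 'q) form set) \<Rightarrow> bool" where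
  "induces_on_cohomology B gN \<omega> A gM \<eta> u v \<Phi> \<phi> \<longleftrightarrow>
     \<phi> \<in> MN_cohomology B gN \<omega> u v \<rightarrow> MN_cohomology A gM \<eta> u v \<and>
     (\<forall>\<alpha> \<in> MN_cocycles B gN \<omega> u v.
        \<Phi> \<alpha> \<in> MN_cocycles A gM \<eta> u v \<and>
        \<phi> (MN_class B gN \<omega> u v \<alpha>) = MN_class A gM \<eta> u v (\<Phi> \<alpha>))"

end

theory Submission
  imports Defs
begin

text \<open>
  Write \<open>F\<^sub>t\<close> for the homotopy, \<open>\<theta> = \<omega>(\<partial>\<^sub>t F)\<close> and \<open>h\<^sub>t = exp (\<integral>\<^sub>0\<^sup>t \<theta> ds)\<close>, and let \<open>\<iota>\<close> be the contraction of
  \<open>F\<^sup>*\<alpha>\<close> with \<open>\<partial>\<^sub>t\<close>. As \<open>d\<close> commutes with \<open>F\<^sup>*\<close> and \<open>\<partial>\<^sub>t F\<close> is tangent to the leaves, leafwise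
  closedness of \<open>\<omega>\<close> gives \<open>d\<^sub>\<F> h\<^sub>t = h\<^sub>t (F\<^sub>t\<^sup>*\<omega> - F\<^sub>0\<^sup>*\<omega>)\<close>, and for a closed form \<open>\<alpha>\<close>
  \<open>\<partial>\<^sub>t (h\<^sub>t F\<^sub>t\<^sup>*\<alpha>) = (d\<^sub>\<F> + F\<^sub>0\<^sup>*\<omega> \<and>) (h\<^sub>t \<iota>)\<close>. Integration over \<open>[0, 1]\<close> shows that
  \<open>h\<^sub>1 g\<^sup>*\<alpha> - f\<^sup>*\<alpha>\<close> is exact.

  A form of bidegree \<open>(u, v)\<close> is determined by its values on arguments of which \<open>v\<close> are leafwise, and
  vanishes if more than \<open>v\<close> are. On such arguments \<open>d\<^sub>\<F>\<close> is the exterior derivative and \<open>f\<^sup>*\<close> the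
  pullback, provided that the derivative of \<open>f\<close> preserves the tangent spaces of the leaves. This holds
  because a leaf meets a chart in countably many plaques, so that a curve in a leaf stays in one plaque.
\<close>

section \<open>Finite-dimensional normed spaces\<close>

text \<open>The obstacle is the metric. A foliated map respects leaf directions but not their
  orthogonal complements, so pullback does not commute with the projections onto bidegrees. It does
  respect the number of leafwise arguments (\<open>count_in\<close>), and this count takes over the
  role of the bigrading: in a sum over omitted arguments, a term that omits a non-leafwise argument
  keeps too many leafwise ones and vanishes. Hence the exponential factor has to be differentiated
  in leafwise directions only, and these are the directions in which leafwise closedness of \<omega>
  gives information. The factor is forced. The closedness of \<alpha>, evaluated with the time
  direction in the first place, gives the time derivative of the pullback plus \<theta> times the
  pullback. Removing the term with \<theta> is a linear differential equation in time, solved by the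
  exponential. The same factor exchanges the twist at time \<open>t\<close> for the twist at time 0,
  so that one fixed operator is left and can be taken out of the time integral.\<close>

lemma independent_coefficients_bounded:
  fixes B :: "'e::real_normed_vector set"
  assumes "finite B" and "independent B"
  shows "\<exists>C. \<forall>r. \<forall>b\<in>B. \<bar>r b\<bar> \<le> C * norm (\<Sum>b\<in>B. r b *\<^sub>R b)"
  using assms
proof (induction B rule: finite_induct)
  case (insert b B)
  have ind: "independent B" and b: "b \<notin> span B"
    using insert.prems insert.hyps by (auto simp: independent_insert)
  obtain C0 where C0: "\<And>r x. x \<in> B \<Longrightarrow> \<bar>r x\<bar> \<le> C0 * norm (\<Sum>b\<in>B. r b *\<^sub>R b)"
    using insert.IH[OF ind] by blast
  \<comment> \<open>For empty \<open>B\<close> the bound leaves the sign of \<open>C0\<close>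
    open.\<close>
  define C where "C = max C0 0"
  have Cpos: "C \<ge> 0" by (simp add: C_def)
  have C: "\<bar>r x\<bar> \<le> C * norm (\<Sum>b\<in>B. r b *\<^sub>R b)" if "x \<in> B" for r x
    using C0[OF that, of r] mult_right_mono[of C0 C "norm (\<Sum>b\<in>B. r b *\<^sub>R b)"]
    by (simp add: C_def)
  \<comment> \<open>Applied to differences, the bound makes the coefficients of a convergent
    sequence Cauchy; their limits are the coefficients of the limit.\<close>
  have "closed (span B)"
    unfolding closed_sequential_limits
  proof (intro allI impI, elim conjE)
    fix X l assume X: "\<forall>n. X n \<in> span B" and l: "X \<longlonglongrightarrow> l"
    have "\<forall>n. \<exists>r. X n = (\<Sum>b\<in>B. r b *\<^sub>R b)"
      using X span_finite[OF insert.hyps(1)] by auto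
    then obtain r where r: "\<And>n. X n = (\<Sum>b\<in>B. r n b *\<^sub>R b)" by metis
    have conv: "convergent (\<lambda>n. r n x)" if x: "x \<in> B" for x
    proof (rule Cauchy_convergent, rule CauchyI)
      fix e :: real assume e: "e > 0"
      have "Cauchy X" using l by (rule LIMSEQ_imp_Cauchy)
      then obtain M where M: "\<And>m n. m \<ge> M \<Longrightarrow> n \<ge> M \<Longrightarrow> norm (X m - X n) < e / (C + 1)"
        using e Cpos unfolding Cauchy_iff
        by (metis add_nonneg_pos divide_pos_pos zero_less_one)
      have "norm (r m x - r n x) < e" if "m \<ge> M" "n \<ge> M" for m n
      proof -
        have "X m - X n = (\<Sum>b\<in>B. (r m b - r n b) *\<^sub>R b)"
          by (simp add: r sum_subtractf scaleR_diff_left)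
        then have "\<bar>r m x - r n x\<bar> \<le> C * norm (X m - X n)"
          using C[OF x, of "\<lambda>b. r m b - r n b"] by simp
        also have "\<dots> \<le> C * (e / (C + 1))"
          using M[OF that] Cpos by (intro mult_left_mono) auto
        also have "\<dots> < e" using e Cpos by (simp add: field_simps)
        finally show ?thesis by simp
      qed
      then show "\<exists>M. \<forall>m\<ge>M. \<forall>n\<ge>M. norm (r m x - r n x) < e"
        by blast
    qed
    then have "X \<longlonglongrightarrow> (\<Sum>b\<in>B. lim (\<lambda>n. r n b) *\<^sub>R b)"
      unfolding r[abs_def]
      by (intro tendsto_sum tendsto_scaleR tendsto_const) (simp add: convergent_LIMSEQ_iff)
    then have "l = (\<Sum>b\<in>B. lim (\<lambda>n. r n b) *\<^sub>R b)"
      using l LIMSEQ_unique by blast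
    then show "l \<in> span B" by (simp add: span_sum span_scale span_base)
  qed
  \<comment> \<open>A lower bound \<open>d\<close> for the distance of \<open>b\<close> from the
    span of \<open>B\<close> bounds the coefficient of \<open>b\<close> by \<open>1 / d\<close>
    times the norm of the sum.\<close>
  then obtain d where d: "d > 0" "ball b d \<subseteq> - span B"
    using b by (metis ComplI open_Compl openE)
  have far: "d \<le> norm (b + y)" if "y \<in> span B" for y
  proof -
    have "- y \<notin> ball b d" using that d(2) span_neg by blast
    then show ?thesis by (simp add: dist_norm)
  qed
  \<comment> \<open>The second entry serves the coefficients over \<open>B\<close>: the part
    \<open>y\<close> of the sum in the span has norm at most \<open>1 + norm b / d\<close> times
    that of the sum.\<close>
  define D where "D = max (1 / d) (C * (1 + norm b / d))"
  have "\<bar>r x\<bar> \<le> D * norm (\<Sum>b\<in>insert b B. r b *\<^sub>R b)" if "x \<in> insert b B" for r x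
  proof -
    define y where "y = (\<Sum>b\<in>B. r b *\<^sub>R b)"
    have s: "(\<Sum>b\<in>insert b B. r b *\<^sub>R b) = r b *\<^sub>R b + y"
      using insert.hyps by (simp add: y_def)
    have y: "y \<in> span B" unfolding y_def by (simp add: span_sum span_scale span_base)
    have rb: "\<bar>r b\<bar> * d \<le> norm (r b *\<^sub>R b + y)"
    proof (cases "r b = 0")
      case False
      have "\<bar>r b\<bar> * d \<le> \<bar>r b\<bar> * norm (b + (1 / r b) *\<^sub>R y)"
        using y by (intro mult_left_mono far) (auto simp: span_scale)
      also have "\<dots> = norm (r b *\<^sub>R b + y)"
        using False by (subst norm_scaleR[symmetric]) (simp add: scaleR_add_right)
      finally show ?thesis .
    qed auto
    have rb': "\<bar>r b\<bar> \<le> (1 / d) * norm (r b *\<^sub>R b + y)"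
      using rb d(1) by (simp add: field_simps)
    have D1: "(1 / d) * norm (r b *\<^sub>R b + y) \<le> D * norm (r b *\<^sub>R b + y)"
      and D2: "C * (1 + norm b / d) * norm (r b *\<^sub>R b + y) \<le> D * norm (r b *\<^sub>R b + y)"
      by (rule mult_right_mono; simp add: D_def)+
    show ?thesis
    proof (cases "x = b")
      case True then show ?thesis using rb' D1 s by simp
    next
      case False
      then have x: "x \<in> B" using that by simp
      have "\<bar>r x\<bar> \<le> C * norm y" using C[OF x, of r] by (simp add: y_def)
      also have "norm y \<le> norm (r b *\<^sub>R b + y) + \<bar>r b\<bar> * norm b"
        using norm_triangle_ineq4[of "r b *\<^sub>R b + y" "r b *\<^sub>R b"] by simp
      also have "\<dots> \<le> norm (r b *\<^sub>R b + y) + (1 / d) * norm (r b *\<^sub>R b + y) * norm b"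
        using rb' by (intro add_left_mono mult_right_mono) auto
      also have "\<dots> = (1 + norm b / d) * norm (r b *\<^sub>R b + y)"
        by (simp add: algebra_simps)
      finally show ?thesis using D2 s Cpos by (simp add: mult_left_mono mult.assoc)
    qed
  qed
  then show ?case by blast
qed simp

text \<open>The coordinates are those of a basis, and the preceding bound makes them continuous.
  They take the place of a Euclidean basis throughout: a linear or multilinear expression becomes a
  finite sum with smooth coefficients.\<close>

lemma finite_dimensional_coordinates:
  assumes "finite_dimensional TYPE('e::real_normed_vector)"
  obtains B :: "'e::real_normed_vector set" and \<phi> :: "'e \<Rightarrow> 'e \<Rightarrow> real"
  where "finite B" and "\<And>b. bounded_linear (\<phi> b)" and "\<And>x. x = (\<Sum>b\<in>B. \<phi> b x *\<^sub>R b)"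
proof -
  obtain B0 :: "'e set" where B0: "finite B0" "span B0 = UNIV"
    using assms by (auto simp: finite_dimensional_def)
  obtain B where B: "B \<subseteq> B0" "independent B" "B0 \<subseteq> span B"
    using maximal_independent_subset[of B0] by blast
  have fin: "finite B" using B(1) B0(1) finite_subset by blast
  have sp: "span B = UNIV" using B(3) B0(2) span_mono[OF B(3)] by (simp add: span_span top.extremum_unique)
  obtain C where C: "\<And>r b. b \<in> B \<Longrightarrow> \<bar>r b\<bar> \<le> C * norm (\<Sum>b\<in>B. r b *\<^sub>R b)"
    using independent_coefficients_bounded[OF fin B(2)] by blast
  define \<phi> where "\<phi> b x = representation B x b" for b x
  have rep: "x = (\<Sum>b\<in>B. \<phi> b x *\<^sub>R b)" for x
    unfolding \<phi>_def using sum_representation_eq[OF B(2) _ fin order_refl, of x] sp by simp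
  have "bounded_linear (\<phi> b)" for b
  proof (rule bounded_linear_intro[where K = "if b \<in> B then C else 0"])
    show "\<phi> b (x + y) = \<phi> b x + \<phi> b y" for x y
      unfolding \<phi>_def using representation_add[OF B(2), of y x] sp by (simp add: add.commute)
    show "\<phi> b (r *\<^sub>R x) = r *\<^sub>R \<phi> b x" for r x
      unfolding \<phi>_def using representation_scale[OF B(2), of x r] sp by simp
    show "norm (\<phi> b x) \<le> norm x * (if b \<in> B then C else 0)" for x
    proof (cases "b \<in> B")
      case True
      then show ?thesis using C[OF True, of "\<lambda>b. \<phi> b x"] rep[of x] by (simp add: mult.commute)
    next
      case False
      then have "\<phi> b x = 0" unfolding \<phi>_def using representation_ne_zero by blast
      then show ?thesis using False by simp
    qed
  qed
  then show ?thesis using that fin rep by blast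
qed

lemma finite_dimensional_prod:
  assumes "finite_dimensional TYPE('a::real_vector)" and "finite_dimensional TYPE('b::real_vector)"
  shows "finite_dimensional TYPE('a \<times> 'b)"
proof -
  obtain A :: "'a set" and B :: "'b set"
    where A: "finite A" "span A = UNIV" and B: "finite B" "span B = UNIV"
    using assms by (auto simp: finite_dimensional_def)
  let ?C = "(\<lambda>a. (a, 0)) ` A \<union> (\<lambda>b. (0, b)) ` B"
  have "linear (\<lambda>a::'a. (a, 0::'b))" "linear (\<lambda>b::'b. (0::'a, b))"
    by (auto intro!: linearI)
  then have "span ((\<lambda>a. (a, 0::'b)) ` A) = range (\<lambda>a. (a, 0))"
    "span ((\<lambda>b. (0::'a, b)) ` B) = range (\<lambda>b. (0, b))"
    using A B by (simp_all add: linear_span_image)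
  then have "(a, 0) \<in> span ?C" "(0, b) \<in> span ?C" for a b
    using span_mono[of "(\<lambda>a. (a, 0::'b)) ` A" ?C] span_mono[of "(\<lambda>b. (0::'a, b)) ` B" ?C] by auto
  then have "(a, 0) + (0, b) \<in> span ?C" for a b by (rule span_add)
  then have "span ?C = UNIV" by auto
  then show ?thesis unfolding finite_dimensional_def using A B by (intro exI[of _ ?C]) auto
qed

lemma finite_dimensional_real: "finite_dimensional TYPE(real)"
proof -
  have "x \<in> span {1}" for x :: real
    using span_scale[OF span_base[of "1::real" "{1}"], of x] by simp
  then show ?thesis unfolding finite_dimensional_def by (intro exI[of _ "{1}"]) auto
qed

lemma linear_coordinates:
  assumes "linear L" and "x = (\<Sum>b\<in>B. r b *\<^sub>R b)"
  shows "L x = (\<Sum>b\<in>B. r b *\<^sub>R L b)"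
  unfolding assms(2) by (simp add: linear_sum[OF assms(1)] linear_scale[OF assms(1)])

section \<open>Smooth functions\<close>

lemma Ck_on_imp_continuous_on: "Ck_on k S f \<Longrightarrow> continuous_on S f"
  by (cases k) (auto intro: has_derivative_continuous_on)

lemma Ck_on_SucI:
  assumes "\<And>x. x \<in> S \<Longrightarrow> (f has_derivative f' x) (at x within S)"
    and "\<And>v. Ck_on k S (\<lambda>x. f' x v)"
  shows "Ck_on (Suc k) S f"
  using assms by auto

lemma Ck_on_Suc: "Ck_on (Suc k) S f \<Longrightarrow> Ck_on k S f"
proof (induction k arbitrary: f)
  case 0
  then show ?case using Ck_on_imp_continuous_on[of "Suc 0" S f] by simp
next
  case (Suc k)
  then show ?case unfolding Ck_on.simps(2)[of "Suc k"] by (subst Ck_on.simps(2)) metis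
qed

lemma Ck_on_subset: "Ck_on k S f \<Longrightarrow> S' \<subseteq> S \<Longrightarrow> Ck_on k S' f"
proof (induction k arbitrary: f)
  case (Suc k)
  then obtain f' where "\<forall>x\<in>S. (f has_derivative f' x) (at x within S)"
    "\<forall>v. Ck_on k S (\<lambda>x. f' x v)" by auto
  with Suc show ?case
    by (auto intro!: exI[of _ f'] intro: has_derivative_subset)
qed (auto intro: continuous_on_subset)

lemma Ck_on_cong: "(\<And>x. x \<in> S \<Longrightarrow> f x = g x) \<Longrightarrow> Ck_on k S f \<Longrightarrow> Ck_on k S g"
proof (induction k arbitrary: f g)
  case (Suc k)
  then show ?case by (auto intro: has_derivative_transform) (metis has_derivative_transform)
qed (auto cong: continuous_on_cong)

lemma Ck_on_const: "Ck_on k S (\<lambda>x. c)"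
  by (induction k arbitrary: c) (auto intro!: exI[of _ "\<lambda>x v. 0"])

lemma Ck_on_bounded_linear:
  assumes L: "bounded_linear L" shows "Ck_on k S f \<Longrightarrow> Ck_on k S (\<lambda>x. L (f x))"
proof (induction k arbitrary: f)
  case 0
  then show ?case using bounded_linear.continuous_on[OF L] by auto
next
  case (Suc k)
  then obtain f' where "\<forall>x\<in>S. (f has_derivative f' x) (at x within S)"
    "\<forall>v. Ck_on k S (\<lambda>x. f' x v)" by auto
  with Suc.IH show ?case
    by (auto intro!: exI[of _ "\<lambda>x v. L (f' x v)"] bounded_linear.has_derivative[OF L])
qed

lemma Ck_on_id: "Ck_on k S (\<lambda>x. x)"
  by (cases k) (auto intro!: exI[of _ "\<lambda>x v. v"] simp: Ck_on_const)

lemma Ck_on_add: "Ck_on k S f \<Longrightarrow> Ck_on k S g \<Longrightarrow> Ck_on k S (\<lambda>x. f x + g x)"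
proof (induction k arbitrary: f g)
  case (Suc k)
  obtain f' where "\<And>x. x \<in> S \<Longrightarrow> (f has_derivative f' x) (at x within S)"
    "\<And>v. Ck_on k S (\<lambda>x. f' x v)" using Suc.prems(1) by auto
  moreover obtain g' where "\<And>x. x \<in> S \<Longrightarrow> (g has_derivative g' x) (at x within S)"
    "\<And>v. Ck_on k S (\<lambda>x. g' x v)" using Suc.prems(2) by auto
  ultimately show ?case
    by (intro Ck_on_SucI[where f' = "\<lambda>x v. f' x v + g' x v"] has_derivative_add Suc.IH)
qed (auto intro!: continuous_intros)

lemma Ck_on_sum: "(\<And>i. i \<in> I \<Longrightarrow> Ck_on k S (f i)) \<Longrightarrow> Ck_on k S (\<lambda>x. \<Sum>i\<in>I. f i x)"
  by (induction I rule: infinite_finite_induct) (auto intro: Ck_on_add Ck_on_const)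

lemma Ck_on_scaleR: "Ck_on k S f \<Longrightarrow> Ck_on k S g \<Longrightarrow> Ck_on k S (\<lambda>x. f x *\<^sub>R g x)"
proof (induction k arbitrary: f g)
  case (Suc k)
  obtain f' where "\<And>x. x \<in> S \<Longrightarrow> (f has_derivative f' x) (at x within S)"
    "\<And>v. Ck_on k S (\<lambda>x. f' x v)" using Suc.prems(1) by auto
  moreover obtain g' where "\<And>x. x \<in> S \<Longrightarrow> (g has_derivative g' x) (at x within S)"
    "\<And>v. Ck_on k S (\<lambda>x. g' x v)" using Suc.prems(2) by auto
  moreover have "Ck_on k S f" "Ck_on k S g" using Suc.prems by (blast intro: Ck_on_Suc)+
  ultimately show ?case
    by (intro Ck_on_SucI[where f' = "\<lambda>x v. f x *\<^sub>R g' x v + f' x v *\<^sub>R g x"]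
        has_derivative_scaleR Ck_on_add Suc.IH)
qed (auto intro!: continuous_intros)

lemma Ck_on_mult:
  fixes f g :: "'a::real_normed_vector \<Rightarrow> real"
  shows "Ck_on k S f \<Longrightarrow> Ck_on k S g \<Longrightarrow> Ck_on k S (\<lambda>x. f x * g x)"
  using Ck_on_scaleR[of k S f g] by simp

text \<open>In the chain rule the outer derivative is applied to a direction that varies with the
  point, whereas \<open>Ck_on\<close> speaks about fixed directions. Expanding the direction in
  coordinates reduces one to the other; this is why the middle space must be
  finite-dimensional.\<close>

lemma Ck_on_compose:
  fixes f :: "'a::real_normed_vector \<Rightarrow> 'b::real_normed_vector"
  assumes fd: "finite_dimensional TYPE('a)" and "\<psi> ` S \<subseteq> T"
  shows "Ck_on k T f \<Longrightarrow> Ck_on k S \<psi> \<Longrightarrow> Ck_on k S (\<lambda>x. f (\<psi> x))"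
proof (induction k arbitrary: f)
  case 0
  then show ?case using assms(2) continuous_on_compose2 by auto
next
  case (Suc k)
  obtain B :: "'a set" and \<phi> where \<phi>: "finite B" "\<And>b. bounded_linear (\<phi> b)"
    and x: "\<And>x. x = (\<Sum>b\<in>B. \<phi> b x *\<^sub>R b)"
    using finite_dimensional_coordinates[OF fd] by blast
  obtain f' where f': "\<And>y. y \<in> T \<Longrightarrow> (f has_derivative f' y) (at y within T)"
    "\<And>v. Ck_on k T (\<lambda>y. f' y v)" using Suc.prems(1) by auto
  obtain \<psi>' where \<psi>': "\<And>x. x \<in> S \<Longrightarrow> (\<psi> has_derivative \<psi>' x) (at x within S)"
    "\<And>v. Ck_on k S (\<lambda>x. \<psi>' x v)" using Suc.prems(2) by auto
  have "((\<lambda>x. f (\<psi> x)) has_derivative (\<lambda>v. f' (\<psi> x) (\<psi>' x v))) (at x within S)" if "x \<in> S" for x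
    by (rule has_derivative_in_compose2[OF f'(1) assms(2) that \<psi>'(1)[OF that]])
  moreover have "Ck_on k S (\<lambda>x. f' (\<psi> x) (\<psi>' x v))" for v
  proof (rule Ck_on_cong)
    show "Ck_on k S (\<lambda>x. \<Sum>b\<in>B. \<phi> b (\<psi>' x v) *\<^sub>R f' (\<psi> x) b)"
      by (intro Ck_on_sum Ck_on_scaleR Ck_on_bounded_linear[OF \<phi>(2) \<psi>'(2)]
          Suc.IH[OF f'(2) Ck_on_Suc[OF Suc.prems(2)]])
    fix y assume "y \<in> S"
    then have lin: "linear (f' (\<psi> y))"
      using f'(1) assms(2) has_derivative_linear by blast
    show "(\<Sum>b\<in>B. \<phi> b (\<psi>' y v) *\<^sub>R f' (\<psi> y) b) = f' (\<psi> y) (\<psi>' y v)"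
      using linear_coordinates[OF lin x] by (rule sym)
  qed
  ultimately show ?case by (rule Ck_on_SucI)
qed

lemma Ck_on_inverse:
  fixes f :: "'a::real_normed_vector \<Rightarrow> real"
  assumes "\<And>x. x \<in> S \<Longrightarrow> f x \<noteq> 0"
  shows "Ck_on k S f \<Longrightarrow> Ck_on k S (\<lambda>x. inverse (f x))"
proof (induction k)
  case 0
  then show ?case using assms by (simp add: continuous_on_inverse)
next
  case (Suc k)
  obtain f' where f': "\<And>x. x \<in> S \<Longrightarrow> (f has_derivative f' x) (at x within S)"
    "\<And>v. Ck_on k S (\<lambda>x. f' x v)" using Suc.prems by auto
  have "Ck_on k S (\<lambda>x. inverse (f x))" using Suc Ck_on_Suc by blast
  then have "Ck_on k S (\<lambda>x. (-1) * (inverse (f x) * f' x v * inverse (f x)))" for v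
    using f' by (intro Ck_on_mult Ck_on_const)
  then show ?case using f' assms
    by (intro Ck_on_SucI[where f' = "\<lambda>x v. - (inverse (f x) * f' x v * inverse (f x))"])
      (simp_all add: has_derivative_inverse)
qed

lemma Ck_on_exp:
  fixes f :: "'a::real_normed_vector \<Rightarrow> real"
  shows "Ck_on k S f \<Longrightarrow> Ck_on k S (\<lambda>x. exp (f x))"
proof (induction k)
  case (Suc k)
  obtain f' where f': "\<And>x. x \<in> S \<Longrightarrow> (f has_derivative f' x) (at x within S)"
    "\<And>v. Ck_on k S (\<lambda>x. f' x v)" using Suc.prems by auto
  have "Ck_on k S (\<lambda>x. exp (f x))" using Suc Ck_on_Suc by blast
  then show ?case using f'
    by (intro Ck_on_SucI[where f' = "\<lambda>x v. exp (f x) * f' x v"] Ck_on_mult)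
      (auto intro!: derivative_eq_intros)
qed (auto intro!: continuous_intros)

text \<open>Prepares the smoothness of \<open>clock\<close>. Each function is, up to sign, the
  derivative of the other, hence the joint induction.\<close>

lemma Ck_on_sin_cos: "Ck_on k S (sin :: real \<Rightarrow> real) \<and> Ck_on k S (cos :: real \<Rightarrow> real)"
proof (induction k)
  case (Suc k)
  have "Ck_on (Suc k) S (sin :: real \<Rightarrow> real)"
    using Suc by (intro Ck_on_SucI[where f' = "\<lambda>x v. cos x * v"] Ck_on_mult Ck_on_const)
      (auto intro!: derivative_eq_intros)
  moreover have "Ck_on (Suc k) S (cos :: real \<Rightarrow> real)"
    using Suc by (intro Ck_on_SucI[where f' = "\<lambda>x v. sin x * - v"] Ck_on_mult Ck_on_const)
      (auto intro!: derivative_eq_intros)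
  ultimately show ?case by blast
qed (auto intro!: continuous_intros)

lemma Ck_on_Pair: "Ck_on k S f \<Longrightarrow> Ck_on k S g \<Longrightarrow> Ck_on k S (\<lambda>x. (f x, g x))"
proof (induction k arbitrary: f g)
  case (Suc k)
  obtain f' where "\<And>x. x \<in> S \<Longrightarrow> (f has_derivative f' x) (at x within S)"
    "\<And>v. Ck_on k S (\<lambda>x. f' x v)" using Suc.prems(1) by auto
  moreover obtain g' where "\<And>x. x \<in> S \<Longrightarrow> (g has_derivative g' x) (at x within S)"
    "\<And>v. Ck_on k S (\<lambda>x. g' x v)" using Suc.prems(2) by auto
  ultimately show ?case
    by (intro Ck_on_SucI[where f' = "\<lambda>x v. (f' x v, g' x v)"] has_derivative_Pair Suc.IH)
qed (auto intro!: continuous_intros)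

section \<open>Smooth functions and their derivatives on open sets\<close>

lemma smooth_on_imp_continuous_on: "smooth_on S f \<Longrightarrow> continuous_on S f"
  unfolding smooth_on_def using Ck_on_imp_continuous_on by blast

lemma smooth_on_subset: "smooth_on S f \<Longrightarrow> S' \<subseteq> S \<Longrightarrow> smooth_on S' f"
  unfolding smooth_on_def using Ck_on_subset by blast

lemma smooth_on_cong: "(\<And>x. x \<in> S \<Longrightarrow> f x = g x) \<Longrightarrow> smooth_on S f \<Longrightarrow> smooth_on S g"
  unfolding smooth_on_def using Ck_on_cong[of S f g] by blast

lemma smooth_on_const: "smooth_on S (\<lambda>x. c)"
  by (simp add: smooth_on_def Ck_on_const)

lemma smooth_on_id: "smooth_on S (\<lambda>x. x)"
  by (simp add: smooth_on_def Ck_on_id)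

lemma smooth_on_bounded_linear: "bounded_linear L \<Longrightarrow> smooth_on S f \<Longrightarrow> smooth_on S (\<lambda>x. L (f x))"
  by (simp add: smooth_on_def Ck_on_bounded_linear)

lemma smooth_on_add: "smooth_on S f \<Longrightarrow> smooth_on S g \<Longrightarrow> smooth_on S (\<lambda>x. f x + g x)"
  by (simp add: smooth_on_def Ck_on_add)

lemma smooth_on_sum: "(\<And>i. i \<in> I \<Longrightarrow> smooth_on S (f i)) \<Longrightarrow> smooth_on S (\<lambda>x. \<Sum>i\<in>I. f i x)"
  by (simp add: smooth_on_def Ck_on_sum)

lemma smooth_on_scaleR: "smooth_on S f \<Longrightarrow> smooth_on S g \<Longrightarrow> smooth_on S (\<lambda>x. f x *\<^sub>R g x)"
  by (simp add: smooth_on_def Ck_on_scaleR)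

lemma smooth_on_mult:
  fixes f g :: "'a::real_normed_vector \<Rightarrow> real"
  shows "smooth_on S f \<Longrightarrow> smooth_on S g \<Longrightarrow> smooth_on S (\<lambda>x. f x * g x)"
  using smooth_on_scaleR[of S f g] by simp

lemma smooth_on_diff:
  assumes "smooth_on S f" "smooth_on S g" shows "smooth_on S (\<lambda>x. f x - g x)"
  using smooth_on_add[OF assms(1) smooth_on_scaleR[OF smooth_on_const[of S "-1::real"] assms(2)]]
  by simp

lemma smooth_on_divide:
  fixes f g :: "'a::real_normed_vector \<Rightarrow> real"
  assumes "smooth_on S f" "smooth_on S g" "\<And>x. x \<in> S \<Longrightarrow> g x \<noteq> 0"
  shows "smooth_on S (\<lambda>x. f x / g x)"
  using smooth_on_mult[OF assms(1), of "\<lambda>x. inverse (g x)"] assms(2,3)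
  by (simp add: smooth_on_def Ck_on_inverse divide_inverse)

lemma smooth_on_exp:
  fixes f :: "'a::real_normed_vector \<Rightarrow> real"
  shows "smooth_on S f \<Longrightarrow> smooth_on S (\<lambda>x. exp (f x))"
  by (simp add: smooth_on_def Ck_on_exp)

lemma smooth_on_Pair: "smooth_on S f \<Longrightarrow> smooth_on S g \<Longrightarrow> smooth_on S (\<lambda>x. (f x, g x))"
  by (simp add: smooth_on_def Ck_on_Pair)

lemma smooth_on_compose:
  fixes f :: "'a::real_normed_vector \<Rightarrow> 'b::real_normed_vector"
  assumes "finite_dimensional TYPE('a)" and "smooth_on T f" and "smooth_on S \<psi>"
    and "\<And>x. x \<in> S \<Longrightarrow> \<psi> x \<in> T"
  shows "smooth_on S (\<lambda>x. f (\<psi> x))"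
  using assms Ck_on_compose[OF assms(1), of \<psi> S T] unfolding smooth_on_def by blast

lemma smooth_on_has_derivative:
  assumes "smooth_on S f" "open S" "x \<in> S"
  shows "(f has_derivative frechet_derivative f (at x)) (at x)"
proof -
  have "Ck_on (Suc 0) S f" using assms(1) unfolding smooth_on_def by blast
  then obtain f' where "(f has_derivative f') (at x within S)" using assms(3) by auto
  then have "f differentiable at x"
    using at_within_open[OF assms(3,2)] by (auto simp: differentiable_def)
  then show ?thesis by (simp add: frechet_derivative_works)
qed

lemma smooth_on_frechet_derivative:
  assumes "smooth_on S f" "open S"
  shows "smooth_on S (\<lambda>x. frechet_derivative f (at x) v)"
  unfolding smooth_on_def
proof
  fix k
  have "Ck_on (Suc k) S f" using assms(1) unfolding smooth_on_def by blast
  then obtain f' where f': "\<forall>x\<in>S. (f has_derivative f' x) (at x within S)"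
    "\<forall>v. Ck_on k S (\<lambda>x. f' x v)" by auto
  have "f' x = frechet_derivative f (at x)" if "x \<in> S" for x
    using f'(1) that at_within_open[OF that assms(2)] frechet_derivative_at by metis
  then show "Ck_on k S (\<lambda>x. frechet_derivative f (at x) v)"
    using f'(2) by (auto intro: Ck_on_cong[of S "\<lambda>x. f' x v"])
qed

text \<open>On an open set all local derivatives coincide with \<open>frechet_derivative\<close>, so
  they fit together. Needed because pullbacks are computed in charts that change from point to
  point.\<close>

lemma Ck_on_local:
  "(\<And>x. x \<in> S \<Longrightarrow> \<exists>W. open W \<and> x \<in> W \<and> Ck_on k (S \<inter> W) f) \<Longrightarrow> open S \<Longrightarrow> Ck_on k S f"
proof (induction k arbitrary: f)
  case 0
  then show ?case
    unfolding Ck_on.simps(1) continuous_on_eq_continuous_within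
    by (metis Int_iff at_within_open open_Int)
next
  case (Suc k)
  have ex: "\<exists>W f'. open W \<and> x \<in> W \<and> (\<forall>y\<in>S \<inter> W. (f has_derivative f' y) (at y)) \<and>
      (\<forall>v. Ck_on k (S \<inter> W) (\<lambda>y. f' y v))" if x: "x \<in> S" for x
  proof -
    obtain W where W: "open W" "x \<in> W" "Ck_on (Suc k) (S \<inter> W) f" using Suc.prems(1)[OF x] by blast
    moreover obtain f' where "\<forall>y\<in>S \<inter> W. (f has_derivative f' y) (at y within S \<inter> W)"
      "\<forall>v. Ck_on k (S \<inter> W) (\<lambda>y. f' y v)" using W(3) by auto
    moreover have "at y within S \<inter> W = at y" if "y \<in> S \<inter> W" for y
      using at_within_open[OF that] W(1) Suc.prems(2) by blast
    ultimately show ?thesis by metis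
  qed
  define D where "D y = frechet_derivative f (at y)" for y
  have D: "(f has_derivative D x) (at x within S)" if x: "x \<in> S" for x
  proof -
    obtain W f' where W: "x \<in> W" "\<forall>y\<in>S \<inter> W. (f has_derivative f' y) (at y)"
      using ex[OF x] by blast
    then have d: "(f has_derivative f' x) (at x)" using x by blast
    then have "f' x = D x" unfolding D_def by (rule frechet_derivative_at)
    then show ?thesis using d by (simp add: has_derivative_at_withinI)
  qed
  have "Ck_on k S (\<lambda>y. D y v)" for v
  proof (rule Suc.IH)
    fix x assume "x \<in> S"
    then obtain W f' where W: "open W" "x \<in> W" "\<forall>y\<in>S \<inter> W. (f has_derivative f' y) (at y)"
      "\<forall>v. Ck_on k (S \<inter> W) (\<lambda>y. f' y v)" using ex by blast
    have "D y = f' y" if "y \<in> S \<inter> W" for y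
      using frechet_derivative_at[of f "f' y" y] W(3) that unfolding D_def by auto
    then have "Ck_on k (S \<inter> W) (\<lambda>y. D y v)"
      using W(4) by (auto intro: Ck_on_cong[of _ "\<lambda>y. f' y v"])
    then show "\<exists>W. open W \<and> x \<in> W \<and> Ck_on k (S \<inter> W) (\<lambda>y. D y v)" using W by blast
  qed (rule Suc.prems(2))
  then show ?case using D by auto
qed

lemma smooth_on_local:
  assumes "open S" and "\<And>x. x \<in> S \<Longrightarrow> \<exists>W. open W \<and> x \<in> W \<and> smooth_on (S \<inter> W) f"
  shows "smooth_on S f"
  unfolding smooth_on_def
proof
  fix k show "Ck_on k S f"
  proof (rule Ck_on_local[OF _ assms(1)])
    fix x assume "x \<in> S"
    then obtain W where "open W" "x \<in> W" "smooth_on (S \<inter> W) f" using assms(2) by blast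
    then show "\<exists>W. open W \<and> x \<in> W \<and> Ck_on k (S \<inter> W) f"
      unfolding smooth_on_def by (intro exI[of _ W]) simp
  qed
qed

section \<open>Symmetry of second derivatives\<close>

text \<open>The mean value theorem twice: in direction \<open>u\<close> for the increment of
  \<open>f\<close> over the step \<open>h\<close> in direction \<open>v\<close>, then in direction
  \<open>v\<close> for the derivative in direction \<open>u\<close>. The box condition keeps all
  segments inside \<open>S\<close>.\<close>

lemma smooth_on_second_difference:
  fixes f :: "'a::real_normed_vector \<Rightarrow> real"
  assumes f: "smooth_on S f" and S: "open S" and h: "h > 0"
    and box: "\<And>s t. s \<in> {0..h} \<Longrightarrow> t \<in> {0..h} \<Longrightarrow> x + s *\<^sub>R u + t *\<^sub>R v \<in> S"
  shows "\<exists>s\<in>{0..h}. \<exists>t\<in>{0..h}. f (x + h *\<^sub>R u + h *\<^sub>R v) - f (x + h *\<^sub>R u) - f (x + h *\<^sub>R v) + f x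
    = h * (h * frechet_derivative (\<lambda>y. frechet_derivative f (at y) u) (at (x + s *\<^sub>R u + t *\<^sub>R v)) v)"
proof -
  define D where "D y = frechet_derivative f (at y)" for y
  define E where "E y = frechet_derivative (\<lambda>y. D y u) (at y) v" for y
  have fD: "(f has_derivative D y) (at y)" if "y \<in> S" for y
    unfolding D_def using smooth_on_has_derivative[OF f S that] .
  have Du: "((\<lambda>y. D y u) has_derivative frechet_derivative (\<lambda>y. D y u) (at y)) (at y)" if "y \<in> S" for y
    unfolding D_def by (rule smooth_on_has_derivative[OF smooth_on_frechet_derivative[OF f S] S that])
  have d1: "((\<lambda>s. f (a + s *\<^sub>R u)) has_real_derivative D (a + s *\<^sub>R u) u) (at s)"
    if "a + s *\<^sub>R u \<in> S" for a s
  proof -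
    have "((\<lambda>s. f (a + s *\<^sub>R u)) has_derivative (\<lambda>r. D (a + s *\<^sub>R u) (r *\<^sub>R u))) (at s)"
      by (rule has_derivative_compose[where f = "\<lambda>s. a + s *\<^sub>R u" and g = f, OF _ fD[OF that]])
        (auto intro!: derivative_eq_intros)
    then show ?thesis
      by (simp add: has_field_derivative_def linear_scale[OF has_derivative_linear[OF fD[OF that]]]
          mult.commute[of _ "D _ _"] mult_commute_abs)
  qed
  have d2: "((\<lambda>t. D (a + t *\<^sub>R v) u) has_real_derivative E (a + t *\<^sub>R v)) (at t)"
    if "a + t *\<^sub>R v \<in> S" for a t
  proof -
    have "((\<lambda>t. D (a + t *\<^sub>R v) u) has_derivative
        (\<lambda>r. frechet_derivative (\<lambda>y. D y u) (at (a + t *\<^sub>R v)) (r *\<^sub>R v))) (at t)"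
      by (rule has_derivative_compose[where f = "\<lambda>t. a + t *\<^sub>R v" and g = "\<lambda>y. D y u", OF _ Du[OF that]])
        (auto intro!: derivative_eq_intros)
    then show ?thesis unfolding E_def
      by (simp add: has_field_derivative_def linear_scale[OF has_derivative_linear[OF Du[OF that]]]
          mult_commute_abs)
  qed
  let ?q = "\<lambda>s. f (x + h *\<^sub>R v + s *\<^sub>R u) - f (x + s *\<^sub>R u)"
  have "\<exists>s>0. s < h \<and> ?q h - ?q 0 = (h - 0) * (D (x + h *\<^sub>R v + s *\<^sub>R u) u - D (x + s *\<^sub>R u) u)"
  proof (rule MVT2[OF h])
    fix s assume s: "0 \<le> s" "s \<le> h"
    show "(?q has_real_derivative D (x + h *\<^sub>R v + s *\<^sub>R u) u - D (x + s *\<^sub>R u) u) (at s)"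
      using box[of s h] box[of s 0] s h by (intro DERIV_diff d1) (auto simp: ac_simps)
  qed
  then obtain s where s: "s > 0" "s < h"
    "?q h - ?q 0 = h * (D (x + s *\<^sub>R u + h *\<^sub>R v) u - D (x + s *\<^sub>R u) u)"
    by (auto simp: ac_simps)
  have "\<exists>t>0. t < h \<and> D (x + s *\<^sub>R u + h *\<^sub>R v) u - D (x + s *\<^sub>R u + 0 *\<^sub>R v) u
      = (h - 0) * E (x + s *\<^sub>R u + t *\<^sub>R v)"
    using box[of s] s h by (intro MVT2 d2) auto
  then obtain t where "t > 0" "t < h"
    "D (x + s *\<^sub>R u + h *\<^sub>R v) u - D (x + s *\<^sub>R u) u = h * E (x + s *\<^sub>R u + t *\<^sub>R v)"
    by auto
  with s show ?thesis unfolding E_def D_def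
    by (intro bexI[of _ s] bexI[of _ t]) (auto simp: ac_simps)
qed

text \<open>The second difference is symmetric in \<open>u\<close> and \<open>v\<close>. So the two
  mixed derivatives take equal values at points arbitrarily close to \<open>x\<close>, and
  continuity excludes a gap between their values at \<open>x\<close>.\<close>

lemma smooth_on_second_derivative_symmetric_real:
  fixes f :: "'a::real_normed_vector \<Rightarrow> real"
  assumes f: "smooth_on S f" and S: "open S" and x: "x \<in> S"
  shows "frechet_derivative (\<lambda>y. frechet_derivative f (at y) u) (at x) v
    = frechet_derivative (\<lambda>y. frechet_derivative f (at y) v) (at x) u"
proof (rule ccontr)
  define E where "E u v y = frechet_derivative (\<lambda>y. frechet_derivative f (at y) u) (at y) v" for u v y
  assume "\<not> ?thesis"
  then have "\<bar>E u v x - E v u x\<bar> > 0" by (simp add: E_def)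
  then obtain e where e: "e > 0" "\<bar>E u v x - E v u x\<bar> = 2 * e" by (metis field_sum_of_halves half_gt_zero mult_2)
  have cont: "isCont (E u v) x" for u v
    unfolding E_def
    using smooth_on_imp_continuous_on[OF smooth_on_frechet_derivative[OF smooth_on_frechet_derivative[OF f S] S]]
      x S continuous_on_eq_continuous_at by blast
  obtain d1 where d1: "d1 > 0" "\<And>y. dist y x < d1 \<Longrightarrow> dist (E u v y) (E u v x) < e"
    using cont[of u v] e(1) unfolding continuous_at_eps_delta by blast
  obtain d2 where d2: "d2 > 0" "\<And>y. dist y x < d2 \<Longrightarrow> dist (E v u y) (E v u x) < e"
    using cont[of v u] e(1) unfolding continuous_at_eps_delta by blast
  obtain d3 where d3: "d3 > 0" "ball x d3 \<subseteq> S" using S x by (rule openE)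
  define d where "d = min d1 (min d2 d3)"
  \<comment> \<open>Keeps the parallelogram spanned by \<open>h *\<^sub>R u\<close> and
    \<open>h *\<^sub>R v\<close> within distance \<open>d\<close> of \<open>x\<close>; the summand 1
    makes the denominator positive.\<close>
  define h where "h = d / (norm u + norm v + 1)"
  have d: "d > 0" using d1 d2 d3 by (simp add: d_def)
  have pos: "norm u + norm v + 1 > 0" by (simp add: add_nonneg_pos)
  have h: "h > 0" unfolding h_def using d pos by simp
  have near: "dist (x + s *\<^sub>R u + t *\<^sub>R v) x < d" if "s \<in> {0..h}" "t \<in> {0..h}" for s t
  proof -
    have "dist (x + s *\<^sub>R u + t *\<^sub>R v) x \<le> \<bar>s\<bar> * norm u + \<bar>t\<bar> * norm v"
      by (simp add: dist_norm add.assoc) (metis norm_scaleR norm_triangle_ineq)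
    also have "\<dots> \<le> h * norm u + h * norm v"
      using that by (intro add_mono mult_right_mono) auto
    also have "\<dots> < h * (norm u + norm v + 1)" using h by (simp add: algebra_simps)
    also have "\<dots> = d" using pos by (simp add: h_def)
    finally show ?thesis .
  qed
  have inS: "x + s *\<^sub>R u + t *\<^sub>R v \<in> S" if "s \<in> {0..h}" "t \<in> {0..h}" for s t
    using near[OF that] d3 by (auto simp: d_def dist_commute)
  have inS': "x + s *\<^sub>R v + t *\<^sub>R u \<in> S" if "s \<in> {0..h}" "t \<in> {0..h}" for s t
    using inS[OF that(2,1)] by (simp add: ac_simps)
  obtain s t where st: "s \<in> {0..h}" "t \<in> {0..h}"
    "f (x + h *\<^sub>R u + h *\<^sub>R v) - f (x + h *\<^sub>R u) - f (x + h *\<^sub>R v) + f x = h * (h * E u v (x + s *\<^sub>R u + t *\<^sub>R v))"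
    using smooth_on_second_difference[OF f S h inS] unfolding E_def by blast
  obtain s' t' where st': "s' \<in> {0..h}" "t' \<in> {0..h}"
    "f (x + h *\<^sub>R v + h *\<^sub>R u) - f (x + h *\<^sub>R v) - f (x + h *\<^sub>R u) + f x = h * (h * E v u (x + s' *\<^sub>R v + t' *\<^sub>R u))"
    using smooth_on_second_difference[OF f S h inS'] unfolding E_def by blast
  have "h * (h * E u v (x + s *\<^sub>R u + t *\<^sub>R v)) = h * (h * E v u (x + t' *\<^sub>R u + s' *\<^sub>R v))"
    using st(3) st'(3) unfolding add.assoc[of x] add.commute[of "_ *\<^sub>R v" "_ *\<^sub>R u"] by linarith
  then have eq: "E u v (x + s *\<^sub>R u + t *\<^sub>R v) = E v u (x + t' *\<^sub>R u + s' *\<^sub>R v)"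
    using h by simp
  have "\<bar>E u v (x + s *\<^sub>R u + t *\<^sub>R v) - E u v x\<bar> < e"
    using d1(2)[of "x + s *\<^sub>R u + t *\<^sub>R v"] near[OF st(1,2)] by (simp add: d_def dist_real_def)
  moreover have "\<bar>E v u (x + t' *\<^sub>R u + s' *\<^sub>R v) - E v u x\<bar> < e"
    using d2(2)[of "x + t' *\<^sub>R u + s' *\<^sub>R v"] near[OF st'(2,1)] by (simp add: d_def dist_real_def)
  ultimately show False using eq e(2) by linarith
qed

lemma frechet_derivative_bounded_linear:
  assumes L: "bounded_linear L" and f: "f differentiable (at x)"
  shows "frechet_derivative (\<lambda>y. L (f y)) (at x) = (\<lambda>v. L (frechet_derivative f (at x) v))"
  using bounded_linear.has_derivative[OF L f[unfolded frechet_derivative_works]]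
  by (rule frechet_derivative_at[symmetric])

text \<open>Coordinate functionals commute with both derivatives, which reduces the claim to real
  functions.\<close>

lemma smooth_on_second_derivative_symmetric:
  fixes f :: "'a::real_normed_vector \<Rightarrow> 'b::real_normed_vector"
  assumes fd: "finite_dimensional TYPE('b)" and f: "smooth_on S f" and S: "open S" and x: "x \<in> S"
  shows "frechet_derivative (\<lambda>y. frechet_derivative f (at y) u) (at x) v
    = frechet_derivative (\<lambda>y. frechet_derivative f (at y) v) (at x) u"
proof -
  obtain B :: "'b set" and \<phi> where \<phi>: "finite B" "\<And>b. bounded_linear (\<phi> b)"
    and rep: "\<And>x. x = (\<Sum>b\<in>B. \<phi> b x *\<^sub>R b)"
    using finite_dimensional_coordinates[OF fd] by blast
  have diff: "f differentiable (at y)" if "y \<in> S" for y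
    using smooth_on_has_derivative[OF f S that] by (auto simp: differentiable_def)
  have diff2: "(\<lambda>y. frechet_derivative f (at y) u) differentiable (at x)" for u
    using smooth_on_has_derivative[OF smooth_on_frechet_derivative[OF f S] S x]
    by (auto simp: differentiable_def)
  have key: "\<phi> b (frechet_derivative (\<lambda>y. frechet_derivative f (at y) u) (at x) v) =
      frechet_derivative (\<lambda>y. frechet_derivative (\<lambda>y. \<phi> b (f y)) (at y) u) (at x) v" for b u v
  proof -
    have "((\<lambda>y. \<phi> b (frechet_derivative f (at y) u)) has_derivative
        frechet_derivative (\<lambda>y. \<phi> b (frechet_derivative f (at y) u)) (at x)) (at x)"
      using bounded_linear.has_derivative[OF \<phi>(2)] diff2 frechet_derivative_works
      by (metis differentiable_def)
    then have "((\<lambda>y. frechet_derivative (\<lambda>y. \<phi> b (f y)) (at y) u) has_derivative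
        frechet_derivative (\<lambda>y. \<phi> b (frechet_derivative f (at y) u)) (at x)) (at x)"
      by (rule has_derivative_transform_within_open[OF _ S x])
        (simp add: frechet_derivative_bounded_linear[OF \<phi>(2) diff])
    then have "frechet_derivative (\<lambda>y. frechet_derivative (\<lambda>y. \<phi> b (f y)) (at y) u) (at x) =
        frechet_derivative (\<lambda>y. \<phi> b (frechet_derivative f (at y) u)) (at x)"
      by (rule frechet_derivative_at[symmetric])
    then show ?thesis using frechet_derivative_bounded_linear[OF \<phi>(2) diff2] by simp
  qed
  have "\<phi> b (frechet_derivative (\<lambda>y. frechet_derivative f (at y) u) (at x) v)
      = \<phi> b (frechet_derivative (\<lambda>y. frechet_derivative f (at y) v) (at x) u)" for b
    unfolding key
    by (rule smooth_on_second_derivative_symmetric_real[OF smooth_on_bounded_linear[OF \<phi>(2) f] S x])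
  then show ?thesis by (subst (1 2) rep) simp
qed

lemma frechet_derivative_at_eq:
  "(f has_derivative f') (at x) \<Longrightarrow> frechet_derivative f (at x) v = f' v"
  using frechet_derivative_at[of f f' x] by simp

section \<open>Differentiation under the integral sign\<close>

text \<open>By compactness of \<open>{0..1}\<close>, the derivatives at points near \<open>p\<close>
  are close to those at \<open>p\<close> uniformly in \<open>s\<close>. The linearization error is
  then small relative to \<open>norm (q - p)\<close> with a bound that does not depend on
  \<open>s\<close>, and integration preserves the bound.\<close>

lemma has_derivative_integral_parameter:
  fixes \<phi> :: "'a::real_normed_vector \<times> real \<Rightarrow> real"
  assumes fd: "finite_dimensional TYPE('a)" and S: "open S" and \<phi>: "smooth_on (S \<times> UNIV) \<phi>"
    and p: "p \<in> S"
  shows "((\<lambda>p. integral {0..1} (\<lambda>s. \<phi> (p, s))) has_derivative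
    (\<lambda>v. integral {0..1} (\<lambda>s. frechet_derivative \<phi> (at (p, s)) (v, 0)))) (at p)"
proof -
  have SU: "open (S \<times> (UNIV :: real set))" using S by (simp add: open_Times)
  define D where "D q s v = frechet_derivative \<phi> (at (q, s)) (v, 0)" for q s v
  have D: "((\<lambda>q. \<phi> (q, s)) has_derivative D q s) (at q)" if "q \<in> S" for q s
    unfolding D_def
    by (rule has_derivative_compose[where f = "\<lambda>q. (q, s)" and g = \<phi>,
          OF _ smooth_on_has_derivative[OF \<phi> SU]])
      (use that in \<open>auto intro!: derivative_eq_intros\<close>)
  have lin: "linear (D q s)" if "q \<in> S" for q s using D[OF that] has_derivative_linear by blast
  have contD: "continuous_on (S \<times> UNIV) (\<lambda>(q, s). D q s v)" for v
    using smooth_on_imp_continuous_on[OF smooth_on_frechet_derivative[OF \<phi> SU]]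
    by (simp add: D_def case_prod_beta')
  have contDs: "continuous_on {0..1} (\<lambda>s. D p s v)" for v
    by (rule continuous_on_compose2[OF contD[of v], of _ "\<lambda>s. (p, s)", simplified])
      (use p in \<open>auto intro!: continuous_intros\<close>)
  have int\<phi>: "(\<lambda>s. \<phi> (q, s)) integrable_on {0..1}" if "q \<in> S" for q
    by (rule integrable_continuous_interval,
        rule continuous_on_compose2[OF smooth_on_imp_continuous_on[OF \<phi>]])
      (use that in \<open>auto intro!: continuous_intros\<close>)
  have intD: "(\<lambda>s. D p s v) integrable_on {0..1}" for v
    using contDs by (rule integrable_continuous_interval)
  obtain B :: "'a set" and \<psi> where \<psi>: "finite B" "\<And>b. bounded_linear (\<psi> b)"
    and rep: "\<And>x. x = (\<Sum>b\<in>B. \<psi> b x *\<^sub>R b)"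
    using finite_dimensional_coordinates[OF fd] by blast
  have Drep: "D q s v = (\<Sum>b\<in>B. \<psi> b v * D q s b)" if "q \<in> S" for q s v
    using linear_coordinates[OF lin[OF that] rep[of v]] by simp
  have "\<exists>K. \<forall>v. \<bar>\<psi> b v\<bar> \<le> norm v * K" for b
    using bounded_linear.bounded[OF \<psi>(2)] by simp
  then obtain K0 where K0: "\<And>b v. \<bar>\<psi> b v\<bar> \<le> norm v * K0 b" by metis
  \<comment> \<open>Turns estimates on basis vectors into estimates of the operator norm: a linear
    map with values of size at most \<open>e'\<close> on \<open>B\<close> has norm at most
    \<open>K * e'\<close>.\<close>
  define K where "K = (\<Sum>b\<in>B. \<bar>K0 b\<bar>)"
  have K: "(\<Sum>b\<in>B. \<bar>\<psi> b v\<bar>) \<le> norm v * K" for v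
    unfolding K_def sum_distrib_left
    by (intro sum_mono order_trans[OF K0] mult_left_mono) auto
  have K_nonneg: "K \<ge> 0" by (simp add: K_def sum_nonneg)
  define L where "L v = integral {0..1} (\<lambda>s. D p s v)" for v
  have Lrep: "L v = (\<Sum>b\<in>B. \<psi> b v * L b)" for v
  proof -
    have "L v = integral {0..1} (\<lambda>s. \<Sum>b\<in>B. \<psi> b v * D p s b)"
      unfolding L_def using Drep[OF p, of _ v] by simp
    also have "\<dots> = (\<Sum>b\<in>B. integral {0..1} (\<lambda>s. \<psi> b v * D p s b))"
      using \<psi>(1) intD by (intro integral_sum integrable_on_mult_right)
    finally show ?thesis by (simp add: L_def)
  qed
  have "bounded_linear (\<lambda>v. \<Sum>b\<in>B. \<psi> b v * L b)"
    by (intro bounded_linear_sum bounded_linear_compose[OF bounded_linear_mult_left \<psi>(2)])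
  moreover have "L = (\<lambda>v. \<Sum>b\<in>B. \<psi> b v * L b)" using Lrep by (rule ext)
  ultimately have bL: "bounded_linear L" by simp
  have main: "\<exists>d>0. \<forall>q. norm (q - p) < d \<longrightarrow>
      norm (integral {0..1} (\<lambda>s. \<phi> (q, s)) - integral {0..1} (\<lambda>s. \<phi> (p, s)) - L (q - p)) \<le> e * norm (q - p)"
    if e: "e > 0" for e
  proof -
    define e' where "e' = e / (K + 1)"
    have e': "e' > 0" using e K_nonneg by (simp add: e'_def)
    have "\<exists>X. open X \<and> p \<in> X \<and> (\<forall>q\<in>X \<inter> S. \<forall>s\<in>{0..1}. \<bar>D q s b - D p s b\<bar> \<le> e')" for b
    proof -
      obtain X where "p \<in> X" "open X"
        "\<forall>q\<in>X \<inter> S. \<forall>s\<in>{0..1}. dist ((\<lambda>(q, s). D q s b) (q, s)) ((\<lambda>(q, s). D q s b) (p, s)) \<le> e'"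
        by (rule continuous_on_prod_compactE[OF continuous_on_subset[OF contD[of b]] _ p e', where C = "{0..1}"])
          auto
      then show ?thesis by (auto simp: dist_real_def)
    qed
    then have "\<forall>b. \<exists>X. open X \<and> p \<in> X \<and> (\<forall>q\<in>X \<inter> S. \<forall>s\<in>{0..1}. \<bar>D q s b - D p s b\<bar> \<le> e')"
      by (rule allI)
    from choice[OF this] obtain X where X0: "\<forall>b. open (X b) \<and> p \<in> X b \<and>
      (\<forall>q\<in>X b \<inter> S. \<forall>s\<in>{0..1}. \<bar>D q s b - D p s b\<bar> \<le> e')" by (rule exE)
    have X: "open (X b)" "p \<in> X b"
      "q \<in> X b \<Longrightarrow> q \<in> S \<Longrightarrow> s \<in> {0..1} \<Longrightarrow> \<bar>D q s b - D p s b\<bar> \<le> e'" for b q s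
      using X0[rule_format, of b] by blast+
    have "open (S \<inter> (\<Inter>b\<in>B. X b))" "p \<in> S \<inter> (\<Inter>b\<in>B. X b)"
      using S X \<psi>(1) p by (auto intro!: open_Int open_INT)
    then obtain d where d: "d > 0" "ball p d \<subseteq> S \<inter> (\<Inter>b\<in>B. X b)" by (rule openE)
    have bound: "norm (\<phi> (q, s) - \<phi> (p, s) - D p s (q - p)) \<le> norm (q - p) * (K * e')"
      if q: "norm (q - p) < d" and s: "s \<in> {0..1}" for q s
    proof (rule differentiable_bound_linearization[where S = "ball p d" and f' = "\<lambda>q. D q s"])
      have qb: "q \<in> ball p d" "p \<in> ball p d" using q d(1) by (auto simp: dist_norm norm_minus_commute)
      show "p + t *\<^sub>R (q - p) \<in> ball p d" if "t \<in> {0..1}" for t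
      proof -
        have "norm (t *\<^sub>R (q - p)) \<le> 1 * norm (q - p)"
          using that unfolding norm_scaleR by (intro mult_right_mono) auto
        then show ?thesis using q by (simp add: dist_norm)
      qed
      show "((\<lambda>q. \<phi> (q, s)) has_derivative D x s) (at x within ball p d)" if "x \<in> ball p d" for x
      proof -
        have "x \<in> S" using d(2) that by blast
        then show ?thesis by (rule has_derivative_at_withinI[OF D])
      qed
      show "p \<in> ball p d" using qb by simp
      fix x assume x: "x \<in> ball p d"
      show "onorm (D x s - D p s) \<le> K * e'"
      proof (rule onorm_bound)
        show "0 \<le> K * e'" using K_nonneg e' by simp
        fix v
        have xS: "x \<in> S" using x d by blast
        have "(D x s - D p s) v = (\<Sum>b\<in>B. \<psi> b v * (D x s b - D p s b))"
          by (simp add: Drep[OF xS, of s v] Drep[OF p, of s v] sum_subtractf right_diff_distrib)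
        also have "norm \<dots> \<le> (\<Sum>b\<in>B. \<bar>\<psi> b v\<bar> * e')"
          by (intro sum_norm_le) (use X(3) x xS d s in \<open>auto simp: abs_mult intro!: mult_left_mono\<close>)
        also have "\<dots> \<le> norm v * K * e'"
          unfolding sum_distrib_right[symmetric] using K[of v] e' by (intro mult_right_mono) auto
        finally show "norm ((D x s - D p s) v) \<le> K * e' * norm v" by (simp add: mult_ac)
      qed
    qed
    have "norm (integral {0..1} (\<lambda>s. \<phi> (q, s)) - integral {0..1} (\<lambda>s. \<phi> (p, s)) - L (q - p)) \<le> e * norm (q - p)"
      if q: "norm (q - p) < d" for q
    proof -
      have qS: "q \<in> S" using q d(2) by (auto simp: dist_norm norm_minus_commute subset_iff)
      have i: "(\<lambda>s. \<phi> (q, s) - \<phi> (p, s) - D p s (q - p)) integrable_on {0..1}"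
        by (intro integrable_diff int\<phi> qS p intD)
      have "integral {0..1} (\<lambda>s. \<phi> (q, s)) - integral {0..1} (\<lambda>s. \<phi> (p, s)) - L (q - p)
          = integral {0..1} (\<lambda>s. \<phi> (q, s) - \<phi> (p, s) - D p s (q - p))"
        unfolding L_def by (simp add: integral_diff int\<phi> qS p intD integrable_diff)
      also have "norm \<dots> \<le> integral {0..1} (\<lambda>s::real. norm (q - p) * (K * e'))"
        using bound[OF q] by (intro integral_norm_bound_integral i) auto
      also have "\<dots> = norm (q - p) * (K * e')" by simp
      also have "\<dots> \<le> norm (q - p) * e"
        using K_nonneg e by (intro mult_left_mono) (auto simp: e'_def field_simps)
      finally show ?thesis by (simp add: mult.commute)
    qed
    then show ?thesis using d(1) by blast
  qed
  have "((\<lambda>p. integral {0..1} (\<lambda>s. \<phi> (p, s))) has_derivative L) (at p)"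
    by (rule has_derivative_at_alt[THEN iffD2]) (intro conjI allI impI bL main)
  moreover have "L = (\<lambda>v. integral {0..1} (\<lambda>s. frechet_derivative \<phi> (at (p, s)) (v, 0)))"
    by (simp only: L_def[abs_def] D_def)
  ultimately show ?thesis by simp
qed

text \<open>A directional derivative of the integral is the integral of another smooth integrand, so
  the induction on \<open>k\<close> has to range over all integrands.\<close>

lemma smooth_on_integral_parameter:
  fixes \<phi> :: "'a::real_normed_vector \<times> real \<Rightarrow> real"
  assumes fd: "finite_dimensional TYPE('a)" and S: "open S" and \<phi>: "smooth_on (S \<times> UNIV) \<phi>"
  shows "smooth_on S (\<lambda>p. integral {0..1} (\<lambda>s. \<phi> (p, s)))"
  unfolding smooth_on_def
proof
  fix k
  show "Ck_on k S (\<lambda>p. integral {0..1} (\<lambda>s. \<phi> (p, s)))" using \<phi>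
  proof (induction k arbitrary: \<phi>)
    case 0
    have "continuous_on S (\<lambda>p. integral {0..1} (\<lambda>s. \<phi> (p, s)))"
      using has_derivative_continuous[OF has_derivative_integral_parameter[OF fd S 0]]
        S continuous_on_eq_continuous_at by blast
    then show ?case by simp
  next
    case (Suc k)
    have "open (S \<times> (UNIV :: real set))" using S by (simp add: open_Times)
    then have "smooth_on (S \<times> UNIV) (\<lambda>p. frechet_derivative \<phi> (at p) (v, 0))" for v
      by (rule smooth_on_frechet_derivative[OF Suc.prems])
    then have ck: "Ck_on k S (\<lambda>p. integral {0..1} (\<lambda>s. frechet_derivative \<phi> (at (p, s)) (v, 0)))" for v
      using Suc.IH[of "\<lambda>p. frechet_derivative \<phi> (at p) (v, 0)"] by simp
    have der: "((\<lambda>p. integral {0..1} (\<lambda>s. \<phi> (p, s))) has_derivative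
        (\<lambda>v. integral {0..1} (\<lambda>s. frechet_derivative \<phi> (at (p, s)) (v, 0)))) (at p within S)"
      if "p \<in> S" for p
      by (rule has_derivative_at_withinI) (rule has_derivative_integral_parameter[OF fd S Suc.prems that])
    show ?case
    proof (rule Ck_on_SucI[where f' = "\<lambda>p v. integral {0..1}
          (\<lambda>s. frechet_derivative \<phi> (at (p, s)) (v, 0))"])
      fix p v
      show "((\<lambda>p. integral {0..1} (\<lambda>s. \<phi> (p, s))) has_derivative
        (\<lambda>v. integral {0..1} (\<lambda>s. frechet_derivative \<phi> (at (p, s)) (v, 0)))) (at p within S)"
        if "p \<in> S" using that by (rule der)
      show "Ck_on k S (\<lambda>p. integral {0..1} (\<lambda>s. frechet_derivative \<phi> (at (p, s)) (v, 0)))"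
        by (rule ck)
    qed
  qed
qed

section \<open>Multilinear and alternating forms\<close>

text \<open>Separated from \<open>alternating_form\<close> because exterior derivatives, wedge
  products and \<open>d_MN\<close> enter the later arguments only through their
  multilinearity.\<close>

definition multilinear_form :: "nat \<Rightarrow> ((nat \<Rightarrow> 'e::real_vector) \<Rightarrow> real) \<Rightarrow> bool" where
  "multilinear_form k a \<longleftrightarrow>
     (\<forall>v w. (\<forall>i<k. v i = w i) \<longrightarrow> a v = a w) \<and> (\<forall>v. \<forall>i<k. linear (\<lambda>u. a (v(i := u))))"

lemma alternating_imp_multilinear: "alternating_form k a \<Longrightarrow> multilinear_form k a"
  by (simp add: alternating_form_def multilinear_form_def)

lemma multilinear_cong: "multilinear_form k a \<Longrightarrow> (\<And>i. i < k \<Longrightarrow> v i = w i) \<Longrightarrow> a v = a w"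
  unfolding multilinear_form_def by blast

lemma multilinear_linear: "multilinear_form k a \<Longrightarrow> i < k \<Longrightarrow> linear (\<lambda>u. a (v(i := u)))"
  unfolding multilinear_form_def by blast

lemma multilinear_zero:
  assumes "multilinear_form k a" "i < k" "v i = 0" shows "a v = 0"
  using linear_0[OF multilinear_linear[OF assms(1,2), of v]] assms(3) by (metis fun_upd_triv)

lemma multilinear_add:
  "multilinear_form k a \<Longrightarrow> i < k \<Longrightarrow> a (v(i := x + y)) = a (v(i := x)) + a (v(i := y))"
  using linear_add[OF multilinear_linear] .

lemma multilinear_sum:
  assumes "multilinear_form k a" "i < k"
  shows "a (v(i := (\<Sum>b\<in>B. r b *\<^sub>R b))) = (\<Sum>b\<in>B. r b * a (v(i := b)))"
  using linear_coordinates[OF multilinear_linear[OF assms, of v] refl, of r B] by simp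

lemma multilinear_coordinate:
  assumes "multilinear_form k a" "i < k" "v i = (\<Sum>b\<in>B. r b *\<^sub>R b)"
  shows "a v = (\<Sum>b\<in>B. r b * a (v(i := b)))"
  using multilinear_sum[OF assms(1,2), of v r B] assms(3) by (metis fun_upd_triv)

lemma alternating_formI:
  assumes "multilinear_form k a"
    and "\<And>v i j. i < k \<Longrightarrow> j < k \<Longrightarrow> i \<noteq> j \<Longrightarrow> v i = v j \<Longrightarrow> a v = 0"
  shows "alternating_form k a"
  using assms unfolding alternating_form_def multilinear_form_def by blast

lemma alternating_zero:
  "alternating_form k a \<Longrightarrow> i < k \<Longrightarrow> j < k \<Longrightarrow> i \<noteq> j \<Longrightarrow> v i = v j \<Longrightarrow> a v = 0"
  unfolding alternating_form_def by blast

lemma multilinear_form_zero: "multilinear_form k (\<lambda>v. 0)"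
  by (simp add: multilinear_form_def linear_zero)

lemma multilinear_form_add:
  "multilinear_form k a \<Longrightarrow> multilinear_form k b \<Longrightarrow> multilinear_form k (\<lambda>v. a v + b v)"
  unfolding multilinear_form_def by (intro conjI allI impI linear_compose_add; metis)

lemma multilinear_form_scale:
  "multilinear_form k a \<Longrightarrow> multilinear_form k (\<lambda>v. c * a v)"
  unfolding multilinear_form_def
  by (intro conjI allI impI) (metis, drule conjunct2, simp add: linear_compose_scale_right[where 'b = real, simplified])

lemma multilinear_form_sum:
  "(\<And>i. i \<in> I \<Longrightarrow> multilinear_form k (a i)) \<Longrightarrow> multilinear_form k (\<lambda>v. \<Sum>i\<in>I. a i v)"
  by (induction I rule: infinite_finite_induct)
    (simp_all add: multilinear_form_zero multilinear_form_add)

lemma multilinear_form_compose: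
  assumes a: "multilinear_form k a" and L: "\<And>i. i < k \<Longrightarrow> linear (L i)"
  shows "multilinear_form k (\<lambda>v. a (\<lambda>i. L i (v i)))"
  unfolding multilinear_form_def
proof (intro conjI allI impI)
  fix v w :: "nat \<Rightarrow> 'b" assume "\<forall>i<k. v i = w i"
  then show "a (\<lambda>i. L i (v i)) = a (\<lambda>i. L i (w i))" by (intro multilinear_cong[OF a]) simp
next
  fix v :: "nat \<Rightarrow> 'b" and i assume i: "i < k"
  have "(\<lambda>j. L j ((v(i := u)) j)) = (\<lambda>j. L j (v j))(i := L i u)" for u by auto
  then have "(\<lambda>u. a (\<lambda>j. L j ((v(i := u)) j))) = (\<lambda>u. a ((\<lambda>j. L j (v j))(i := u))) \<circ> L i"
    by (simp add: comp_def)
  then show "linear (\<lambda>u. a (\<lambda>j. L j ((v(i := u)) j)))"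
    using linear_compose[OF L[OF i] multilinear_linear[OF a i]] by simp
qed

lemma alternating_form_zero: "alternating_form k (\<lambda>v. 0)"
  by (simp add: alternating_form_def linear_zero)

lemma alternating_form_add:
  assumes "alternating_form k a" "alternating_form k b"
  shows "alternating_form k (\<lambda>v. a v + b v)"
proof (rule alternating_formI)
  show "multilinear_form k (\<lambda>v. a v + b v)"
    by (intro multilinear_form_add alternating_imp_multilinear assms)
  show "a v + b v = 0" if "i < k" "j < k" "i \<noteq> j" "v i = v j" for v i j
    using alternating_zero[OF assms(1) that] alternating_zero[OF assms(2) that] by simp
qed

lemma alternating_form_scale:
  assumes "alternating_form k a" shows "alternating_form k (\<lambda>v. c * a v)"
proof (rule alternating_formI)
  show "multilinear_form k (\<lambda>v. c * a v)"
    by (intro multilinear_form_scale alternating_imp_multilinear assms)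
  show "c * a v = 0" if "i < k" "j < k" "i \<noteq> j" "v i = v j" for v i j
    using alternating_zero[OF assms(1) that] by simp
qed

lemma alternating_form_compose:
  assumes "alternating_form k a" "linear L" shows "alternating_form k (\<lambda>v. a (\<lambda>i. L (v i)))"
proof (rule alternating_formI)
  show "multilinear_form k (\<lambda>v. a (\<lambda>i. L (v i)))"
    by (rule multilinear_form_compose[OF alternating_imp_multilinear[OF assms(1)] assms(2)])
  show "a (\<lambda>i. L (v i)) = 0" if "i < k" "j < k" "i \<noteq> j" "v i = v j" for v i j
    using that by (intro alternating_zero[OF assms(1), of i j]) auto
qed

text \<open>Polarization: the form vanishes with \<open>x + y\<close> in both places.\<close>

lemma alternating_swap:
  assumes a: "alternating_form k a" and ij: "i < k" "j < k" "i \<noteq> j"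
  shows "a (v(i := y, j := x)) = - a (v(i := x, j := y))"
proof -
  note m = alternating_imp_multilinear[OF a]
  have z: "a (v(i := x, j := x)) = 0" for x using ij by (intro alternating_zero[OF a, of i j]) auto
  have c: "v(i := p, j := q) = v(j := q, i := p)" for p q using ij(3) by (rule fun_upd_twist)
  have "0 = a (v(i := x + y, j := x + y))" using z by simp
  also have "\<dots> = a (v(i := x + y, j := x)) + a (v(i := x + y, j := y))"
    by (rule multilinear_add[OF m ij(2)])
  also have "\<dots> = a (v(i := x, j := x)) + a (v(i := y, j := x)) + (a (v(i := x, j := y)) + a (v(i := y, j := y)))"
    unfolding c by (simp add: multilinear_add[OF m ij(1)])
  finally show ?thesis using z by simp
qed

lemma alternating_permute:
  assumes a: "alternating_form k a" and \<sigma>: "\<sigma> permutes {..<k}"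
  shows "a (\<lambda>i. v (\<sigma> i)) = of_int (sign \<sigma>) * a v"
  using \<sigma> finite_lessThan
proof (induction \<sigma> arbitrary: v rule: permutes_induct)
  case id
  show ?case by simp
next
  case (swap i j p)
  have "a (\<lambda>m. v (Transposition.transpose i j m)) = - a v"
  proof -
    have "(\<lambda>m. v (Transposition.transpose i j m)) = v(i := v j, j := v i)"
      by (auto simp: transpose_def fun_eq_iff)
    then show ?thesis using alternating_swap[OF a, of i j v "v j" "v i"] swap by simp
  qed
  moreover have "sign (Transposition.transpose i j \<circ> p) = - sign p"
    using swap permutation_permutes finite_lessThan
    by (subst sign_compose) (auto simp: sign_swap_id permutation_swap_id)
  ultimately show ?case using swap.IH[of "\<lambda>m. v (Transposition.transpose i j m)"]
    by (simp add: comp_def)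
qed

definition insert_arg :: "nat \<Rightarrow> 'e \<Rightarrow> (nat \<Rightarrow> 'e) \<Rightarrow> nat \<Rightarrow> 'e" where
  "insert_arg p s w = (\<lambda>j. if j < p then w j else if j = p then s else w (j - 1))"

text \<open>Moving \<open>s\<close> from position \<open>p\<close> to the front takes
  \<open>p\<close> swaps of neighbours.\<close>

lemma alternating_insert_arg:
  assumes a: "alternating_form k a"
  shows "p < k \<Longrightarrow> a (insert_arg p s w) = (-1) ^ p * a (insert_arg 0 s w)"
proof (induction p)
  case (Suc p)
  let ?w = "insert_arg p s w"
  have "insert_arg (Suc p) s w = ?w(p := w p, Suc p := s)"
    by (auto simp: insert_arg_def fun_eq_iff)
  moreover have "?w = ?w(p := s, Suc p := w p)"
    by (auto simp: insert_arg_def fun_eq_iff)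
  ultimately have "a (insert_arg (Suc p) s w) = - a ?w"
    using alternating_swap[OF a, of p "Suc p" ?w "w p" s] Suc.prems by simp
  then show ?case using Suc by simp
qed simp

text \<open>The second-order terms in the exterior derivative of a pullback cancel in pairs.\<close>

lemma alternating_symmetric_sum_zero:
  assumes a: "alternating_form k a" and s: "\<And>i j. s i j = s j i"
  shows "(\<Sum>i\<le>k. (-1) ^ i * (\<Sum>j<k. a ((omit i v)(j := s i (if j < i then j else Suc j))))) = (0::real)"
proof -
  define t where "t = (\<lambda>(i, j). (-1) ^ i * a ((omit i v)(j := s i (if j < i then j else Suc j))))"
  \<comment> \<open>In the numbering of \<open>v\<close>, the pair \<open>(i, j)\<close> omits index
    \<open>i\<close> and replaces the argument of index \<open>m\<close>, which is \<open>j\<close>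
    or \<open>Suc j\<close>. The involution exchanges \<open>i\<close> and \<open>m\<close>.\<close>
  define \<phi> where "\<phi> = (\<lambda>(i, j). if j < i then (j, i - 1) else (Suc j, i :: nat))"
  have pair: "t (Suc j, i) = - t (i, j)" if "i \<le> j" "j < k" for i j
  proof -
    \<comment> \<open>\<open>v\<close> without the two indices \<open>i\<close> and
      \<open>Suc j\<close>. Both terms of a pair arise from it by inserting the same vector, at
      position \<open>j\<close> or at position \<open>i\<close>; the remaining signs differ by one
      factor -1.\<close>
    define w where "w = (\<lambda>m. if m < i then v m else if m < j then v (Suc m) else v (Suc (Suc m)))"
    have 1: "(omit i v)(j := s i (Suc j)) = insert_arg j (s i (Suc j)) w"
      using that by (auto simp: omit_def insert_arg_def w_def fun_eq_iff)
    have 2: "(omit (Suc j) v)(i := s i (Suc j)) = insert_arg i (s i (Suc j)) w"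
      using that by (auto simp: omit_def insert_arg_def w_def fun_eq_iff)
    have "t (i, j) = (-1) ^ i * (-1) ^ j * a (insert_arg 0 (s i (Suc j)) w)"
      using that by (simp add: t_def 1 alternating_insert_arg[OF a, of j])
    moreover have "t (Suc j, i) = (-1) ^ Suc j * (-1) ^ i * a (insert_arg 0 (s i (Suc j)) w)"
      using that by (simp add: t_def s[of "Suc j"] 2 alternating_insert_arg[OF a, of i])
    ultimately show ?thesis by simp
  qed
  have anti: "t (\<phi> x) = - t x" if "x \<in> {..k} \<times> {..<k}" for x
  proof -
    obtain i j where x: "x = (i, j)" by (cases x)
    show ?thesis
    proof (cases "j < i")
      case True
      then obtain i' where i': "i = Suc i'" "j \<le> i'" by (cases i) auto
      then show ?thesis using pair[of j i'] that by (simp add: x \<phi>_def)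
    next
      case False
      then show ?thesis using pair[of i j] that by (simp add: x \<phi>_def)
    qed
  qed
  have "sum t ({..k} \<times> {..<k}) = sum (\<lambda>x. - t x) ({..k} \<times> {..<k})"
    by (rule sum.reindex_bij_witness[of _ \<phi> \<phi>]) (auto simp: \<phi>_def anti[unfolded \<phi>_def] split: if_splits)
  then have "sum t ({..k} \<times> {..<k}) = 0" by (simp add: sum_negf)
  then show ?thesis by (simp add: t_def sum.cartesian_product[symmetric] sum_distrib_left)
qed

section \<open>Multilinear forms with variable arguments\<close>

text \<open>Smoothness is assumed for constant arguments only. The induction lets the first
  \<open>m\<close> arguments vary: expanding argument \<open>m\<close> in coordinates leaves forms
  in which it is constant.\<close>

lemma smooth_on_multilinear:
  fixes a :: "'x::real_normed_vector \<Rightarrow> (nat \<Rightarrow> 'e::real_normed_vector) \<Rightarrow> real"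
  assumes fd: "finite_dimensional TYPE('e)"
    and a: "\<And>p. p \<in> S \<Longrightarrow> multilinear_form k (a p)"
    and sm: "\<And>v. smooth_on S (\<lambda>p. a p v)" and V: "\<And>i. i < k \<Longrightarrow> smooth_on S (V i)"
  shows "smooth_on S (\<lambda>p. a p (\<lambda>i. V i p))"
proof -
  obtain B :: "'e set" and \<phi> where \<phi>: "finite B" "\<And>b. bounded_linear (\<phi> b)"
    and rep: "\<And>x. x = (\<Sum>b\<in>B. \<phi> b x *\<^sub>R b)"
    using finite_dimensional_coordinates[OF fd] by blast
  have "smooth_on S (\<lambda>p. a p (\<lambda>i. if i < m then V i p else w i))" if "m \<le> k" for m w
    using that
  proof (induction m arbitrary: w)
    case 0
    show ?case using sm by simp
  next
    case (Suc m)
    have m: "m < k" "m \<le> k" using Suc.prems by auto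
    have "smooth_on S (\<lambda>p. \<Sum>b\<in>B. \<phi> b (V m p) * a p (\<lambda>i. if i < m then V i p else (w(m := b)) i))"
      by (intro smooth_on_sum smooth_on_mult smooth_on_bounded_linear[OF \<phi>(2) V[OF m(1)]] Suc.IH[OF m(2)])
    then show ?case
    proof (rule smooth_on_cong[rotated])
      fix p assume p: "p \<in> S"
      have "(\<lambda>i. if i < Suc m then V i p else w i)(m := b) = (\<lambda>i. if i < m then V i p else (w(m := b)) i)" for b
        by auto
      then show "(\<Sum>b\<in>B. \<phi> b (V m p) * a p (\<lambda>i. if i < m then V i p else (w(m := b)) i))
          = a p (\<lambda>i. if i < Suc m then V i p else w i)"
        using multilinear_coordinate[OF a[OF p] m(1), of "\<lambda>i. if i < Suc m then V i p else w i"
            "\<lambda>b. \<phi> b (V m p)" B] rep[of "V m p"] by simp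
    qed
  qed
  from this[of k "\<lambda>i. 0"] show ?thesis
    by (rule smooth_on_cong[rotated]) (auto intro!: multilinear_cong[OF a])
qed

text \<open>The product rule, one term for the form and one for each argument. As for smoothness,
  the constant arguments are made variable one after the other.\<close>

lemma has_derivative_multilinear:
  fixes a :: "'x::real_normed_vector \<Rightarrow> (nat \<Rightarrow> 'e::real_normed_vector) \<Rightarrow> real"
  assumes fd: "finite_dimensional TYPE('e)" and S: "open S" "p \<in> S"
    and a: "\<And>p. p \<in> S \<Longrightarrow> multilinear_form k (a p)"
    and a': "\<And>v. ((\<lambda>q. a q v) has_derivative a' v) (at p)"
    and V: "\<And>i. i < k \<Longrightarrow> (V i has_derivative V' i) (at p)"
  shows "((\<lambda>q. a q (\<lambda>i. V i q)) has_derivative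
    (\<lambda>h. a' (\<lambda>i. V i p) h + (\<Sum>i<k. a p ((\<lambda>i. V i p)(i := V' i h))))) (at p)"
proof -
  obtain B :: "'e set" and \<phi> where \<phi>: "finite B" "\<And>b. bounded_linear (\<phi> b)"
    and rep: "\<And>x. x = (\<Sum>b\<in>B. \<phi> b x *\<^sub>R b)"
    using finite_dimensional_coordinates[OF fd] by blast
  \<comment> \<open>The derivative inherits linearity in each argument from the form, by uniqueness
    of derivatives.\<close>
  have a'sum: "(\<Sum>b\<in>B. \<phi> b (v m) * a' (v(m := b)) h) = a' v h" if m: "m < k" for v m h
  proof -
    have "((\<lambda>q. \<Sum>b\<in>B. \<phi> b (v m) * a q (v(m := b))) has_derivative
        (\<lambda>h. \<Sum>b\<in>B. \<phi> b (v m) * a' (v(m := b)) h)) (at p)"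
      by (intro has_derivative_sum has_derivative_mult_right a')
    then have "((\<lambda>q. a q v) has_derivative (\<lambda>h. \<Sum>b\<in>B. \<phi> b (v m) * a' (v(m := b)) h)) (at p)"
      by (rule has_derivative_transform_within_open[OF _ S])
        (use multilinear_coordinate[OF a m rep] in simp)
    then show ?thesis using has_derivative_unique[OF _ a'[of v]] by metis
  qed
  have "((\<lambda>q. a q (\<lambda>i. if i < m then V i q else w i)) has_derivative
      (\<lambda>h. a' (\<lambda>i. if i < m then V i p else w i) h +
        (\<Sum>i<m. a p ((\<lambda>i. if i < m then V i p else w i)(i := V' i h))))) (at p)" if "m \<le> k" for m w
    using that
  proof (induction m arbitrary: w)
    case 0
    show ?case using a' by simp
  next
    case (Suc m)
    have m: "m < k" "m \<le> k" using Suc.prems by auto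
    define x where "x b q = (\<lambda>i. if i < m then V i q else (w(m := b)) i)" for b q
    define y where "y q = (\<lambda>i. if i < Suc m then V i q else w i)" for q
    have ym: "y q m = V m q" for q by (simp add: y_def)
    have xy: "x b q = (y q)(m := b)" for b q by (auto simp: x_def y_def)
    have IH: "((\<lambda>q. a q (x b q)) has_derivative
        (\<lambda>h. a' (x b p) h + (\<Sum>i<m. a p ((x b p)(i := V' i h))))) (at p)" for b
      unfolding x_def by (rule Suc.IH[OF m(2)])
    have ay: "a q z = (\<Sum>b\<in>B. \<phi> b (z m) * a q (z(m := b)))" if "q \<in> S" for q z
      by (rule multilinear_coordinate[OF a[OF that] m(1) rep])
    have "((\<lambda>q. \<Sum>b\<in>B. \<phi> b (V m q) * a q (x b q)) has_derivative
      (\<lambda>h. \<Sum>b\<in>B. \<phi> b (V m p) * (a' (x b p) h + (\<Sum>i<m. a p ((x b p)(i := V' i h)))) +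
          \<phi> b (V' m h) * a p (x b p))) (at p)"
      by (intro has_derivative_sum has_derivative_mult IH
          bounded_linear.has_derivative[OF \<phi>(2) V[OF m(1)]])
    then have "((\<lambda>q. a q (y q)) has_derivative
      (\<lambda>h. \<Sum>b\<in>B. \<phi> b (V m p) * (a' (x b p) h + (\<Sum>i<m. a p ((x b p)(i := V' i h)))) +
          \<phi> b (V' m h) * a p (x b p))) (at p)"
      by (rule has_derivative_transform_within_open[OF _ S])
        (use ay[of _ "y _"] in \<open>simp add: ym xy\<close>)
    moreover have "(\<Sum>b\<in>B. \<phi> b (V m p) * (a' (x b p) h + (\<Sum>i<m. a p ((x b p)(i := V' i h)))) +
          \<phi> b (V' m h) * a p (x b p)) = a' (y p) h + (\<Sum>i<Suc m. a p ((y p)(i := V' i h)))" for h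
    proof -
      have 1: "(\<Sum>b\<in>B. \<phi> b (V m p) * a' (x b p) h) = a' (y p) h"
        using a'sum[OF m(1), of "y p" h] by (simp add: ym xy)
      have 2: "(\<Sum>b\<in>B. \<phi> b (V m p) * a p ((x b p)(i := V' i h))) = a p ((y p)(i := V' i h))"
        if "i < m" for i
        using ay[OF S(2), of "(y p)(i := V' i h)"] that
        by (simp add: ym xy fun_upd_twist[of i m])
      have 3: "(\<Sum>b\<in>B. \<phi> b (V' m h) * a p (x b p)) = a p ((y p)(m := V' m h))"
        using ay[OF S(2), of "(y p)(m := V' m h)"] by (simp add: xy)
      have "(\<Sum>b\<in>B. \<phi> b (V m p) * (a' (x b p) h + (\<Sum>i<m. a p ((x b p)(i := V' i h)))) +
          \<phi> b (V' m h) * a p (x b p))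
        = (\<Sum>b\<in>B. \<phi> b (V m p) * a' (x b p) h)
          + (\<Sum>b\<in>B. \<Sum>i<m. \<phi> b (V m p) * a p ((x b p)(i := V' i h)))
          + (\<Sum>b\<in>B. \<phi> b (V' m h) * a p (x b p))"
        by (simp add: sum.distrib distrib_left sum_distrib_left)
      also have "(\<Sum>b\<in>B. \<Sum>i<m. \<phi> b (V m p) * a p ((x b p)(i := V' i h)))
          = (\<Sum>i<m. a p ((y p)(i := V' i h)))"
        by (subst sum.swap) (simp add: 2)
      also have "(\<Sum>b\<in>B. \<phi> b (V m p) * a' (x b p) h) + (\<Sum>i<m. a p ((y p)(i := V' i h)))
          + (\<Sum>b\<in>B. \<phi> b (V' m h) * a p (x b p))
        = a' (y p) h + (\<Sum>i<Suc m. a p ((y p)(i := V' i h)))"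
        by (simp only: 1 3 sum.lessThan_Suc add.assoc)
      finally show ?thesis .
    qed
    ultimately have "((\<lambda>q. a q (y q)) has_derivative
        (\<lambda>h. a' (y p) h + (\<Sum>i<Suc m. a p ((y p)(i := V' i h))))) (at p)" by (simp only:)
    then show ?case unfolding y_def .
  qed
  from this[of k "\<lambda>i. 0"]
  have D: "((\<lambda>q. a q (\<lambda>i. if i < k then V i q else 0)) has_derivative
      (\<lambda>h. a' (\<lambda>i. if i < k then V i p else 0) h +
        (\<Sum>i<k. a p ((\<lambda>i. if i < k then V i p else 0)(i := V' i h))))) (at p)" by simp
  have "a' (\<lambda>i. if i < k then V i p else 0) = a' (\<lambda>i. V i p)"
  proof (rule has_derivative_unique[OF _ a'])
    show "((\<lambda>q. a q (\<lambda>i. V i p)) has_derivative a' (\<lambda>i. if i < k then V i p else 0)) (at p)"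
      by (rule has_derivative_transform_within_open[OF a'[of "\<lambda>i. if i < k then V i p else 0"] S])
        (auto intro!: multilinear_cong[OF a])
  qed
  moreover have "a p ((\<lambda>i. if i < k then V i p else 0)(i := V' i h)) = a p ((\<lambda>i. V i p)(i := V' i h))"
    for i h
    by (rule multilinear_cong[OF a[OF S(2)]]) auto
  ultimately have "((\<lambda>q. a q (\<lambda>i. if i < k then V i q else 0)) has_derivative
      (\<lambda>h. a' (\<lambda>i. V i p) h + (\<Sum>i<k. a p ((\<lambda>i. V i p)(i := V' i h))))) (at p)"
    using D by (simp only:)
  then show ?thesis
  proof (rule has_derivative_transform_within_open[OF _ S])
    show "a q (\<lambda>i. if i < k then V i q else 0) = a q (\<lambda>i. V i q)" if "q \<in> S" for q
      by (rule multilinear_cong[OF a[OF that]]) simp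
  qed
qed

section \<open>Components of a bidegree\<close>

definition split_args :: "('e \<Rightarrow> 'e) \<Rightarrow> nat set \<Rightarrow> (nat \<Rightarrow> 'e::real_vector) \<Rightarrow> nat \<Rightarrow> 'e" where
  "split_args P S w = (\<lambda>i. if i \<in> S then w i - P (w i) else P (w i))"

lemma component_at_split_args:
  "component_at P u k a w = (\<Sum>S | S \<subseteq> {..<k} \<and> card S = u. a (split_args P S w))"
  by (simp add: component_at_def split_args_def)

lemma finite_subsets_card: "finite {S. S \<subseteq> {..<k::nat} \<and> card S = u}"
  by (rule finite_subset[of _ "Pow {..<k}"]) auto

text \<open>Each argument is the sum of its two parts. Splitting argument \<open>m\<close> doubles
  the family of index sets: those without \<open>m\<close> take the part \<open>P (w m)\<close>,
  those with \<open>m\<close> the complementary one.\<close>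

lemma multilinear_split_sum:
  assumes a: "multilinear_form k a"
  shows "a w = (\<Sum>S\<in>Pow {..<k}. a (split_args P S w))"
proof -
  have "a w = (\<Sum>S\<in>Pow {..<m}. a (\<lambda>i. if i < m then split_args P S w i else w i))" if "m \<le> k" for m
    using that
  proof (induction m)
    case (Suc m)
    have m: "m < k" "m \<le> k" using Suc.prems by auto
    let ?f = "\<lambda>m S i. if i < m then split_args P S w i else w i"
    have step: "a (?f m S) = a (?f (Suc m) S) + a (?f (Suc m) (insert m S))" if "S \<subseteq> {..<m}" for S
    proof -
      have "m \<notin> S" using that by auto
      then have 1: "?f (Suc m) S = (?f m S)(m := P (w m))"
        and 2: "?f (Suc m) (insert m S) = (?f m S)(m := w m - P (w m))"
        by (auto simp: split_args_def fun_eq_iff)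
      have 3: "?f m S = (?f m S)(m := P (w m) + (w m - P (w m)))" by (auto simp: fun_eq_iff)
      show ?thesis unfolding 1 2 by (subst 3) (rule multilinear_add[OF a m(1)])
    qed
    have "a w = (\<Sum>S\<in>Pow {..<m}. a (?f m S))" by (rule Suc.IH[OF m(2)])
    also have "\<dots> = (\<Sum>S\<in>Pow {..<m}. a (?f (Suc m) S) + a (?f (Suc m) (insert m S)))"
      by (rule sum.cong[OF refl]) (rule step, simp)
    also have "\<dots> = (\<Sum>S\<in>Pow {..<m}. a (?f (Suc m) S)) + (\<Sum>S\<in>insert m ` Pow {..<m}. a (?f (Suc m) S))"
    proof -
      have "inj_on (insert m) (Pow {..<m})"
      proof (rule inj_onI)
        fix S T assume "S \<in> Pow {..<m}" "T \<in> Pow {..<m}" and eq: "insert m S = insert m T"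
        then have "m \<notin> S" "m \<notin> T" by auto
        then show "S = T" using eq by (rule insert_ident[THEN iffD1])
      qed
      then show ?thesis by (simp only: sum.distrib sum.reindex comp_def)
    qed
    also have "\<dots> = (\<Sum>S\<in>Pow {..<Suc m}. a (?f (Suc m) S))"
      unfolding lessThan_Suc Pow_insert by (rule sum.union_disjoint[symmetric]) auto
    finally show ?case .
  qed simp
  from this[of k] have "a w = (\<Sum>S\<in>Pow {..<k}. a (\<lambda>i. if i < k then split_args P S w i else w i))" by simp
  also have "\<dots> = (\<Sum>S\<in>Pow {..<k}. a (split_args P S w))"
    by (rule sum.cong[OF refl]) (rule multilinear_cong[OF a], simp)
  finally show ?thesis .
qed

text \<open>The component keeps those terms of the full expansion whose index set has
  \<open>u\<close> elements.\<close>

lemma component_at_eq_self: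
  assumes a: "multilinear_form k a"
    and z: "\<And>S. S \<subseteq> {..<k} \<Longrightarrow> card S \<noteq> u \<Longrightarrow> a (split_args P S w) = 0"
  shows "component_at P u k a w = a w"
  unfolding component_at_split_args multilinear_split_sum[OF a, of w P]
  by (rule sum.mono_neutral_left) (auto intro: z)

lemma multilinear_form_component_at:
  assumes "multilinear_form k a" "linear P"
  shows "multilinear_form k (component_at P u k a)"
proof -
  have lin: "linear (\<lambda>x. if i \<in> S then x - P x else P x)" for S and i :: nat
    using assms(2) by (cases "i \<in> S") (auto intro: linear_compose_sub[OF linear_id[unfolded id_def]])
  show ?thesis
    unfolding component_at_def[abs_def]
    by (intro multilinear_form_sum multilinear_form_compose[OF assms(1) lin])
qed

text \<open>Exchanging two equal arguments permutes the index sets of size \<open>u\<close> and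
  changes the sign of each term, so the sum equals its own negative.\<close>

lemma alternating_form_component_at:
  assumes a: "alternating_form k a" and P: "linear P"
  shows "alternating_form k (component_at P u k a)"
proof (rule alternating_formI)
  show "multilinear_form k (component_at P u k a)"
    by (rule multilinear_form_component_at[OF alternating_imp_multilinear[OF a] P])
  fix v :: "nat \<Rightarrow> 'a" and i j assume ij: "i < k" "j < k" "i \<noteq> j" and eq: "v i = v j"
  let ?\<tau> = "Transposition.transpose i j"
  let ?F = "{S. S \<subseteq> {..<k} \<and> card S = u}"
  have \<tau>: "?\<tau> permutes {..<k}" using ij by (intro permutes_swap_id) auto
  have v\<tau>: "v (?\<tau> m) = v m" for m using eq by (auto simp: Transposition.transpose_def)
  have "split_args P (?\<tau> ` S) v = (\<lambda>m. split_args P S v (?\<tau> m))" for S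
  proof
    fix m
    have "m \<in> ?\<tau> ` S \<longleftrightarrow> ?\<tau> m \<in> S"
      by (metis image_iff transpose_involutory)
    then show "split_args P (?\<tau> ` S) v m = split_args P S v (?\<tau> m)"
      by (simp add: split_args_def v\<tau>)
  qed
  then have anti: "a (split_args P (?\<tau> ` S) v) = - a (split_args P S v)" for S
    using alternating_permute[OF a \<tau>, of "split_args P S v"] ij by (simp add: sign_swap_id)
  have img: "?\<tau> ` S \<in> ?F" if "S \<in> ?F" for S
  proof -
    have "?\<tau> ` S \<subseteq> {..<k}" using that permutes_image[OF \<tau>] by blast
    moreover have "card (?\<tau> ` S) = card S"
      by (intro card_image inj_on_subset[OF permutes_inj[OF \<tau>]]) simp
    ultimately show ?thesis using that by simp
  qed
  have "(\<Sum>S\<in>?F. a (split_args P S v)) = (\<Sum>S\<in>?F. - a (split_args P S v))"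
    by (rule sum.reindex_bij_witness[of _ "(`) ?\<tau>" "(`) ?\<tau>"])
      (simp_all only: img anti minus_minus, simp_all add: image_image)
  then show "component_at P u k a v = 0"
    by (simp add: component_at_split_args sum_negf)
qed

text \<open>With \<open>T\<close> the leaf directions this is the number of leafwise arguments.
  Since no complement of \<open>T\<close> occurs, the number cannot drop under a linear map that
  preserves leaf directions.\<close>

definition count_in :: "'e set \<Rightarrow> nat \<Rightarrow> (nat \<Rightarrow> 'e) \<Rightarrow> nat" where
  "count_in T k w = card {i. i < k \<and> w i \<in> T}"

text \<open>Only \<open>v\<close> positions lie outside an index set of size \<open>u\<close>, so
  some argument from \<open>T\<close> falls into it, and the complementary part of that argument is
  0.\<close>

lemma component_at_count:
  assumes a: "multilinear_form (u + v) a" and PT: "\<And>x. x \<in> T \<Longrightarrow> P x = x"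
    and w: "count_in T (u + v) w > v"
  shows "component_at P u (u + v) a w = 0"
  unfolding component_at_split_args
proof (rule sum.neutral, intro ballI)
  fix S assume "S \<in> {S. S \<subseteq> {..<u + v} \<and> card S = u}"
  then have S: "S \<subseteq> {..<u + v}" "card S = u" by auto
  have "\<exists>i\<in>S. w i \<in> T"
  proof (rule ccontr)
    assume "\<not> ?thesis"
    then have "{i. i < u + v \<and> w i \<in> T} \<subseteq> {..<u + v} - S" using S by auto
    then have "count_in T (u + v) w \<le> card ({..<u + v} - S)"
      unfolding count_in_def by (intro card_mono) auto
    also have "\<dots> = v" using S by (simp add: card_Diff_subset finite_subset[OF S(1)])
    finally show False using w by simp
  qed
  then obtain i where "i \<in> S" "w i \<in> T" by blast
  then show "a (split_args P S w) = 0"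
    using S PT by (intro multilinear_zero[OF a, of i]) (auto simp: split_args_def)
qed

text \<open>This replaces the projections onto bidegrees in all later computations.\<close>

lemma component_at_eq_of_count:
  assumes a: "multilinear_form (u + v) a" and PT: "\<And>x. x \<in> T \<Longrightarrow> P x = x" and P: "\<And>x. P x \<in> T"
    and z: "\<And>w. count_in T (u + v) w > v \<Longrightarrow> a w = 0"
    and w: "count_in T (u + v) w \<ge> v"
  shows "component_at P u (u + v) a w = a w"
proof (rule component_at_eq_self[OF a])
  fix S assume S: "S \<subseteq> {..<u + v}" "card S \<noteq> u"
  have fin: "finite S" using S(1) finite_subset by blast
  show "a (split_args P S w) = 0"
  \<comment> \<open>With too small an index set, more than \<open>v\<close> of the split arguments
    lie in \<open>T\<close>. With too large a one, it contains the position of an argument from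
    \<open>T\<close>, whose complementary part is 0.\<close>
  proof (cases "card S < u")
    case True
    have "{..<u + v} - S \<subseteq> {i. i < u + v \<and> split_args P S w i \<in> T}"
      using P by (auto simp: split_args_def)
    then have "card ({..<u + v} - S) \<le> count_in T (u + v) (split_args P S w)"
      unfolding count_in_def by (intro card_mono) auto
    moreover have "card ({..<u + v} - S) > v"
      using True S(1) by (simp add: card_Diff_subset fin)
    ultimately show ?thesis by (intro z) simp
  next
    case False
    then have S': "card S > u" using S by simp
    have "\<exists>i\<in>S. w i \<in> T"
    proof (rule ccontr)
      assume "\<not> ?thesis"
      then have "{i. i < u + v \<and> w i \<in> T} \<subseteq> {..<u + v} - S" using S by auto
      then have "count_in T (u + v) w \<le> card ({..<u + v} - S)"
        unfolding count_in_def by (intro card_mono) auto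
      also have "\<dots> = u + v - card S" using S by (simp add: card_Diff_subset fin)
      also have "\<dots> < v" using S' card_mono[OF _ S(1)] w calculation by auto
      finally show False using w by simp
    qed
    then obtain i where "i \<in> S" "w i \<in> T" by blast
    then show ?thesis
      using S PT by (intro multilinear_zero[OF a, of i]) (auto simp: split_args_def)
  qed
qed

text \<open>An argument split by two different choices becomes \<open>P (x - P x)\<close> or
  \<open>P x - P (P x)\<close>, which is 0. So the component vanishes on arguments split along an
  index set of the wrong size.\<close>

lemma component_at_idem:
  assumes a: "multilinear_form k a" and P: "linear P" and PP: "\<And>x. P (P x) = P x"
  shows "component_at P u k (component_at P u k a) = component_at P u k a"
proof (rule ext, rule component_at_eq_self[OF multilinear_form_component_at[OF a P]])
  fix w S assume S: "S \<subseteq> {..<k}" "card S \<noteq> u"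
  have z: "P (x - P x) = 0" for x by (simp add: linear_diff[OF P] PP)
  show "component_at P u k a (split_args P S w) = 0"
    unfolding component_at_split_args
  proof (rule sum.neutral, intro ballI)
    fix S' assume "S' \<in> {S. S \<subseteq> {..<k} \<and> card S = u}"
    then have S': "S' \<subseteq> {..<k}" "card S' = u" by auto
    then have "S' \<noteq> S" using S by auto
    then obtain i where "i < k" "(i \<in> S') \<noteq> (i \<in> S)" using S S' by blast
    then show "a (split_args P S' (split_args P S w)) = 0"
      by (intro multilinear_zero[OF a, of i]) (auto simp: split_args_def z PP)
  qed
qed

lemma component_at_cong:
  assumes "\<And>S. S \<subseteq> {..<k} \<Longrightarrow> card S = u \<Longrightarrow> a (split_args P S w) = b (split_args P S w)"
  shows "component_at P u k a w = component_at P u k b w"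
  unfolding component_at_split_args by (rule sum.cong) (auto intro: assms)

lemma component_at_add:
  "component_at P u k (\<lambda>w. a w + b w) w = component_at P u k a w + component_at P u k b w"
  by (simp add: component_at_def sum.distrib)

lemma component_at_diff:
  "component_at P u k (\<lambda>w. a w - b w) w = component_at P u k a w - component_at P u k b w"
  by (simp add: component_at_def sum_subtractf)

lemma component_at_scale:
  "component_at P u k (\<lambda>w. c * a w) w = c * component_at P u k a w"
  by (simp add: component_at_def sum_distrib_left)

section \<open>Components as sums of wedge products\<close>

lemma multilinear_basis_expansion:
  fixes a :: "(nat \<Rightarrow> 'e::real_vector) \<Rightarrow> real"
  assumes a: "multilinear_form k a" and B: "finite B"
    and rep: "\<And>i. i < k \<Longrightarrow> x i = (\<Sum>b\<in>B. c i b *\<^sub>R b)"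
  shows "a x = (\<Sum>J\<in>{..<k} \<rightarrow>\<^sub>E B. (\<Prod>i<k. c i (J i)) * a J)"
proof -
  have "a x = (\<Sum>J\<in>{..<m} \<rightarrow>\<^sub>E B. (\<Prod>i<m. c i (J i)) * a (\<lambda>i. if i < m then J i else x i))"
    if "m \<le> k" for m
    using that
  proof (induction m)
    case (Suc m)
    have m: "m < k" "m \<le> k" using Suc.prems by auto
    let ?f = "\<lambda>m J i. if i < m then J i else x i"
    have step: "(\<Prod>i<m. c i (J i)) * a (?f m J)
        = (\<Sum>b\<in>B. (\<Prod>i<Suc m. c i ((J(m := b)) i)) * a (?f (Suc m) (J(m := b))))" for J
    proof -
      have "a (?f m J) = (\<Sum>b\<in>B. c m b * a ((?f m J)(m := b)))"
        by (rule multilinear_coordinate[OF a m(1)]) (simp add: rep[OF m(1)])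
      moreover have "(?f m J)(m := b) = ?f (Suc m) (J(m := b))" for b by (auto simp: fun_eq_iff)
      moreover have "(\<Prod>i<Suc m. c i ((J(m := b)) i)) = (\<Prod>i<m. c i (J i)) * c m b" for b
        by simp
      ultimately show ?thesis by (simp only: sum_distrib_left mult.assoc)
    qed
    have "a x = (\<Sum>J\<in>{..<m} \<rightarrow>\<^sub>E B. (\<Prod>i<m. c i (J i)) * a (?f m J))" by (rule Suc.IH[OF m(2)])
    also have "\<dots> = (\<Sum>J\<in>{..<m} \<rightarrow>\<^sub>E B. \<Sum>b\<in>B. (\<Prod>i<Suc m. c i ((J(m := b)) i)) * a (?f (Suc m) (J(m := b))))"
      by (simp only: step)
    also have "\<dots> = (\<Sum>(b, J)\<in>B \<times> ({..<m} \<rightarrow>\<^sub>E B). (\<Prod>i<Suc m. c i ((J(m := b)) i)) * a (?f (Suc m) (J(m := b))))"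
      by (subst sum.swap) (rule sum.cartesian_product)
    also have "\<dots> = (\<Sum>J\<in>{..<Suc m} \<rightarrow>\<^sub>E B. (\<Prod>i<Suc m. c i (J i)) * a (?f (Suc m) J))"
      unfolding lessThan_Suc[of m] PiE_insert_eq
      by (subst sum.reindex[OF inj_combinator]) (auto simp: comp_def case_prod_beta')
    finally show ?case .
  qed simp
  from this[of k]
  have "a x = (\<Sum>J\<in>{..<k} \<rightarrow>\<^sub>E B. (\<Prod>i<k. c i (J i)) * a (\<lambda>i. if i < k then J i else x i))" by simp
  also have "\<dots> = (\<Sum>J\<in>{..<k} \<rightarrow>\<^sub>E B. (\<Prod>i<k. c i (J i)) * a J)"
  proof (rule sum.cong[OF refl])
    fix J
    have "a (\<lambda>i. if i < k then J i else x i) = a J" by (rule multilinear_cong[OF a]) simp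
    then show "(\<Prod>i<k. c i (J i)) * a (\<lambda>i. if i < k then J i else x i) = (\<Prod>i<k. c i (J i)) * a J" by simp
  qed
  finally show ?thesis .
qed

lemma permutes_image_subset:
  assumes "S \<subseteq> {..<k}" "card S = u" "u \<le> k"
  obtains \<tau> where "\<tau> permutes {..<k}" "\<tau> ` {..<u} = S"
proof -
  have fin: "finite S" using assms(1) finite_subset by blast
  obtain f where f: "bij_betw f {..<u} S"
    using finite_same_card_bij[of "{..<u}" S] fin assms(2) by auto
  have "card ({..<k} - {..<u}) = card ({..<k} - S)"
    using assms fin by (simp add: card_Diff_subset)
  then obtain g where g: "bij_betw g ({..<k} - {..<u}) ({..<k} - S)"
    using finite_same_card_bij[of "{..<k} - {..<u}" "{..<k} - S"] by auto
  define \<tau> where "\<tau> i = (if i \<in> {..<k} then if i \<in> {..<u} then f i else g i else i)" for i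
  have "bij_betw (\<lambda>i. if i \<in> {..<u} then f i else g i) ({..<u} \<union> ({..<k} - {..<u})) (S \<union> ({..<k} - S))"
    by (rule bij_betw_disjoint_Un[OF f g]) auto
  moreover have "{..<u} \<union> ({..<k} - {..<u}) = {..<k}" "S \<union> ({..<k} - S) = {..<k}"
    using assms by auto
  ultimately have "bij_betw (\<lambda>i. if i \<in> {..<u} then f i else g i) {..<k} {..<k}" by simp
  then have "bij_betw \<tau> {..<k} {..<k}" by (rule bij_betw_cong[THEN iffD1, rotated]) (simp add: \<tau>_def)
  then have "\<tau> permutes {..<k}" by (rule bij_imp_permutes) (simp add: \<tau>_def)
  moreover have "\<tau> ` {..<u} = S"
  proof -
    have "\<tau> ` {..<u} = f ` {..<u}" using assms by (intro image_cong) (auto simp: \<tau>_def)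
    then show ?thesis using f by (simp add: bij_betw_def)
  qed
  ultimately show ?thesis by (rule that)
qed

text \<open>The permutations that carry \<open>{..<u}\<close> to \<open>S\<close> form a coset of
  the stabilizer of \<open>{..<u}\<close>; composition with one of them is the bijection.\<close>

lemma card_permutes_image:
  assumes "S \<subseteq> {..<k}" "card S = u" "u \<le> k"
  shows "card {\<sigma>. \<sigma> permutes {..<k} \<and> \<sigma> ` {..<u} = S} = card {\<sigma>. \<sigma> permutes {..<k} \<and> \<sigma> ` {..<u} = {..<u}}"
proof -
  obtain \<tau> where \<tau>: "\<tau> permutes {..<k}" "\<tau> ` {..<u} = S" using permutes_image_subset[OF assms] .
  have inv: "inv \<tau> permutes {..<k}" "\<tau> \<circ> inv \<tau> = id" "inv \<tau> \<circ> \<tau> = id"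
    using \<tau>(1) permutes_inv permutes_inv_o by blast+
  have S: "inv \<tau> ` S = {..<u}"
    unfolding \<tau>(2)[symmetric] image_comp inv(3) by simp
  have "bij_betw ((\<circ>) \<tau>) {\<sigma>. \<sigma> permutes {..<k} \<and> \<sigma> ` {..<u} = {..<u}} {\<sigma>. \<sigma> permutes {..<k} \<and> \<sigma> ` {..<u} = S}"
  proof (rule bij_betw_byWitness[where f' = "(\<circ>) (inv \<tau>)"])
    show "\<forall>\<sigma>\<in>{\<sigma>. \<sigma> permutes {..<k} \<and> \<sigma> ` {..<u} = {..<u}}. inv \<tau> \<circ> (\<tau> \<circ> \<sigma>) = \<sigma>"
      "\<forall>\<sigma>\<in>{\<sigma>. \<sigma> permutes {..<k} \<and> \<sigma> ` {..<u} = S}. \<tau> \<circ> (inv \<tau> \<circ> \<sigma>) = \<sigma>"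
      by (simp_all add: o_assoc inv)
    show "(\<circ>) \<tau> ` {\<sigma>. \<sigma> permutes {..<k} \<and> \<sigma> ` {..<u} = {..<u}} \<subseteq> {\<sigma>. \<sigma> permutes {..<k} \<and> \<sigma> ` {..<u} = S}"
      by (intro image_subsetI CollectI conjI permutes_compose[OF _ \<tau>(1)])
        (simp_all only: mem_Collect_eq image_comp[symmetric] \<tau>(2))
    show "(\<circ>) (inv \<tau>) ` {\<sigma>. \<sigma> permutes {..<k} \<and> \<sigma> ` {..<u} = S} \<subseteq> {\<sigma>. \<sigma> permutes {..<k} \<and> \<sigma> ` {..<u} = {..<u}}"
      by (intro image_subsetI CollectI conjI permutes_compose[OF _ inv(1)])
        (simp_all only: mem_Collect_eq image_comp[symmetric] S)
  qed
  then show ?thesis by (rule bij_betw_same_card[symmetric])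
qed

lemma bigraded_formsI:
  assumes F: "finite F"
    and "\<And>J i. J \<in> F \<Longrightarrow> i < u \<Longrightarrow> \<theta> J i \<in> annihilator T"
    and "\<And>J i. J \<in> F \<Longrightarrow> i \<in> {u..<u + v} \<Longrightarrow> \<theta> J i \<in> annihilator N"
    and eq: "\<And>w. a w = (\<Sum>J\<in>F. r J * wedge_covectors (u + v) (\<theta> J) w)"
  shows "a \<in> bigraded_forms T N u v"
proof -
  obtain e where e: "bij_betw e {0..<card F} F" using ex_bij_betw_nat_finite[OF F] by blast
  have eF: "e m \<in> F" if "m < card F" for m using e that by (auto simp: bij_betw_def)
  have "a w = (\<Sum>m<card F. r (e m) * wedge_covectors (u + v) (\<theta> (e m)) w)" for w
    unfolding eq using sum.reindex_bij_betw[OF e, of "\<lambda>J. r J * wedge_covectors (u + v) (\<theta> J) w"]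
    by (simp add: atLeast0LessThan)
  then show ?thesis
    unfolding bigraded_forms_def mem_Collect_eq using assms(2,3)[OF eF]
    by (intro exI[of _ "card F"] exI[of _ "r \<circ> e"] exI[of _ "\<theta> \<circ> e"] conjI allI impI ballI)
      (auto simp: fun_eq_iff)
qed

text \<open>Complements \<open>component_at_bigraded\<close>. Each index set of size
  \<open>u\<close> is the image of \<open>{..<u}\<close> under equally many permutations, so a
  multiple of the component is a signed sum over all permutations. Expanding \<open>a\<close> in
  coordinates turns it into wedge products of coordinate functionals composed with
  \<open>x - P x\<close> in the first \<open>u\<close> places and with \<open>P\<close> in the
  others.\<close>

lemma component_at_in_bigraded_forms:
  fixes a :: "(nat \<Rightarrow> 'e::real_normed_vector) \<Rightarrow> real"
  assumes fd: "finite_dimensional TYPE('e)" and a: "alternating_form (u + v) a"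
    and P: "linear P" and PT: "\<And>x. x \<in> T \<Longrightarrow> P x = x" and PN: "\<And>x. x \<in> N \<Longrightarrow> P x = 0"
  shows "component_at P u (u + v) a \<in> bigraded_forms T N u v"
proof -
  let ?k = "u + v"
  obtain B :: "'e set" and \<phi> where \<phi>: "finite B" "\<And>b. bounded_linear (\<phi> b)"
    and rep: "\<And>x. x = (\<Sum>b\<in>B. \<phi> b x *\<^sub>R b)"
    using finite_dimensional_coordinates[OF fd] by blast
  note m = alternating_imp_multilinear[OF a]
  define Q where "Q i x = (if i < u then x - P x else P x)" for i :: nat and x
  define G where "G = {\<sigma>. \<sigma> permutes {..<?k}}"
  \<comment> \<open>The order of the stabilizer, \<open>fact u * fact v\<close>; it is divided out
    in the coefficients \<open>a J / c\<close>.\<close>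
  define c where "c = card {\<sigma>. \<sigma> permutes {..<?k} \<and> \<sigma> ` {..<u} = {..<u}}"
  have finG: "finite G" by (simp add: G_def finite_permutations)
  have "c \<noteq> 0"
  proof -
    have "id \<in> {\<sigma>. \<sigma> permutes {..<?k} \<and> \<sigma> ` {..<u} = {..<u}}" by (simp add: permutes_id)
    moreover have "finite {\<sigma>. \<sigma> permutes {..<?k} \<and> \<sigma> ` {..<u} = {..<u}}"
      by (rule finite_subset[OF _ finG]) (auto simp: G_def)
    ultimately show ?thesis unfolding c_def by (metis card_0_eq emptyE)
  qed
  let ?F = "{S. S \<subseteq> {..<?k} \<and> card S = u}"
  define \<theta> where "\<theta> J i x = \<phi> (J i) (Q i x)" for J :: "nat \<Rightarrow> 'e" and i x
  have eq: "c * component_at P u ?k a w = (\<Sum>J\<in>{..<?k} \<rightarrow>\<^sub>E B. a J * wedge_covectors ?k (\<theta> J) w)" for w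
  proof -
    have perm: "of_int (sign \<sigma>) * a (\<lambda>i. Q i (w (\<sigma> i))) = a (split_args P (\<sigma> ` {..<u}) w)"
      if \<sigma>: "\<sigma> \<in> G" for \<sigma>
    proof -
      have inj: "inj \<sigma>" using \<sigma> permutes_inj by (auto simp: G_def)
      have "(\<lambda>i. Q i (w (\<sigma> i))) = (\<lambda>i. split_args P (\<sigma> ` {..<u}) w (\<sigma> i))"
        using inj by (auto simp: split_args_def Q_def inj_image_mem_iff fun_eq_iff)
      then have "a (\<lambda>i. Q i (w (\<sigma> i))) = of_int (sign \<sigma>) * a (split_args P (\<sigma> ` {..<u}) w)"
        using alternating_permute[OF a] \<sigma> by (simp add: G_def)
      then show ?thesis
        by (simp add: mult.assoc[symmetric] of_int_mult[symmetric] del: of_int_mult)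
    qed
    have img: "(\<lambda>\<sigma>. \<sigma> ` {..<u}) ` G \<subseteq> ?F"
    proof (rule image_subsetI)
      fix \<sigma> assume "\<sigma> \<in> G"
      then have \<sigma>: "\<sigma> permutes {..<?k}" by (simp add: G_def)
      have "card (\<sigma> ` {..<u}) = u"
        using card_image[OF inj_on_subset[OF permutes_inj[OF \<sigma>] subset_UNIV], of "{..<u}"] by simp
      moreover have "\<sigma> ` {..<u} \<subseteq> \<sigma> ` {..<?k}" by (intro image_mono) auto
      ultimately show "\<sigma> ` {..<u} \<in> ?F" using permutes_image[OF \<sigma>] by simp
    qed
    have "c * component_at P u ?k a w = (\<Sum>S\<in>?F. c * a (split_args P S w))"
      by (simp add: component_at_split_args sum_distrib_left)
    also have "\<dots> = (\<Sum>S\<in>?F. \<Sum>\<sigma>\<in>{\<sigma>. \<sigma> \<in> G \<and> \<sigma> ` {..<u} = S}. a (split_args P (\<sigma> ` {..<u}) w))"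
    proof (rule sum.cong[OF refl])
      fix S assume "S \<in> ?F"
      then have "card {\<sigma>. \<sigma> \<in> G \<and> \<sigma> ` {..<u} = S} = c"
        using card_permutes_image[of S ?k u] by (simp add: c_def G_def)
      then show "c * a (split_args P S w) = (\<Sum>\<sigma>\<in>{\<sigma>. \<sigma> \<in> G \<and> \<sigma> ` {..<u} = S}. a (split_args P (\<sigma> ` {..<u}) w))"
        by simp
    qed
    also have "\<dots> = (\<Sum>\<sigma>\<in>G. a (split_args P (\<sigma> ` {..<u}) w))"
      by (rule sum.group[OF finG finite_subsets_card img])
    also have "\<dots> = (\<Sum>\<sigma>\<in>G. of_int (sign \<sigma>) * a (\<lambda>i. Q i (w (\<sigma> i))))"
      by (rule sum.cong[OF refl]) (simp add: perm)
    also have "\<dots> = (\<Sum>\<sigma>\<in>G. of_int (sign \<sigma>) * (\<Sum>J\<in>{..<?k} \<rightarrow>\<^sub>E B. (\<Prod>i<?k. \<theta> J i (w (\<sigma> i))) * a J))"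
      unfolding \<theta>_def
      by (intro sum.cong refl arg_cong2[where f = "(*)"] multilinear_basis_expansion[OF m \<phi>(1)]) (rule rep)
    also have "\<dots> = (\<Sum>J\<in>{..<?k} \<rightarrow>\<^sub>E B. a J * wedge_covectors ?k (\<theta> J) w)"
      unfolding wedge_covectors_def sum_distrib_left G_def
      by (subst sum.swap) (simp add: mult_ac)
    finally show ?thesis .
  qed
  have linQ: "linear (Q i)" for i
    unfolding Q_def[abs_def] using P
    by (cases "i < u") (auto intro: linear_compose_sub[OF linear_id[unfolded id_def]])
  have lin: "linear (\<theta> J i)" for J i
    unfolding \<theta>_def[abs_def]
    using linear_compose[OF linQ bounded_linear.linear[OF \<phi>(2)]] by (simp add: comp_def)
  have \<phi>0: "\<phi> b 0 = 0" for b using linear_0[OF bounded_linear.linear[OF \<phi>(2)]] .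
  show ?thesis
  proof (rule bigraded_formsI[where F = "{..<?k} \<rightarrow>\<^sub>E B" and \<theta> = \<theta> and r = "\<lambda>J. a J / c"])
    show "finite ({..<?k} \<rightarrow>\<^sub>E B)" using \<phi>(1) by (intro finite_PiE) auto
    show "\<theta> J i \<in> annihilator T" if "i < u" for J i
      using that lin by (simp add: annihilator_def \<theta>_def Q_def PT \<phi>0)
    show "\<theta> J i \<in> annihilator N" if "i \<in> {u..<u + v}" for J i
      using that lin by (simp add: annihilator_def \<theta>_def Q_def PN \<phi>0)
    show "component_at P u ?k a w = (\<Sum>J\<in>{..<?k} \<rightarrow>\<^sub>E B. a J / c * wedge_covectors ?k (\<theta> J) w)" for w
      using eq[of w] \<open>c \<noteq> 0\<close> by (simp add: sum_divide_distrib[symmetric] field_simps)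
  qed
qed

section \<open>Charts and pullbacks to open sets of normed spaces\<close>

lemma smooth_atlasD:
  assumes "smooth_atlas (A :: ('m::{t2_space,second_countable_topology}, 'e::real_normed_vector) chart set)"
  shows smooth_atlas_finite_dimensional: "finite_dimensional TYPE('e)"
    and smooth_atlas_cover: "\<exists>c\<in>A. x \<in> cdom c"
    and smooth_atlas_open: "c \<in> A \<Longrightarrow> open (cdom c)" "c \<in> A \<Longrightarrow> open (crange c)"
    and smooth_atlas_continuous: "c \<in> A \<Longrightarrow> continuous_on (cdom c) (coord c)"
      "c \<in> A \<Longrightarrow> continuous_on (crange c) (chart_inv c)"
    and smooth_atlas_inv: "c \<in> A \<Longrightarrow> y \<in> cdom c \<Longrightarrow> chart_inv c (coord c y) = y"
      "c \<in> A \<Longrightarrow> z \<in> crange c \<Longrightarrow> coord c (chart_inv c z) = z"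
    and smooth_atlas_inv_in: "c \<in> A \<Longrightarrow> z \<in> crange c \<Longrightarrow> chart_inv c z \<in> cdom c"
    and smooth_atlas_transition: "c \<in> A \<Longrightarrow> c' \<in> A \<Longrightarrow>
      smooth_on (coord c ` (cdom c \<inter> cdom c')) (in_charts id c c')"
proof -
  have cov: "(\<Union>c\<in>A. cdom c) = UNIV"
    using assms by (simp add: smooth_atlas_def)
  have hom: "open (cdom c) \<and> open (crange c) \<and> homeomorphism (cdom c) (crange c) (coord c) (chart_inv c)"
      if "c \<in> A" for c
    using assms that by (simp_all add: smooth_atlas_def)
  show "finite_dimensional TYPE('e)" using assms by (simp add: smooth_atlas_def)
  show "\<exists>c\<in>A. x \<in> cdom c" using cov by blast
  show "smooth_on (coord c ` (cdom c \<inter> cdom c')) (in_charts id c c')" if "c \<in> A" "c' \<in> A"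
    using assms that by (simp add: smooth_atlas_def)
  assume c: "c \<in> A"
  show "open (cdom c)" "open (crange c)" "continuous_on (cdom c) (coord c)"
    "continuous_on (crange c) (chart_inv c)"
    "y \<in> cdom c \<Longrightarrow> chart_inv c (coord c y) = y" "z \<in> crange c \<Longrightarrow> coord c (chart_inv c z) = z"
    using hom[OF c] by (simp_all add: homeomorphism_def)
  show "z \<in> crange c \<Longrightarrow> chart_inv c z \<in> cdom c"
    using hom[OF c] by (auto simp: homeomorphism_def)
qed

lemma coord_in_crange: "x \<in> cdom c \<Longrightarrow> coord c x \<in> crange c"
  by (simp add: crange_def)

lemma open_coord_image:
  assumes A: "smooth_atlas A" "c \<in> A" and U: "open U"
  shows "open (coord c ` (cdom c \<inter> U))"
proof -
  have "coord c ` (cdom c \<inter> U) = chart_inv c -` U \<inter> crange c"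
    using smooth_atlas_inv[OF A(1) A(2)] smooth_atlas_inv_in[OF A] by (auto simp: crange_def)
  then show ?thesis
    using smooth_atlas_continuous(2)[OF A] smooth_atlas_open(2)[OF A] U
      continuous_on_open_vimage by metis
qed

lemma has_derivative_transition:
  assumes A: "smooth_atlas A" "c \<in> A" "c' \<in> A" and x: "x \<in> cdom c" "x \<in> cdom c'"
  shows "(in_charts id c c' has_derivative chart_deriv id c c' x) (at (coord c x))"
  unfolding chart_deriv_def
  by (rule smooth_on_has_derivative[OF smooth_atlas_transition[OF A]
        open_coord_image[OF A(1,2) smooth_atlas_open(1)[OF A(1,3)]]]) (use x in auto)

lemma chart_exists:
  assumes "smooth_atlas B"
  shows "(SOME c. c \<in> B \<and> y \<in> cdom c) \<in> B" "y \<in> cdom (SOME c. c \<in> B \<and> y \<in> cdom c)"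
  using someI_ex[of "\<lambda>c. c \<in> B \<and> y \<in> cdom c"] smooth_atlas_cover[OF assms] by blast+

section \<open>Pullback along smooth maps from open sets of normed spaces\<close>

text \<open>A smooth map into the manifold from an open set of a normed space. Inverse charts, maps
  read in a source chart and the homotopy on chart times time line are all of this kind, so the
  calculus of pullbacks is developed once for them.\<close>

definition plot ::
  "('n::topological_space, 'e::real_normed_vector) chart set \<Rightarrow> 'x::real_normed_vector set \<Rightarrow> ('x \<Rightarrow> 'n) \<Rightarrow> bool" where
  "plot B S G \<longleftrightarrow> open S \<and> continuous_on S G \<and>
     (\<forall>c\<in>B. smooth_on {p\<in>S. G p \<in> cdom c} (coord c \<circ> G))"

definition plot_deriv ::
  "('n, 'e::real_normed_vector) chart \<Rightarrow> ('x::real_normed_vector \<Rightarrow> 'n) \<Rightarrow> 'x \<Rightarrow> 'x \<Rightarrow> 'e" where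
  "plot_deriv c G p = frechet_derivative (coord c \<circ> G) (at p)"

text \<open>Makes the same choice of chart as \<open>pullback_form\<close>. The two therefore agree
  for arbitrary values of \<alpha>, without assuming that \<alpha> transforms correctly under
  changes of charts.\<close>

definition pull ::
  "('n, 'e::real_normed_vector) chart set \<Rightarrow> ('x::real_normed_vector \<Rightarrow> 'n) \<Rightarrow> ('n, 'e) form \<Rightarrow>
   'x \<Rightarrow> (nat \<Rightarrow> 'x) \<Rightarrow> real" where
  "pull B G \<alpha> p v = (let c = (SOME c. c \<in> B \<and> G p \<in> cdom c)
     in \<alpha> c (G p) (\<lambda>i. plot_deriv c G p (v i)))"

lemma plot_open: "plot B S G \<Longrightarrow> open S"
  by (simp add: plot_def)

lemma plot_domain_open:
  assumes B: "smooth_atlas B" "c \<in> B" and G: "plot B S G"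
  shows "open {p\<in>S. G p \<in> cdom c}"
proof -
  have "open (G -` cdom c \<inter> S)"
    using G smooth_atlas_open(1)[OF B] continuous_on_open_vimage unfolding plot_def by metis
  then show ?thesis by (simp add: vimage_def Int_def conj_commute)
qed

lemma plot_smooth: "c \<in> B \<Longrightarrow> plot B S G \<Longrightarrow> smooth_on {p\<in>S. G p \<in> cdom c} (coord c \<circ> G)"
  by (simp add: plot_def)

lemma plot_has_derivative:
  assumes B: "smooth_atlas B" "c \<in> B" and G: "plot B S G" and p: "p \<in> S" "G p \<in> cdom c"
  shows "((coord c \<circ> G) has_derivative plot_deriv c G p) (at p)"
  unfolding plot_deriv_def
  by (rule smooth_on_has_derivative[OF plot_smooth[OF B(2) G] plot_domain_open[OF B G]]) (use p in simp)

lemma plot_deriv_linear: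
  assumes "smooth_atlas B" "c \<in> B" "plot B S G" "p \<in> S" "G p \<in> cdom c"
  shows "linear (plot_deriv c G p)"
  using plot_has_derivative[OF assms] by (rule has_derivative_linear)

lemma plot_deriv_change:
  assumes B: "smooth_atlas B" "c \<in> B" "c' \<in> B" and G: "plot B S G" and p: "p \<in> S"
    and c: "G p \<in> cdom c" "G p \<in> cdom c'"
  shows "plot_deriv c' G p = (\<lambda>v. chart_deriv id c c' (G p) (plot_deriv c G p v))"
proof -
  have "((\<lambda>q. in_charts id c c' ((coord c \<circ> G) q)) has_derivative
      (\<lambda>v. chart_deriv id c c' (G p) (plot_deriv c G p v))) (at p)"
    by (rule has_derivative_compose[where f = "coord c \<circ> G" and g = "in_charts id c c'",
          OF plot_has_derivative[OF B(1,2) G p c(1)]])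
      (use has_derivative_transition[OF B c] in \<open>simp only: comp_apply\<close>)
  then have "((coord c' \<circ> G) has_derivative
      (\<lambda>v. chart_deriv id c c' (G p) (plot_deriv c G p v))) (at p)"
    by (rule has_derivative_transform_within_open[OF _ plot_domain_open[OF B(1,2) G]])
      (use p c smooth_atlas_inv(1)[OF B(1,2)] in \<open>auto simp: in_charts_def\<close>)
  then show ?thesis
    unfolding plot_deriv_def[of c'] by (rule frechet_derivative_at[symmetric])
qed

lemma differential_formD:
  assumes "differential_form B k \<alpha>"
  shows differential_form_alternating: "c \<in> B \<Longrightarrow> x \<in> cdom c \<Longrightarrow> alternating_form k (\<alpha> c x)"
    and differential_form_change: "c \<in> B \<Longrightarrow> c' \<in> B \<Longrightarrow> x \<in> cdom c \<Longrightarrow> x \<in> cdom c' \<Longrightarrow>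
      \<alpha> c x v = \<alpha> c' x (\<lambda>i. chart_deriv id c c' x (v i))"
    and differential_form_smooth: "c \<in> B \<Longrightarrow> smooth_on (crange c) (\<lambda>z. \<alpha> c (chart_inv c z) v)"
    and differential_form_outside: "\<not> (c \<in> B \<and> x \<in> cdom c) \<Longrightarrow> \<alpha> c x v = 0"
  using assms unfolding differential_form_def by blast+

text \<open>The change of the derivative under a change of charts cancels that of the form, so any
  chart may replace the chosen one.\<close>

lemma pull_eq:
  assumes B: "smooth_atlas B" "c \<in> B" and G: "plot B S G" and p: "p \<in> S" "G p \<in> cdom c"
    and \<alpha>: "differential_form B k \<alpha>"
  shows "pull B G \<alpha> p v = \<alpha> c (G p) (\<lambda>i. plot_deriv c G p (v i))"
proof -
  define d where "d = (SOME c. c \<in> B \<and> G p \<in> cdom c)"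
  have d: "d \<in> B" "G p \<in> cdom d" unfolding d_def by (rule chart_exists[OF B(1)])+
  show ?thesis
    unfolding pull_def d_def[symmetric] Let_def plot_deriv_change[OF B(1) d(1) B(2) G p(1) d(2) p(2)]
    by (rule differential_form_change[OF \<alpha> d(1) B(2) d(2) p(2)])
qed

lemma pull_alternating:
  assumes B: "smooth_atlas B" and G: "plot B S G" and p: "p \<in> S" and \<alpha>: "differential_form B k \<alpha>"
  shows "alternating_form k (pull B G \<alpha> p)"
proof -
  obtain c where c: "c \<in> B" "G p \<in> cdom c" using smooth_atlas_cover[OF B] by blast
  have "pull B G \<alpha> p = (\<lambda>v. \<alpha> c (G p) (\<lambda>i. plot_deriv c G p (v i)))"
    using pull_eq[OF B c(1) G p c(2) \<alpha>] by (rule ext)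
  then show ?thesis
    using alternating_form_compose[OF differential_form_alternating[OF \<alpha> c] plot_deriv_linear[OF B c(1) G p c(2)]]
    by simp
qed

lemma plot_deriv_smooth:
  assumes "smooth_atlas B" "c \<in> B" "plot B S G"
  shows "smooth_on {p\<in>S. G p \<in> cdom c} (\<lambda>p. plot_deriv c G p v)"
  unfolding plot_deriv_def
  by (rule smooth_on_frechet_derivative[OF plot_smooth[OF assms(2,3)] plot_domain_open[OF assms]])

lemma smooth_on_form_along_plot:
  assumes B: "smooth_atlas B" "c \<in> B" and G: "plot B S G" and \<alpha>: "differential_form B k \<alpha>"
  shows "smooth_on {p\<in>S. G p \<in> cdom c} (\<lambda>p. \<alpha> c (G p) w)"
proof (rule smooth_on_cong)
  show "smooth_on {p\<in>S. G p \<in> cdom c} (\<lambda>p. \<alpha> c (chart_inv c ((coord c \<circ> G) p)) w)"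
    by (rule smooth_on_compose[OF smooth_atlas_finite_dimensional[OF B(1)]
          differential_form_smooth[OF \<alpha> B(2)] plot_smooth[OF B(2) G]])
      (simp add: coord_in_crange)
qed (simp add: smooth_atlas_inv(1)[OF B])

text \<open>The chosen chart may jump from point to point; near each point one fixed chart is used
  instead.\<close>

lemma pull_smooth:
  assumes B: "smooth_atlas B" and G: "plot B S G" and \<alpha>: "differential_form B k \<alpha>"
  shows "smooth_on S (\<lambda>p. pull B G \<alpha> p v)"
proof (rule smooth_on_local[OF plot_open[OF G]])
  fix p assume p: "p \<in> S"
  obtain c where c: "c \<in> B" "G p \<in> cdom c" using smooth_atlas_cover[OF B] by blast
  let ?W = "{p\<in>S. G p \<in> cdom c}"
  have "smooth_on ?W (\<lambda>q. \<alpha> c (G q) (\<lambda>i. plot_deriv c G q (v i)))"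
    by (rule smooth_on_multilinear[OF smooth_atlas_finite_dimensional[OF B], where k = k])
      (use alternating_imp_multilinear[OF differential_form_alternating[OF \<alpha> c(1)]]
        smooth_on_form_along_plot[OF B c(1) G \<alpha>] plot_deriv_smooth[OF B c(1) G] in auto)
  then have "smooth_on ?W (\<lambda>q. pull B G \<alpha> q v)"
    by (rule smooth_on_cong[rotated]) (simp add: pull_eq[OF B c(1) G _ _ \<alpha>])
  moreover have "S \<inter> ?W = ?W" by auto
  ultimately show "\<exists>W. open W \<and> p \<in> W \<and> smooth_on (S \<inter> W) (\<lambda>q. pull B G \<alpha> q v)"
    using plot_domain_open[OF B c(1) G] p c(2) by (intro exI[of _ ?W]) simp
qed

text \<open>The exterior derivative commutes with pullback. The product rule yields the derivative
  of the coefficients, which is the right-hand side, and terms with the second derivative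
  \<open>H\<close> of the plot; these cancel because \<open>H\<close> is symmetric.\<close>

lemma pull_ext_deriv:
  assumes B: "smooth_atlas (B :: ('n::{t2_space,second_countable_topology}, 'e::real_normed_vector) chart set)"
    and c: "c \<in> B" and G: "plot B S G" and p: "p \<in> S" "G p \<in> cdom c"
    and \<alpha>: "differential_form B k \<alpha>"
  shows "(\<Sum>i\<le>k. (-1) ^ i * frechet_derivative (\<lambda>q. pull B G \<alpha> q (omit i v)) (at p) (v i))
    = ext_deriv B k \<alpha> c (G p) (\<lambda>i. plot_deriv c G p (v i))"
proof -
  note fd = smooth_atlas_finite_dimensional[OF B]
  let ?W = "{p\<in>S. G p \<in> cdom c}"
  let ?D = "plot_deriv c G p"
  have W: "open ?W" "p \<in> ?W" using plot_domain_open[OF B c G] p by auto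
  define a where "a q w = \<alpha> c (G q) w" for q w
  define a' where "a' w h = frechet_derivative (\<lambda>z. \<alpha> c (chart_inv c z) w) (at (coord c (G p))) (?D h)" for w h
  define H where "H x h = frechet_derivative (\<lambda>q. plot_deriv c G q x) (at p) h" for x h
  have Hsym: "H x y = H y x" for x y
    unfolding H_def plot_deriv_def
    by (rule smooth_on_second_derivative_symmetric[OF fd plot_smooth[OF c G] W])
  have am: "multilinear_form k (a q)" if "q \<in> ?W" for q
    unfolding a_def[abs_def]
    by (rule alternating_imp_multilinear[OF differential_form_alternating[OF \<alpha> c]]) (use that in simp)
  have da: "((\<lambda>q. a q w) has_derivative a' w) (at p)" for w
  proof -
    have "((\<lambda>q. \<alpha> c (chart_inv c ((coord c \<circ> G) q)) w) has_derivative a' w) (at p)"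
      unfolding a'_def[abs_def]
      by (rule has_derivative_compose[where f = "coord c \<circ> G" and g = "\<lambda>z. \<alpha> c (chart_inv c z) w",
            OF plot_has_derivative[OF B c G p]])
        (use smooth_on_has_derivative[OF differential_form_smooth[OF \<alpha> c] smooth_atlas_open(2)[OF B c]
            coord_in_crange[OF p(2)]] in simp)
    then show ?thesis
      by (rule has_derivative_transform_within_open[OF _ W])
        (simp add: a_def smooth_atlas_inv(1)[OF B c])
  qed
  have dV: "((\<lambda>q. plot_deriv c G q x) has_derivative H x) (at p)" for x
    using smooth_on_has_derivative[OF plot_deriv_smooth[OF B c G] W] by (simp add: H_def[abs_def])
  have dpull: "frechet_derivative (\<lambda>q. pull B G \<alpha> q u) (at p) h
      = a' (\<lambda>i. ?D (u i)) h + (\<Sum>i<k. a p ((\<lambda>i. ?D (u i))(i := H (u i) h)))" for u h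
  proof -
    have "((\<lambda>q. a q (\<lambda>i. plot_deriv c G q (u i))) has_derivative
        (\<lambda>h. a' (\<lambda>i. ?D (u i)) h + (\<Sum>i<k. a p ((\<lambda>i. ?D (u i))(i := H (u i) h))))) (at p)"
      by (rule has_derivative_multilinear[where V = "\<lambda>i q. plot_deriv c G q (u i)", OF fd W am da dV])
    then have "((\<lambda>q. pull B G \<alpha> q u) has_derivative
        (\<lambda>h. a' (\<lambda>i. ?D (u i)) h + (\<Sum>i<k. a p ((\<lambda>i. ?D (u i))(i := H (u i) h))))) (at p)"
      by (rule has_derivative_transform_within_open[OF _ W]) (simp add: a_def pull_eq[OF B c G _ _ \<alpha>])
    then show ?thesis by (rule frechet_derivative_at_eq)
  qed
  have om: "(\<lambda>j. ?D (omit i v j)) = omit i (\<lambda>j. ?D (v j))" for i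
    by (auto simp: omit_def fun_eq_iff)
  have "(\<Sum>i\<le>k. (-1) ^ i * (\<Sum>j<k. a p ((\<lambda>m. ?D (omit i v m))(j := H (omit i v j) (v i))))) = 0"
  proof -
    have H': "H (omit i v j) (v i) = (\<lambda>i m. H (v m) (v i)) i (if j < i then j else Suc j)" for i j
      by (simp add: omit_def)
    show ?thesis unfolding om H'
      by (rule alternating_symmetric_sum_zero[where s = "\<lambda>i m. H (v m) (v i)"])
        (simp_all add: a_def differential_form_alternating[OF \<alpha> c p(2)] Hsym)
  qed
  moreover have "ext_deriv B k \<alpha> c (G p) (\<lambda>i. ?D (v i)) = (\<Sum>i\<le>k. (-1) ^ i * a' (\<lambda>j. ?D (omit i v j)) (v i))"
    unfolding om a'_def ext_deriv_def using c p by simp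
  ultimately show ?thesis
    unfolding dpull by (simp add: distrib_left sum.distrib)
qed

lemma plot_deriv_compose:
  assumes B: "smooth_atlas B" "c \<in> B" and G: "plot B S G"
    and \<psi>: "(\<psi> has_derivative \<psi>') (at p)" "\<psi> p \<in> S" and c: "G (\<psi> p) \<in> cdom c"
  shows "plot_deriv c (\<lambda>p. G (\<psi> p)) p v = plot_deriv c G (\<psi> p) (\<psi>' v)"
proof -
  have "((\<lambda>q. (coord c \<circ> G) (\<psi> q)) has_derivative (\<lambda>v. plot_deriv c G (\<psi> p) (\<psi>' v))) (at p)"
    by (rule has_derivative_compose[where g = "coord c \<circ> G", OF \<psi>(1)])
      (rule plot_has_derivative[OF B G \<psi>(2) c])
  then show ?thesis
    unfolding plot_deriv_def[of c "\<lambda>p. G (\<psi> p)"] comp_def by (rule frechet_derivative_at_eq)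
qed

text \<open>Both sides choose the same chart around \<open>G (\<psi> p)\<close>, so only the chain
  rule is involved and \<alpha> may be arbitrary.\<close>

lemma pull_compose:
  assumes B: "smooth_atlas B" and G: "plot B S G"
    and \<psi>: "(\<psi> has_derivative \<psi>') (at p)" "\<psi> p \<in> S"
  shows "pull B (\<lambda>p. G (\<psi> p)) \<alpha> p v = pull B G \<alpha> (\<psi> p) (\<lambda>i. \<psi>' (v i))"
  unfolding pull_def Let_def
  by (simp add: plot_deriv_compose[OF B chart_exists(1)[OF B] G \<psi> chart_exists(2)[OF B]])

section \<open>Foliated maps preserve the tangent spaces of the leaves\<close>

lemma mem_tangent_space: "w \<in> tangent_space \<longleftrightarrow> snd w = 0"
  by (simp add: tangent_space_def mem_Times_iff)

lemma has_derivative_snd_zero: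
  fixes f :: "'x::real_normed_vector \<Rightarrow> 'p::real_normed_vector \<times> 'q::real_normed_vector"
  assumes f: "(f has_derivative f') (at z)" and e: "e > 0"
    and c: "\<And>s. \<bar>s\<bar> < e \<Longrightarrow> snd (f (z + s *\<^sub>R w)) = snd (f z)"
  shows "snd (f' w) = 0"
proof -
  have "((\<lambda>s. f (z + s *\<^sub>R w)) has_derivative (\<lambda>r. f' (r *\<^sub>R w))) (at 0)"
    by (rule has_derivative_compose[where f = "\<lambda>s. z + s *\<^sub>R w" and g = f])
      (use f in \<open>auto intro!: derivative_eq_intros\<close>)
  then have "((\<lambda>s. snd (f (z + s *\<^sub>R w))) has_derivative (\<lambda>r. snd (f' (r *\<^sub>R w)))) (at 0)"
    by (rule has_derivative_snd)
  then have "((\<lambda>s. snd (f z)) has_derivative (\<lambda>r. snd (f' (r *\<^sub>R w)))) (at 0)"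
    by (rule has_derivative_transform_within_open[OF _ open_greaterThanLessThan[of "-e" e]]) (use e c in auto)
  then have "(\<lambda>r. snd (f' (r *\<^sub>R w))) = (\<lambda>r. 0)"
    by (rule has_derivative_unique) simp
  from fun_cong[OF this, of 1] show ?thesis by simp
qed

lemma foliated_atlas_smooth: "foliated_atlas A \<Longrightarrow> smooth_atlas A"
  by (simp add: foliated_atlas_def)

lemma foliated_atlas_locally_constant:
  assumes A: "foliated_atlas A" "c \<in> A" "c' \<in> A" and x: "x \<in> cdom c" "x \<in> cdom c'"
  obtains U where "open U" "x \<in> U" "U \<subseteq> cdom c \<inter> cdom c'"
    "\<And>y y'. y \<in> U \<Longrightarrow> y' \<in> U \<Longrightarrow> snd (coord c y) = snd (coord c y') \<Longrightarrow> snd (coord c' y) = snd (coord c' y')"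
proof -
  have sA: "smooth_atlas A" using A(1) by (rule foliated_atlas_smooth)
  obtain W where W: "open W" "coord c x \<in> W" "W \<subseteq> coord c ` (cdom c \<inter> cdom c')"
    "\<And>z z'. z \<in> W \<Longrightarrow> z' \<in> W \<Longrightarrow> snd z = snd z' \<Longrightarrow> snd (in_charts id c c' z) = snd (in_charts id c c' z')"
    using A x unfolding foliated_atlas_def by (metis IntI)
  have inj: "chart_inv c (coord c y) = y" if "y \<in> cdom c" for y
    using smooth_atlas_inv(1)[OF sA A(2) that] .
  define U where "U = coord c -` W \<inter> cdom c"
  have "open U"
    unfolding U_def
    using smooth_atlas_continuous(1)[OF sA A(2)] smooth_atlas_open(1)[OF sA A(2)] W(1)
      continuous_on_open_vimage by blast
  moreover have "x \<in> U" using W(2) x by (simp add: U_def)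
  moreover have "U \<subseteq> cdom c \<inter> cdom c'"
  proof
    fix y assume y: "y \<in> U"
    then obtain y' where y': "coord c y = coord c y'" "y' \<in> cdom c" "y' \<in> cdom c'"
      using W(3) unfolding U_def by blast
    have "y = y'" using inj[of y] inj[OF y'(2)] y y'(1) by (simp add: U_def)
    then show "y \<in> cdom c \<inter> cdom c'" using y' by simp
  qed
  moreover have "snd (coord c' y) = snd (coord c' y')"
    if "y \<in> U" "y' \<in> U" "snd (coord c y) = snd (coord c y')" for y y'
    using W(4)[of "coord c y" "coord c y'"] that by (simp add: U_def in_charts_def inj)
  ultimately show ?thesis by (rule that)
qed

lemma transition_tangent_space:
  assumes A: "foliated_atlas A" "c \<in> A" "c' \<in> A" and x: "x \<in> cdom c" "x \<in> cdom c'"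
    and w: "w \<in> tangent_space"
  shows "chart_deriv id c c' x w \<in> tangent_space"
proof -
  have sA: "smooth_atlas A" using A(1) by (rule foliated_atlas_smooth)
  obtain W where W: "open W" "coord c x \<in> W"
    "\<And>z z'. z \<in> W \<Longrightarrow> z' \<in> W \<Longrightarrow> snd z = snd z' \<Longrightarrow> snd (in_charts id c c' z) = snd (in_charts id c c' z')"
    using A x unfolding foliated_atlas_def by (metis IntI)
  have "open ((\<lambda>s. coord c x + s *\<^sub>R w) -` W)"
    by (rule open_vimage[OF W(1)]) (intro continuous_intros)
  then obtain e where e: "e > 0" "ball 0 e \<subseteq> (\<lambda>s. coord c x + s *\<^sub>R w) -` W"
    using W(2) by (elim openE[where x = 0]) auto
  have "snd (chart_deriv id c c' x w) = 0"
  proof (rule has_derivative_snd_zero[OF has_derivative_transition[OF sA A(2,3) x] e(1)])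
    fix s :: real assume "\<bar>s\<bar> < e"
    then have "s \<in> ball 0 e" by simp
    then have "coord c x + s *\<^sub>R w \<in> W" using e(2) by blast
    then show "snd (in_charts id c c' (coord c x + s *\<^sub>R w)) = snd (in_charts id c c' (coord c x))"
      by (rule W(3)) (use W(2) w in \<open>simp_all add: mem_tangent_space\<close>)
  qed
  then show ?thesis by (simp add: mem_tangent_space)
qed

section \<open>A leaf meets a chart in countably many slices\<close>

text \<open>By the Lindelof property, countably many open sets on which \<open>f\<close> takes at
  most one value on \<open>D\<close> already cover \<open>D\<close>.\<close>

lemma countable_locally_constant_image:
  fixes f :: "'a::second_countable_topology \<Rightarrow> 'b"
  assumes "\<And>y. y \<in> D \<Longrightarrow> \<exists>U. open U \<and> y \<in> U \<and> (\<forall>y'\<in>U \<inter> D. f y' = f y)"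
  shows "countable (f ` D)"
proof -
  define F where "F = {U. open U \<and> (\<forall>y\<in>U \<inter> D. \<forall>y'\<in>U \<inter> D. f y' = f y)}"
  obtain F' where F': "F' \<subseteq> F" "countable F'" "\<Union>F' = \<Union>F"
  proof (rule Lindelof[of F])
    show "open U" if "U \<in> F" for U using that by (simp add: F_def)
  qed
  have "D \<subseteq> \<Union>F"
  proof
    fix y assume "y \<in> D"
    then obtain U where U: "open U" "y \<in> U" "\<forall>y'\<in>U \<inter> D. f y' = f y" using assms by blast
    then have "U \<in> F" by (simp add: F_def)
    then show "y \<in> \<Union>F" using U(2) by blast
  qed
  then have "f ` D \<subseteq> (\<Union>U\<in>F'. f ` (U \<inter> D))" using F'(3) by blast
  moreover have "countable (\<Union>U\<in>F'. f ` (U \<inter> D))"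
    using F'(2)
  proof (rule countable_UN)
    fix U assume "U \<in> F'"
    show "countable (f ` (U \<inter> D))"
    proof (cases "U \<inter> D = {}")
      case False
      then obtain y where "y \<in> U \<inter> D" by blast
      then have "f ` (U \<inter> D) \<subseteq> {f y}" using \<open>U \<in> F'\<close> F'(1) by (auto simp: F_def)
      then show ?thesis by (rule countable_subset) simp
    qed simp
  qed
  ultimately show ?thesis by (rule countable_subset)
qed

text \<open>Transitions preserve slices locally, so the transverse coordinate of \<open>c'\<close>
  is locally constant on a slice of \<open>c\<close>.\<close>

lemma countable_plaques_of_chart:
  assumes A: "foliated_atlas A" "c \<in> A" "c' \<in> A"
  shows "countable ((\<lambda>y. snd (coord c' y)) ` {y \<in> cdom c \<inter> cdom c'. snd (coord c y) = b})"
proof (rule countable_locally_constant_image)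
  fix y assume y: "y \<in> {y \<in> cdom c \<inter> cdom c'. snd (coord c y) = b}"
  obtain U where U: "open U" "y \<in> U"
    "\<And>y y'. y \<in> U \<Longrightarrow> y' \<in> U \<Longrightarrow> snd (coord c y) = snd (coord c y') \<Longrightarrow> snd (coord c' y) = snd (coord c' y')"
    using foliated_atlas_locally_constant[OF A, of y] y by (metis (lifting) Int_iff mem_Collect_eq)
  show "\<exists>U. open U \<and> y \<in> U \<and>
      (\<forall>y'\<in>U \<inter> {y \<in> cdom c \<inter> cdom c'. snd (coord c y) = b}. snd (coord c' y') = snd (coord c' y))"
    by (intro exI[of _ U] conjI U(1,2) ballI U(3)) (use y U(2) in auto)
qed

text \<open>
  Lindelof: countably many charts cover the manifold, and each slice of a chart meets only
  countably many slices of another one. Hence the slices reached from a given one by chains of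
  intersecting slices are countable in number, and they cover the leaf.
\<close>

lemma countable_leaf_transversal:
  fixes A :: "('m::{t2_space,second_countable_topology}, 'p::real_normed_vector \<times> 'q::real_normed_vector) chart set"
  assumes A: "foliated_atlas A" and c: "c \<in> A"
  shows "countable ((\<lambda>y. snd (coord c y)) ` (leaf A x \<inter> cdom c))"
proof -
  have sA: "smooth_atlas A" using A(1) by (rule foliated_atlas_smooth)
  obtain F where F: "F \<subseteq> cdom ` A" "countable F" "\<Union>F = \<Union>(cdom ` A)"
    by (rule Lindelof[of "cdom ` A"]) (use smooth_atlas_open(1)[OF sA] in auto)
  obtain A0 where A0: "A0 \<subseteq> A" "countable A0" "F = cdom ` A0"
    using F(1,2) by (metis countable_subset_image)
  have cover: "\<exists>c\<in>A0. y \<in> cdom c" for y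
    using F(3) A0(3) smooth_atlas_cover[OF sA, of y] by blast
  \<comment> \<open>A pair \<open>(c, b)\<close> stands for the slice of \<open>c\<close> with
    transverse coordinate \<open>b\<close>; related slices intersect.\<close>
  define R where "R = {((c, b), (c', b')) | c b c' b'. c' \<in> A0 \<and> c \<in> A0 \<and>
    b' \<in> (\<lambda>y. snd (coord c' y)) ` {y \<in> cdom c \<inter> cdom c'. snd (coord c y) = b}}"
  obtain c0 where c0: "c0 \<in> A0" "x \<in> cdom c0" using cover by blast
  define Q where "Q = R\<^sup>* `` {(c0, snd (coord c0 x))}"
  have "countable Q"
    unfolding Q_def
  proof (rule countable_rtrancl)
    fix Y :: "(('m, 'p \<times> 'q) chart \<times> 'q) set" assume Y: "countable Y"
    have "R `` Y \<subseteq> (\<Union>(c, b)\<in>Y. if c \<in> A0 then \<Union>c'\<in>A0.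
        Pair c' ` (\<lambda>y. snd (coord c' y)) ` {y \<in> cdom c \<inter> cdom c'. snd (coord c y) = b} else {})"
      by (fastforce simp: R_def)
    moreover have "countable \<dots>"
    proof (rule countable_UN[OF Y])
      fix q assume "q \<in> Y"
      obtain c b where q: "q = (c, b)" by (cases q)
      have "countable (\<Union>c'\<in>A0. Pair c' ` (\<lambda>y. snd (coord c' y)) ` {y \<in> cdom c \<inter> cdom c'. snd (coord c y) = b})"
        if "c \<in> A0"
        by (intro countable_UN A0(2) countable_image countable_plaques_of_chart[OF A]) (use that A0(1) in auto)
      then show "countable (case q of (c, b) \<Rightarrow> if c \<in> A0 then \<Union>c'\<in>A0.
        Pair c' ` (\<lambda>y. snd (coord c' y)) ` {y \<in> cdom c \<inter> cdom c'. snd (coord c y) = b} else {})"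
        unfolding q by simp
    qed
    ultimately show "countable (R `` Y)" by (rule countable_subset)
  qed simp
  \<comment> \<open>The union of the slices that are reached. It remains to see that it absorbs
    every plaque that it meets.\<close>
  define K where "K = {y. \<exists>(c, b)\<in>Q. y \<in> cdom c \<and> snd (coord c y) = b}"
  have Q_A0: "c \<in> A0" if "(c, b) \<in> Q" for c b
  proof -
    have "((c0, snd (coord c0 x)), (c, b)) \<in> R\<^sup>*" using that by (simp add: Q_def)
    then show ?thesis by (cases rule: rtranclE) (use c0 in \<open>auto simp: R_def\<close>)
  qed
  have K_step: "y' \<in> K" if y: "y \<in> K" "y \<in> cdom c" "y' \<in> cdom c" "c \<in> A0"
    "snd (coord c y) = snd (coord c y')" for y y' c
  proof -
    obtain c1 b1 where 1: "(c1, b1) \<in> Q" "y \<in> cdom c1" "snd (coord c1 y) = b1"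
      using y(1) by (auto simp: K_def)
    have "((c1, b1), (c, snd (coord c y))) \<in> R"
      unfolding R_def using 1 y Q_A0[OF 1(1)] by (auto intro!: image_eqI[of _ _ y])
    then have "(c, snd (coord c y)) \<in> Q" using 1(1) unfolding Q_def by (auto intro: rtrancl_into_rtrancl)
    then show ?thesis using y by (auto simp: K_def)
  qed
  have K_plaque: "y' \<in> K" if y: "y \<in> K" and yy': "same_plaque A y y'" for y y'
  proof -
    obtain c where cc: "c \<in> A" "y \<in> cdom c" "y' \<in> cdom c"
      "connected_component (crange c \<inter> (UNIV \<times> {snd (coord c y)})) (coord c y) (coord c y')"
      using yy' by (auto simp: same_plaque_def)
    obtain C where C: "connected C" "C \<subseteq> crange c \<inter> (UNIV \<times> {snd (coord c y)})"
      "coord c y \<in> C" "coord c y' \<in> C"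
      using cc(4) by (auto simp: connected_component_def)
    \<comment> \<open>The chart \<open>c\<close> of the plaque need not belong to \<open>A0\<close>.
      Near each point of \<open>C\<close>, however, points of \<open>C\<close> lie in one slice of a
      chart from \<open>A0\<close>, so membership in \<open>K\<close> is locally constant on the
      connected set \<open>C\<close>.\<close>
    have loc: "\<exists>W. open W \<and> z \<in> W \<and> (\<forall>z'\<in>W \<inter> C. chart_inv c z' \<in> K \<longleftrightarrow> chart_inv c z \<in> K)"
      if z: "z \<in> C" for z
    proof -
      have zc: "z \<in> crange c" using z C(2) by blast
      note zc = zc smooth_atlas_inv_in[OF sA cc(1) zc]
      obtain c1 where c1: "c1 \<in> A0" "chart_inv c z \<in> cdom c1" using cover by blast
      then have "c1 \<in> A" using A0 by blast
      then obtain U where U: "open U" "chart_inv c z \<in> U" "U \<subseteq> cdom c \<inter> cdom c1"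
        "\<And>y y'. y \<in> U \<Longrightarrow> y' \<in> U \<Longrightarrow> snd (coord c y) = snd (coord c y') \<Longrightarrow> snd (coord c1 y) = snd (coord c1 y')"
        using foliated_atlas_locally_constant[OF A cc(1) _ zc(2) c1(2)] by metis
      define W where "W = chart_inv c -` U \<inter> crange c"
      have "open W" unfolding W_def
        using smooth_atlas_continuous(2)[OF sA cc(1)] smooth_atlas_open(2)[OF sA cc(1)] U(1)
          continuous_on_open_vimage by blast
      moreover have "z \<in> W" using zc U by (simp add: W_def)
      moreover have "chart_inv c z' \<in> K \<longleftrightarrow> chart_inv c z \<in> K" if z': "z' \<in> W" "z' \<in> C" for z'
      proof -
        have zU: "chart_inv c z' \<in> U" using z' by (simp add: W_def)
        have "snd z' = snd z" using subsetD[OF C(2) z] subsetD[OF C(2) z'(2)]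
          by (simp add: mem_Times_iff)
        then have "snd (coord c (chart_inv c z')) = snd (coord c (chart_inv c z))"
          using smooth_atlas_inv(2)[OF sA cc(1)] z' zc by (simp add: W_def)
        then have eq: "snd (coord c1 (chart_inv c z')) = snd (coord c1 (chart_inv c z))"
          using U(4)[OF zU U(2)] by blast
        have in1: "chart_inv c z' \<in> cdom c1" using zU U(3) by blast
        show ?thesis
          using K_step[OF _ in1 c1(2,1) eq] K_step[OF _ c1(2) in1 c1(1) eq[symmetric]] by blast
      qed
      ultimately show ?thesis by (intro exI[of _ W]) blast
    qed
    have "chart_inv c ` C \<subseteq> K"
    proof (rule ccontr)
      assume "\<not> ?thesis"
      then obtain z1 where z1: "z1 \<in> C" "chart_inv c z1 \<notin> K" by blast
      define X where "X k = \<Union>{W. open W \<and> (\<forall>z\<in>W \<inter> C. chart_inv c z \<in> K \<longleftrightarrow> k)}" for k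
      have op: "open (X k)" for k unfolding X_def by (rule open_Union) simp
      have inX: "z \<in> X (chart_inv c z \<in> K)" if "z \<in> C" for z
        using loc[OF that] unfolding X_def by blast
      have notX: "(chart_inv c z \<in> K) = k" if "z \<in> C" "z \<in> X k" for z k
        using that unfolding X_def by blast
      have "X True \<inter> X False \<inter> C = {}" using notX by blast
      moreover have "C \<subseteq> X True \<union> X False"
      proof
        fix z assume z: "z \<in> C"
        show "z \<in> X True \<union> X False" using inX[OF z] by (cases "chart_inv c z \<in> K") simp_all
      qed
      moreover have "X False \<inter> C \<noteq> {}" using inX[OF z1(1)] z1 by auto
      moreover have "X True \<inter> C \<noteq> {}"
      proof -
        have "chart_inv c (coord c y) \<in> K" using y smooth_atlas_inv(1)[OF sA cc(1,2)] by simp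
        then show ?thesis using inX[OF C(3)] C(3) by auto
      qed
      ultimately show False using connectedD[OF C(1) op op] by blast
    qed
    then have "chart_inv c (coord c y') \<in> K" using C(4) by blast
    then show ?thesis using smooth_atlas_inv(1)[OF sA cc(1,3)] by simp
  qed
  have "y \<in> K" if "y \<in> leaf A x" for y
  proof -
    have "(same_plaque A)\<^sup>*\<^sup>* x y" using that by (simp add: leaf_def)
    then show ?thesis
    proof (induction rule: rtranclp_induct)
      case base
      have "(c0, snd (coord c0 x)) \<in> Q" by (simp add: Q_def)
      then show ?case using c0 by (auto simp: K_def)
    next
      case (step y z)
      show ?case by (rule K_plaque[OF step.IH step.hyps(2)])
    qed
  qed
  then have "(\<lambda>y. snd (coord c y)) ` (leaf A x \<inter> cdom c)
      \<subseteq> (\<Union>(c1, b1)\<in>Q. (\<lambda>y. snd (coord c y)) ` {y \<in> cdom c1 \<inter> cdom c. snd (coord c1 y) = b1})"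
    unfolding K_def by fast
  moreover have "countable \<dots>"
    using \<open>countable Q\<close>
  proof (rule countable_UN)
    fix q assume "q \<in> Q"
    then show "countable (case q of (c1, b1) \<Rightarrow> (\<lambda>y. snd (coord c y)) ` {y \<in> cdom c1 \<inter> cdom c. snd (coord c1 y) = b1})"
    proof (cases q)
      case (Pair c1 b1)
      then have "c1 \<in> A" using \<open>q \<in> Q\<close> Q_A0 A0(1) by blast
      then show ?thesis unfolding Pair prod.case by (rule countable_plaques_of_chart[OF A _ c])
    qed
  qed
  ultimately show ?thesis by (rule countable_subset)
qed

lemma leaf_trans: "y \<in> leaf A x \<Longrightarrow> z \<in> leaf A y \<Longrightarrow> z \<in> leaf A x"
  by (simp add: leaf_def)

text \<open>Leaf membership is assumed along a straight line through \<open>p\<close> only. This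
  form covers leaf directions of the source and the time direction of a homotopy alike.\<close>

lemma plot_deriv_tangent:
  fixes B :: "('n::{t2_space,second_countable_topology}, 'r::real_normed_vector \<times> 's::real_normed_vector) chart set"
  assumes B: "foliated_atlas B" "c \<in> B" and G: "plot B S G" and p: "p \<in> S" "G p \<in> cdom c"
    and e: "e > 0" and leaf: "\<And>s. \<bar>s\<bar> < e \<Longrightarrow> G (p + s *\<^sub>R u) \<in> leaf B y"
  shows "plot_deriv c G p u \<in> tangent_space"
proof -
  have sB: "smooth_atlas B" using B(1) by (rule foliated_atlas_smooth)
  let ?W = "{p\<in>S. G p \<in> cdom c}"
  have "open ((\<lambda>s. p + s *\<^sub>R u) -` ?W)"
    by (rule open_vimage[OF plot_domain_open[OF sB B(2) G]]) (intro continuous_intros)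
  then obtain d where d: "d > 0" "ball 0 d \<subseteq> (\<lambda>s. p + s *\<^sub>R u) -` ?W"
    using p by (elim openE[where x = 0]) auto
  define r where "r = min d e"
  have r: "r > 0" using d e by (simp add: r_def)
  have inW: "p + s *\<^sub>R u \<in> ?W" if "\<bar>s\<bar> < r" for s
  proof -
    have "s \<in> ball 0 d" using that by (simp add: r_def)
    then show ?thesis using d(2) by blast
  qed
  define \<gamma> where "\<gamma> s = snd ((coord c \<circ> G) (p + s *\<^sub>R u))" for s
  have "continuous_on {-r<..<r} \<gamma>"
    unfolding \<gamma>_def
    by (intro continuous_on_snd continuous_on_compose2[OF smooth_on_imp_continuous_on[OF plot_smooth[OF B(2) G]]]
        continuous_intros) (use inW in auto)
  then have conn: "connected (\<gamma> ` {-r<..<r})" by (rule connected_continuous_image) simp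
  have "\<gamma> ` {-r<..<r} \<subseteq> (\<lambda>y. snd (coord c y)) ` (leaf B y \<inter> cdom c)"
  proof (rule image_subsetI)
    fix s assume "s \<in> {-r<..<r}"
    then have "\<bar>s\<bar> < r" by auto
    then have "G (p + s *\<^sub>R u) \<in> leaf B y \<inter> cdom c" using inW[of s] leaf[of s] by (simp add: r_def)
    then show "\<gamma> s \<in> (\<lambda>y. snd (coord c y)) ` (leaf B y \<inter> cdom c)"
      unfolding \<gamma>_def comp_def by (rule imageI)
  qed
  then have count: "countable (\<gamma> ` {-r<..<r})"
    using countable_leaf_transversal[OF B] countable_subset by blast
  have const: "\<gamma> s = \<gamma> 0" if "\<bar>s\<bar> < r" for s
  proof (rule ccontr)
    assume "\<gamma> s \<noteq> \<gamma> 0"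
    moreover have "\<gamma> s \<in> \<gamma> ` {-r<..<r}" "\<gamma> 0 \<in> \<gamma> ` {-r<..<r}"
      by (intro imageI; use that r in auto)+
    ultimately show False using connected_uncountable[OF conn] count by blast
  qed
  have "snd (plot_deriv c G p u) = 0"
    by (rule has_derivative_snd_zero[OF plot_has_derivative[OF sB B(2) G p] r])
      (use const in \<open>simp add: \<gamma>_def\<close>)
  then show ?thesis by (simp add: mem_tangent_space)
qed

text \<open>A short segment in a leaf direction is a connected part of a slice of the chart, hence
  lies in one plaque.\<close>

lemma leaf_line:
  fixes A :: "('m::{t2_space,second_countable_topology}, 'p::real_normed_vector \<times> 'q::real_normed_vector) chart set"
  assumes A: "smooth_atlas A" "c \<in> A" and z: "z \<in> crange c" and w: "w \<in> tangent_space"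
  shows "\<exists>e>0. \<forall>s. \<bar>s\<bar> < e \<longrightarrow> z + s *\<^sub>R w \<in> crange c \<and> chart_inv c (z + s *\<^sub>R w) \<in> leaf A (chart_inv c z)"
proof -
  have "open ((\<lambda>s. z + s *\<^sub>R w) -` crange c)"
    by (rule open_vimage[OF smooth_atlas_open(2)[OF A]]) (intro continuous_intros)
  then obtain e where e: "e > 0" "ball 0 e \<subseteq> (\<lambda>s. z + s *\<^sub>R w) -` crange c"
    using z by (elim openE[where x = 0]) auto
  have in_range: "z + s *\<^sub>R w \<in> crange c" if "\<bar>s\<bar> < e" for s
  proof -
    have "s \<in> ball 0 e" using that by simp
    then show ?thesis using e(2) by blast
  qed
  have "chart_inv c (z + s *\<^sub>R w) \<in> leaf A (chart_inv c z)" if s: "\<bar>s\<bar> < e" for s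
  proof -
    let ?C = "(\<lambda>s. z + s *\<^sub>R w) ` {-e<..<e}"
    have "connected ?C" by (intro connected_continuous_image continuous_intros) simp
    moreover have "?C \<subseteq> crange c \<inter> (UNIV \<times> {snd z})"
    proof (rule image_subsetI)
      fix t assume "t \<in> {-e<..<e}"
      then have "\<bar>t\<bar> < e" by auto
      then show "z + t *\<^sub>R w \<in> crange c \<inter> (UNIV \<times> {snd z})"
        using in_range w by (simp add: mem_tangent_space mem_Times_iff)
    qed
    moreover have "z \<in> ?C" "z + s *\<^sub>R w \<in> ?C"
      using e(1) s by (auto intro: image_eqI[of _ _ 0] image_eqI[of _ _ s] simp: abs_less_iff)
    ultimately have "connected_component (crange c \<inter> (UNIV \<times> {snd z})) z (z + s *\<^sub>R w)"
      unfolding connected_component_def by blast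
    then have "same_plaque A (chart_inv c z) (chart_inv c (z + s *\<^sub>R w))"
      unfolding same_plaque_def
      using smooth_atlas_inv(2)[OF A] smooth_atlas_inv_in[OF A] z in_range[OF s] A(2)
      by (intro bexI[of _ c]) simp_all
    then show ?thesis by (simp add: leaf_def r_into_rtranclp)
  qed
  with e(1) in_range show ?thesis by (intro exI[of _ e]) simp
qed

section \<open>The projection onto the leaf direction\<close>

text \<open>Gram-Schmidt without normalization, which displays the smooth dependence on
  \<open>z\<close>. If the next vector \<open>e\<close> is not in the span, its part
  \<open>n z\<close> orthogonal to the span is nonzero, and the projection onto \<open>n z\<close>
  is added.\<close>

lemma orthogonal_projection_exists:
  fixes g :: "'x::real_normed_vector \<Rightarrow> 'e::real_normed_vector \<Rightarrow> 'e \<Rightarrow> real"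
  assumes fd: "finite_dimensional TYPE('e)"
    and bil: "\<And>z. z \<in> S \<Longrightarrow> bilinear (g z)" and sym: "\<And>z u v. z \<in> S \<Longrightarrow> g z u v = g z v u"
    and pos: "\<And>z v. z \<in> S \<Longrightarrow> v \<noteq> 0 \<Longrightarrow> g z v v > 0"
    and sm: "\<And>u v. smooth_on S (\<lambda>z. g z u v)" and F: "finite F"
  shows "\<exists>P. (\<forall>z\<in>S. \<forall>w. P z w \<in> span F \<and> (\<forall>u\<in>span F. g z u (w - P z w) = 0)) \<and>
    (\<forall>w. smooth_on S (\<lambda>z. P z w))"
  using F
proof (induction F rule: finite_induct)
  case empty
  show ?case
    by (rule exI[of _ "\<lambda>z w. 0"]) (simp add: bilinear_lzero[OF bil] smooth_on_const)
next
  case (insert e F)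
  then obtain P where P: "\<And>z w. z \<in> S \<Longrightarrow> P z w \<in> span F"
    "\<And>z w u. z \<in> S \<Longrightarrow> u \<in> span F \<Longrightarrow> g z u (w - P z w) = 0" "\<And>w. smooth_on S (\<lambda>z. P z w)"
    by blast
  show ?case
  proof (cases "e \<in> span F")
    case True
    then have "span (insert e F) = span F" by (rule span_redundant)
    then show ?thesis using P by (intro exI[of _ P]) simp
  next
    case False
    define n where "n z = e - P z e" for z
    have n0: "n z \<noteq> 0" if "z \<in> S" for z using P(1)[OF that, of e] False by (auto simp: n_def)
    have nF: "n z \<in> span (insert e F)" if "z \<in> S" for z
      unfolding n_def using P(1)[OF that, of e] span_mono[of F "insert e F"]
      by (intro span_diff) (auto intro: span_base)
    define P' where "P' z w = P z w + (g z w (n z) / g z (n z) (n z)) *\<^sub>R n z" for z w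
    have smn: "smooth_on S n" unfolding n_def[abs_def] by (intro smooth_on_diff smooth_on_const P(3))
    have smg: "smooth_on S (\<lambda>z. g z (U z) (V z))" if "smooth_on S U" "smooth_on S V" for U V
    proof -
      have "multilinear_form 2 (\<lambda>v. g z (v 0) (v 1))" if z: "z \<in> S" for z
      proof -
        have l: "linear (\<lambda>y. g z x y)" "linear (\<lambda>y. g z y x)" for x
          using bil[OF z] by (simp_all add: bilinear_def)
        have "linear (\<lambda>u. g z ((v(i := u)) 0) ((v(i := u)) 1))" if "i < 2" for v :: "nat \<Rightarrow> 'e" and i
        proof -
          have "i = 0 \<or> i = 1" using that by auto
          then show ?thesis using l by auto
        qed
        then show ?thesis by (simp add: multilinear_form_def)
      qed
      moreover have "smooth_on S (\<lambda>z. if i = 0 then U z else V z)" for i :: nat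
        by (cases "i = 0") (simp_all add: that)
      ultimately have "smooth_on S (\<lambda>z. (\<lambda>v. g z (v 0) (v 1)) (\<lambda>i::nat. if i = 0 then U z else V z))"
        by (intro smooth_on_multilinear[OF fd, where k = 2 and a = "\<lambda>z v. g z (v 0) (v 1)"
              and V = "\<lambda>i z. if i = 0 then U z else V z"] sm)
      then show ?thesis by simp
    qed
    have "P' z w \<in> span (insert e F) \<and> (\<forall>u\<in>span (insert e F). g z u (w - P' z w) = 0)"
      if z: "z \<in> S" for z w
    proof
      have "P z w \<in> span (insert e F)" using P(1)[OF z] span_mono[of F "insert e F"] by blast
      then show "P' z w \<in> span (insert e F)" unfolding P'_def by (intro span_add span_scale nF[OF z])
      have gn: "g z (n z) (n z) \<noteq> 0" using pos[OF z n0[OF z]] by simp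
      have exp: "g z u (w - P' z w) = g z u (w - P z w) - (g z w (n z) / g z (n z) (n z)) * g z u (n z)" for u
        unfolding P'_def diff_diff_eq[symmetric]
        by (simp only: bilinear_rsub[OF bil[OF z]] bilinear_rmul[OF bil[OF z]]) simp
      have yF: "g z y (w - P' z w) = 0" if y: "y \<in> span F" for y
        unfolding exp using P(2)[OF z y, of w] P(2)[OF z y, of e] by (simp add: n_def)
      have "g z (n z) (P z w) = 0"
        using P(2)[OF z P(1)[OF z], of w e] sym[OF z] by (simp add: n_def)
      then have nn: "g z (n z) (w - P' z w) = 0"
        unfolding exp using gn sym[OF z, of "n z" w] by (simp add: bilinear_rsub[OF bil[OF z]])
      show "\<forall>u\<in>span (insert e F). g z u (w - P' z w) = 0"
      proof
        fix u assume "u \<in> span (insert e F)"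
        then obtain k where k: "u - k *\<^sub>R e \<in> span F" by (auto simp: span_breakdown_eq)
        define y where "y = (u - k *\<^sub>R e) + k *\<^sub>R P z e"
        have y: "y \<in> span F" unfolding y_def using k P(1)[OF z] by (intro span_add span_scale)
        have u: "u = y + k *\<^sub>R n z" by (simp add: y_def n_def algebra_simps)
        show "g z u (w - P' z w) = 0"
          unfolding u by (simp only: bilinear_ladd[OF bil[OF z]] bilinear_lmul[OF bil[OF z]] yF[OF y] nn) simp
      qed
    qed
    moreover have "smooth_on S (\<lambda>z. P' z w)" for w
    proof -
      have "g z (n z) (n z) \<noteq> 0" if "z \<in> S" for z using pos[OF that n0[OF that]] by simp
      then show ?thesis unfolding P'_def
        by (intro smooth_on_add P(3) smooth_on_scaleR smooth_on_divide smg smooth_on_const smn)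
    qed
    ultimately show ?thesis by (intro exI[of _ P']) blast
  qed
qed

lemma tangent_space_span:
  assumes "finite_dimensional TYPE('p::real_vector \<times> 'q::real_vector)"
  obtains F :: "('p::real_vector \<times> 'q::real_vector) set" where "finite F" "span F = tangent_space"
proof -
  obtain B :: "('p \<times> 'q) set" where B: "finite B" "span B = UNIV"
    using assms by (auto simp: finite_dimensional_def)
  let ?L = "\<lambda>w :: 'p \<times> 'q. (fst w, 0 :: 'q)"
  have "linear ?L" by (auto intro!: linearI)
  then have "span (?L ` B) = range ?L" using B by (simp add: linear_span_image)
  also have "\<dots> = tangent_space"
  proof (rule set_eqI)
    fix x :: "'p \<times> 'q" show "x \<in> range ?L \<longleftrightarrow> x \<in> tangent_space"
      by (cases x) (auto simp: mem_tangent_space intro: image_eqI[of _ _ x])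
  qed
  finally show ?thesis using that B by blast
qed

lemma riemannian_metricD:
  assumes "riemannian_metric A g"
  shows riemannian_metric_bilinear: "c \<in> A \<Longrightarrow> x \<in> cdom c \<Longrightarrow> bilinear (g c x)"
    and riemannian_metric_sym: "c \<in> A \<Longrightarrow> x \<in> cdom c \<Longrightarrow> g c x u v = g c x v u"
    and riemannian_metric_pos: "c \<in> A \<Longrightarrow> x \<in> cdom c \<Longrightarrow> v \<noteq> 0 \<Longrightarrow> g c x v v > 0"
    and riemannian_metric_change: "c \<in> A \<Longrightarrow> c' \<in> A \<Longrightarrow> x \<in> cdom c \<Longrightarrow> x \<in> cdom c' \<Longrightarrow>
      g c x u v = g c' x (chart_deriv id c c' x u) (chart_deriv id c c' x v)"
    and riemannian_metric_smooth: "c \<in> A \<Longrightarrow> smooth_on (crange c) (\<lambda>z. g c (chart_inv c z) u v)"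
proof -
  have 1: "bilinear (g c x) \<and> (\<forall>u v. g c x u v = g c x v u) \<and> (\<forall>v. v \<noteq> 0 \<longrightarrow> g c x v v > 0)"
    if "c \<in> A" "x \<in> cdom c"
    by (rule assms[unfolded riemannian_metric_def, THEN conjunct1, THEN bspec, THEN bspec, OF that])
  show "bilinear (g c x)" if "c \<in> A" "x \<in> cdom c" using 1[OF that] by (rule conjunct1)
  show "g c x u v = g c x v u" if "c \<in> A" "x \<in> cdom c"
    using 1[OF that, THEN conjunct2, THEN conjunct1] by blast
  show "g c x v v > 0" if "c \<in> A" "x \<in> cdom c" "v \<noteq> 0"
    using 1[OF that(1,2), THEN conjunct2, THEN conjunct2] that(3) by blast
  show "g c x u v = g c' x (chart_deriv id c c' x u) (chart_deriv id c c' x v)"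
    if "c \<in> A" "c' \<in> A" "x \<in> cdom c" "x \<in> cdom c'"
    using assms[unfolded riemannian_metric_def, THEN conjunct2, THEN conjunct1, rule_format, of c c' x u v] that
    by simp
  show "smooth_on (crange c) (\<lambda>z. g c (chart_inv c z) u v)" if "c \<in> A"
    using assms[unfolded riemannian_metric_def, THEN conjunct2, THEN conjunct2, rule_format, OF that] .
qed

locale foliated_riemannian =
  fixes A :: "('m::{t2_space,second_countable_topology}, 'p::real_normed_vector \<times> 'q::real_normed_vector) chart set"
    and g :: "('m, 'p \<times> 'q) metric_field"
  assumes foliated: "foliated_atlas A" and metric: "riemannian_metric A g"
begin

lemmas atlas = foliated_atlas_smooth[OF foliated]

text \<open>Provides existence and smooth dependence for the \<open>THE\<close> in
  \<open>tangential_part\<close>; uniqueness comes from positivity of the metric.\<close>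

lemma tangential_projection:
  assumes c: "c \<in> A"
  shows "\<exists>P. (\<forall>z\<in>crange c. \<forall>w. P z w \<in> tangent_space \<and> w - P z w \<in> normal_space g c (chart_inv c z)) \<and>
    (\<forall>w. smooth_on (crange c) (\<lambda>z. P z w))"
proof -
  obtain F :: "('p \<times> 'q) set" where F: "finite F" "span F = tangent_space"
    using tangent_space_span[OF smooth_atlas_finite_dimensional[OF atlas]] .
  note inv = smooth_atlas_inv_in[OF atlas c]
  have "\<exists>P. (\<forall>z\<in>crange c. \<forall>w. P z w \<in> span F \<and> (\<forall>u\<in>span F. g c (chart_inv c z) u (w - P z w) = 0)) \<and>
    (\<forall>w. smooth_on (crange c) (\<lambda>z. P z w))"
    by (rule orthogonal_projection_exists[OF smooth_atlas_finite_dimensional[OF atlas]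
        riemannian_metric_bilinear[OF metric c inv] riemannian_metric_sym[OF metric c inv]
        riemannian_metric_pos[OF metric c inv] riemannian_metric_smooth[OF metric c] F(1)])
  then show ?thesis by (simp only: F(2) normal_space_def mem_Collect_eq)
qed

lemma tangent_normal_trivial:
  assumes "c \<in> A" "x \<in> cdom c" "w \<in> tangent_space" "w \<in> normal_space g c x"
  shows "w = 0"
  using riemannian_metric_pos[OF metric assms(1,2), of w] assms(3,4)
  by (fastforce simp: normal_space_def)

lemma tangent_space_diff: "u \<in> tangent_space \<Longrightarrow> w \<in> tangent_space \<Longrightarrow> u - w \<in> tangent_space"
  by (simp add: mem_tangent_space)

lemma normal_space_diff:
  assumes "c \<in> A" "x \<in> cdom c" "u \<in> normal_space g c x" "w \<in> normal_space g c x"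
  shows "u - w \<in> normal_space g c x"
  using assms(3,4) by (simp add: normal_space_def bilinear_rsub[OF riemannian_metric_bilinear[OF metric assms(1,2)]])

lemma tangential_part_unique:
  assumes c: "c \<in> A" "x \<in> cdom c" and a: "a \<in> tangent_space" "w - a \<in> normal_space g c x"
  shows "tangential_part g c x w = a"
  unfolding tangential_part_def
proof (rule the_equality)
  fix b assume b: "b \<in> tangent_space \<and> w - b \<in> normal_space g c x"
  have "b - a = (w - a) - (w - b)" by simp
  then have "b - a \<in> normal_space g c x" using normal_space_diff[OF c a(2), of "w - b"] b by simp
  then have "b - a = 0" using tangent_normal_trivial[OF c] tangent_space_diff b a by blast
  then show "b = a" by simp
qed (use a in blast)

lemma tangential_part_in:
  assumes c: "c \<in> A" "x \<in> cdom c"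
  shows "tangential_part g c x w \<in> tangent_space" "w - tangential_part g c x w \<in> normal_space g c x"
proof -
  obtain P where P0: "\<forall>z\<in>crange c. \<forall>w. P z w \<in> tangent_space \<and> w - P z w \<in> normal_space g c (chart_inv c z)"
    and Ps: "\<forall>w. smooth_on (crange c) (\<lambda>z. P z w)"
    using tangential_projection[OF c(1)] by (elim exE conjE)
  have P: "P z w \<in> tangent_space" "w - P z w \<in> normal_space g c (chart_inv c z)" if "z \<in> crange c" for z w
    using P0[THEN bspec, OF that, THEN spec, of w] by simp_all
  have z: "coord c x \<in> crange c" using c(2) by (rule coord_in_crange)
  have a: "P (coord c x) w \<in> tangent_space" "w - P (coord c x) w \<in> normal_space g c x"
    using P(1)[OF z, of w] P(2)[OF z, of w] smooth_atlas_inv(1)[OF atlas c] by simp_all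
  show "tangential_part g c x w \<in> tangent_space" "w - tangential_part g c x w \<in> normal_space g c x"
    unfolding tangential_part_unique[OF c a] by (rule a)+
qed

lemma tangential_part_tangent:
  assumes c: "c \<in> A" "x \<in> cdom c" and w: "w \<in> tangent_space"
  shows "tangential_part g c x w = w"
  by (rule tangential_part_unique[OF c w])
    (simp add: normal_space_def bilinear_rzero[OF riemannian_metric_bilinear[OF metric c]])

lemma tangential_part_normal:
  assumes c: "c \<in> A" "x \<in> cdom c" and w: "w \<in> normal_space g c x"
  shows "tangential_part g c x w = 0"
  by (rule tangential_part_unique[OF c]) (simp_all add: w mem_tangent_space)

lemma tangential_part_linear:
  assumes c: "c \<in> A" "x \<in> cdom c"
  shows "linear (tangential_part g c x)"
proof (rule linearI)
  note bil = riemannian_metric_bilinear[OF metric c]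
  note tp = tangential_part_in[OF c]
  show "tangential_part g c x (u + w) = tangential_part g c x u + tangential_part g c x w" for u w
  proof (rule tangential_part_unique[OF c])
    have eq: "u + w - (tangential_part g c x u + tangential_part g c x w)
      = (u - tangential_part g c x u) + (w - tangential_part g c x w)" by simp
    show "u + w - (tangential_part g c x u + tangential_part g c x w) \<in> normal_space g c x"
      unfolding eq using tp(2)[of u] tp(2)[of w] by (simp add: normal_space_def bilinear_radd[OF bil])
  qed (use tp(1) in \<open>simp add: mem_tangent_space\<close>)
  show "tangential_part g c x (r *\<^sub>R u) = r *\<^sub>R tangential_part g c x u" for r u
  proof (rule tangential_part_unique[OF c])
    show "r *\<^sub>R u - r *\<^sub>R tangential_part g c x u \<in> normal_space g c x"
      using tp(2)[of u] unfolding scaleR_diff_right[symmetric]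
      by (simp add: normal_space_def bilinear_rmul[OF bil])
  qed (use tp(1) in \<open>simp add: mem_tangent_space\<close>)
qed

lemma tangential_part_smooth:
  assumes c: "c \<in> A"
  shows "smooth_on (crange c) (\<lambda>z. tangential_part g c (chart_inv c z) w)"
proof -
  obtain P where P0: "\<forall>z\<in>crange c. \<forall>w. P z w \<in> tangent_space \<and> w - P z w \<in> normal_space g c (chart_inv c z)"
    and Ps: "\<forall>w. smooth_on (crange c) (\<lambda>z. P z w)"
    using tangential_projection[OF c] by (elim exE conjE)
  have P: "P z w \<in> tangent_space" "w - P z w \<in> normal_space g c (chart_inv c z)" if "z \<in> crange c" for z w
    using P0[THEN bspec, OF that, THEN spec, of w] by simp_all
  show ?thesis
    by (rule smooth_on_cong[OF _ Ps[THEN spec, of w]])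
      (rule tangential_part_unique[OF c smooth_atlas_inv_in[OF atlas c] P(1,2), symmetric])
qed

lemma chart_inv_plot:
  assumes c: "c \<in> A"
  shows "plot A (crange c) (chart_inv c)"
  unfolding plot_def
proof (intro conjI ballI)
  show "open (crange c)" "continuous_on (crange c) (chart_inv c)"
    using smooth_atlas_open(2)[OF atlas c] smooth_atlas_continuous(2)[OF atlas c] by blast+
  fix c' assume c': "c' \<in> A"
  have "{p \<in> crange c. chart_inv c p \<in> cdom c'} \<subseteq> coord c ` (cdom c \<inter> cdom c')"
  proof
    fix p assume "p \<in> {p \<in> crange c. chart_inv c p \<in> cdom c'}"
    then show "p \<in> coord c ` (cdom c \<inter> cdom c')"
      using smooth_atlas_inv(2)[OF atlas c] smooth_atlas_inv_in[OF atlas c]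
      by (intro image_eqI[of _ _ "chart_inv c p"]) auto
  qed
  then show "smooth_on {p \<in> crange c. chart_inv c p \<in> cdom c'} (coord c' \<circ> chart_inv c)"
    using smooth_on_subset[OF smooth_atlas_transition[OF atlas c c']] by (simp add: in_charts_def)
qed

text \<open>The chain rule for the identity, obtained by reading the plot \<open>chart_inv c\<close>
  in \<open>c\<close> and in \<open>c'\<close>.\<close>

lemma transition_inverse:
  assumes c: "c \<in> A" "c' \<in> A" and x: "x \<in> cdom c" "x \<in> cdom c'"
  shows "chart_deriv id c' c x (chart_deriv id c c' x w) = w"
proof -
  note z = coord_in_crange[OF x(1)] and inv = smooth_atlas_inv(1)[OF atlas c(1) x(1)]
  have "((\<lambda>z. z) has_derivative (\<lambda>w. w)) (at (coord c x))" by (rule has_derivative_ident)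
  then have "((coord c \<circ> chart_inv c) has_derivative (\<lambda>w. w)) (at (coord c x))"
    by (rule has_derivative_transform_within_open[OF _ smooth_atlas_open(2)[OF atlas c(1)] z])
      (simp add: smooth_atlas_inv(2)[OF atlas c(1)])
  then have "plot_deriv c (chart_inv c) (coord c x) w = w"
    unfolding plot_deriv_def by (rule frechet_derivative_at_eq)
  moreover have "plot_deriv c' (chart_inv c) (coord c x) = chart_deriv id c c' x"
    by (simp add: plot_deriv_def chart_deriv_def in_charts_def)
  ultimately show ?thesis
    using plot_deriv_change[OF atlas c(2,1) chart_inv_plot[OF c(1)] z] inv x by simp
qed

lemma transition_linear:
  assumes c: "c \<in> A" "c' \<in> A" and x: "x \<in> cdom c" "x \<in> cdom c'"
  shows "linear (chart_deriv id c c' x)"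
  using has_derivative_transition[OF atlas c x] by (rule has_derivative_linear)

text \<open>Transitions preserve leaf directions, and so do their inverses. As isometries they then
  preserve normal vectors too, and the decomposition into both parts is unique.\<close>

lemma tangential_part_change:
  assumes c: "c \<in> A" "c' \<in> A" and x: "x \<in> cdom c" "x \<in> cdom c'"
  shows "chart_deriv id c c' x (tangential_part g c x w) = tangential_part g c' x (chart_deriv id c c' x w)"
proof (rule tangential_part_unique[OF c(2) x(2), symmetric])
  let ?L = "chart_deriv id c c' x"
  let ?n = "w - tangential_part g c x w"
  note tp = tangential_part_in[OF c(1) x(1), of w]
  show "?L (tangential_part g c x w) \<in> tangent_space"
    by (rule transition_tangent_space[OF foliated c x tp(1)])
  have "g c' x u (?L ?n) = 0" if u: "u \<in> tangent_space" for u
  proof -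
    let ?u = "chart_deriv id c' c x u"
    have "?u \<in> tangent_space" by (rule transition_tangent_space[OF foliated c(2,1) x(2,1) u])
    then have "g c x ?u ?n = 0" using tp(2) by (simp add: normal_space_def)
    then show ?thesis
      using riemannian_metric_change[OF metric c(2,1) x(2,1), of u "?L ?n"] by (simp add: transition_inverse[OF c x])
  qed
  then show "?L w - ?L (tangential_part g c x w) \<in> normal_space g c' x"
    by (simp add: normal_space_def linear_diff[OF transition_linear[OF c x], symmetric])
qed

section \<open>Bigraded differential forms\<close>

text \<open>Replaces the span of wedge products by a fixed-point equation, which is easy to verify
  for differences, multiples and projections of forms.\<close>

lemma Omega_iff:
  "\<alpha> \<in> Omega A g u v \<longleftrightarrow> differential_form A (u + v) \<alpha> \<and>
    (\<forall>c\<in>A. \<forall>x\<in>cdom c. component_at (tangential_part g c x) u (u + v) (\<alpha> c x) = \<alpha> c x)"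
proof -
  have "\<alpha> c x \<in> bigraded_forms tangent_space (normal_space g c x) u v \<longleftrightarrow>
      component_at (tangential_part g c x) u (u + v) (\<alpha> c x) = \<alpha> c x"
    if \<alpha>: "differential_form A (u + v) \<alpha>" and c: "c \<in> A" "x \<in> cdom c" for c x
  proof
    assume "\<alpha> c x \<in> bigraded_forms tangent_space (normal_space g c x) u v"
    from component_at_bigraded[OF this, of "tangential_part g c x" u] tangential_part_in[OF c]
    show "component_at (tangential_part g c x) u (u + v) (\<alpha> c x) = \<alpha> c x" by simp
  next
    assume eq: "component_at (tangential_part g c x) u (u + v) (\<alpha> c x) = \<alpha> c x"
    have "component_at (tangential_part g c x) u (u + v) (\<alpha> c x)
        \<in> bigraded_forms tangent_space (normal_space g c x) u v"
      by (rule component_at_in_bigraded_forms[OF smooth_atlas_finite_dimensional[OF atlas]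
            differential_form_alternating[OF \<alpha> c] tangential_part_linear[OF c]
            tangential_part_tangent[OF c] tangential_part_normal[OF c]])
    then show "\<alpha> c x \<in> bigraded_forms tangent_space (normal_space g c x) u v" unfolding eq .
  qed
  then show ?thesis unfolding Omega_def by blast
qed

lemma OmegaD:
  assumes "\<alpha> \<in> Omega A g u v"
  shows Omega_form: "differential_form A (u + v) \<alpha>"
    and Omega_component: "c \<in> A \<Longrightarrow> x \<in> cdom c \<Longrightarrow>
      component_at (tangential_part g c x) u (u + v) (\<alpha> c x) = \<alpha> c x"
    and Omega_outside: "\<not> (c \<in> A \<and> x \<in> cdom c) \<Longrightarrow> \<alpha> c x w = 0"
    and Omega_multilinear: "c \<in> A \<Longrightarrow> x \<in> cdom c \<Longrightarrow> multilinear_form (u + v) (\<alpha> c x)"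
proof -
  have \<alpha>: "differential_form A (u + v) \<alpha>" using assms unfolding Omega_iff by blast
  then show "differential_form A (u + v) \<alpha>" .
  show "component_at (tangential_part g c x) u (u + v) (\<alpha> c x) = \<alpha> c x" if "c \<in> A" "x \<in> cdom c"
    using assms that unfolding Omega_iff by blast
  show "\<not> (c \<in> A \<and> x \<in> cdom c) \<Longrightarrow> \<alpha> c x w = 0" by (rule differential_form_outside[OF \<alpha>])
  show "c \<in> A \<Longrightarrow> x \<in> cdom c \<Longrightarrow> multilinear_form (u + v) (\<alpha> c x)"
    by (rule alternating_imp_multilinear[OF differential_form_alternating[OF \<alpha>]])
qed

lemma tangential_part_idem:
  assumes c: "c \<in> A" "x \<in> cdom c"
  shows "tangential_part g c x (tangential_part g c x w) = tangential_part g c x w"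
  by (rule tangential_part_tangent[OF c tangential_part_in(1)[OF c]])

lemma bidegree_part_Omega:
  assumes \<beta>: "differential_form A (u + v) \<beta>"
  shows "bidegree_part g u v \<beta> \<in> Omega A g u v"
  unfolding Omega_iff
proof (intro conjI ballI)
  show "component_at (tangential_part g c x) u (u + v) (bidegree_part g u v \<beta> c x) = bidegree_part g u v \<beta> c x"
    if c: "c \<in> A" "x \<in> cdom c" for c x
    unfolding bidegree_part_def
    by (rule component_at_idem[OF alternating_imp_multilinear[OF differential_form_alternating[OF \<beta> c]]
          tangential_part_linear[OF c] tangential_part_idem[OF c]])
  show "differential_form A (u + v) (bidegree_part g u v \<beta>)"
    unfolding differential_form_def
  proof (intro conjI ballI allI impI)
    show "alternating_form (u + v) (bidegree_part g u v \<beta> c x)" if c: "c \<in> A" "x \<in> cdom c" for c x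
      unfolding bidegree_part_def
      by (rule alternating_form_component_at[OF differential_form_alternating[OF \<beta> c] tangential_part_linear[OF c]])
    show "bidegree_part g u v \<beta> c x w = bidegree_part g u v \<beta> c' x (\<lambda>i. chart_deriv id c c' x (w i))"
      if c: "c \<in> A" "c' \<in> A" and x: "x \<in> cdom c \<inter> cdom c'" for c c' x w
    proof -
      have x': "x \<in> cdom c" "x \<in> cdom c'" using x by auto
      have "(\<lambda>i. chart_deriv id c c' x (split_args (tangential_part g c x) S w i))
          = split_args (tangential_part g c' x) S (\<lambda>i. chart_deriv id c c' x (w i))" for S
        by (simp add: split_args_def fun_eq_iff linear_diff[OF transition_linear[OF c x']]
            tangential_part_change[OF c x'])
      then show ?thesis
        unfolding bidegree_part_def component_at_split_args
        by (simp add: differential_form_change[OF \<beta> c x'])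
    qed
    show "smooth_on (crange c) (\<lambda>z. bidegree_part g u v \<beta> c (chart_inv c z) w)" if c: "c \<in> A" for c w
      unfolding bidegree_part_def component_at_def
    proof (rule smooth_on_sum)
      fix S
      show "smooth_on (crange c) (\<lambda>z. \<beta> c (chart_inv c z) (\<lambda>i. if i \<in> S
          then w i - tangential_part g c (chart_inv c z) (w i) else tangential_part g c (chart_inv c z) (w i)))"
      proof (rule smooth_on_multilinear[OF smooth_atlas_finite_dimensional[OF atlas], where k = "u + v"])
        show "multilinear_form (u + v) (\<beta> c (chart_inv c z))" if "z \<in> crange c" for z
          by (rule alternating_imp_multilinear[OF differential_form_alternating[OF \<beta> c]])
            (rule smooth_atlas_inv_in[OF atlas c that])
        show "smooth_on (crange c) (\<lambda>z. \<beta> c (chart_inv c z) v)" for v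
          by (rule differential_form_smooth[OF \<beta> c])
        show "smooth_on (crange c) (\<lambda>z. if i \<in> S then w i - tangential_part g c (chart_inv c z) (w i)
            else tangential_part g c (chart_inv c z) (w i))" for i
          by (cases "i \<in> S") (simp_all add: tangential_part_smooth[OF c] smooth_on_diff smooth_on_const)
      qed
    qed
    show "bidegree_part g u v \<beta> c x w = 0" if "\<not> (c \<in> A \<and> x \<in> cdom c)" for c x w
      by (simp add: bidegree_part_def component_at_def differential_form_outside[OF \<beta> that])
  qed
qed

lemma Omega_count_zero:
  assumes \<alpha>: "\<alpha> \<in> Omega A g u v" and c: "c \<in> A" "x \<in> cdom c"
    and w: "count_in tangent_space (u + v) w > v"
  shows "\<alpha> c x w = 0"
  using component_at_count[OF Omega_multilinear[OF \<alpha> c] tangential_part_tangent[OF c] w]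
  by (simp add: Omega_component[OF \<alpha> c])

lemma bidegree_part_eq_of_count:
  assumes c: "c \<in> A" "x \<in> cdom c" and m: "multilinear_form (u + v) (\<beta> c x)"
    and z: "\<And>w. count_in tangent_space (u + v) w > v \<Longrightarrow> \<beta> c x w = 0"
    and w: "count_in tangent_space (u + v) w \<ge> v"
  shows "bidegree_part g u v \<beta> c x w = \<beta> c x w"
  unfolding bidegree_part_def
  by (rule component_at_eq_of_count[OF m tangential_part_tangent[OF c] tangential_part_in(1)[OF c] z w])

end

section \<open>The operators on bigraded forms, evaluated by counting leafwise arguments\<close>

lemma frechet_derivative_cong_open:
  assumes "open S" "x \<in> S" "\<And>y. y \<in> S \<Longrightarrow> f y = g y"
  shows "frechet_derivative f (at x) = frechet_derivative g (at x)"
proof -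
  have "(f has_derivative D) (at x) \<longleftrightarrow> (g has_derivative D) (at x)" for D
    using has_derivative_transform_within_open[of f D x UNIV S g]
      has_derivative_transform_within_open[of g D x UNIV S f] assms by auto
  then show ?thesis by (simp add: frechet_derivative_def)
qed

text \<open>The relations that express multilinearity are differentiated; uniqueness of the
  derivative transfers them to \<open>a'\<close>.\<close>

lemma multilinear_derivative:
  fixes a :: "'x::real_normed_vector \<Rightarrow> (nat \<Rightarrow> 'e::real_vector) \<Rightarrow> real"
  assumes S: "open S" "p \<in> S" and a: "\<And>q. q \<in> S \<Longrightarrow> multilinear_form k (a q)"
    and a': "\<And>v. ((\<lambda>q. a q v) has_derivative a' v) (at p)"
  shows "multilinear_form k (\<lambda>v. a' v h)"
proof -
  have uniq: "a' v = d" if "((\<lambda>q. b q) has_derivative d) (at p)" "\<And>q. q \<in> S \<Longrightarrow> b q = a q v" for v b d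
    using has_derivative_transform_within_open[OF that(1) S that(2)] has_derivative_unique[OF a'] by blast
  show ?thesis
    unfolding multilinear_form_def
  proof (intro conjI allI impI linearI)
    show "a' v h = a' w h" if "\<forall>i<k. v i = w i" for v w
      by (subst uniq[OF a'[of w]]) (use multilinear_cong[OF a, of _ w v] that in auto)
    fix v :: "nat \<Rightarrow> 'e" and i x y assume i: "i < k"
    show "a' (v(i := x + y)) h = a' (v(i := x)) h + a' (v(i := y)) h"
      by (subst uniq[OF has_derivative_add[OF a'[of "v(i := x)"] a'[of "v(i := y)"]]])
        (simp_all add: multilinear_add[OF a i])
    fix r :: real
    show "a' (v(i := r *\<^sub>R x)) h = r *\<^sub>R a' (v(i := x)) h"
      by (subst uniq[OF has_derivative_scaleR_right[OF a'[of "v(i := x)"], of r]])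
        (use linear_scale[OF multilinear_linear[OF a i]] in simp_all)
  qed
qed

lemma multilinear_form_omit:
  fixes b :: "'e::real_vector \<Rightarrow> (nat \<Rightarrow> 'e) \<Rightarrow> real"
  assumes b: "\<And>h. multilinear_form k (b h)" and lin: "\<And>w. linear (\<lambda>h. b h w)" and i: "i \<le> k"
  shows "multilinear_form (Suc k) (\<lambda>v. b (v i) (omit i v))"
  unfolding multilinear_form_def
proof (intro conjI allI impI)
  show "b (v i) (omit i v) = b (w i) (omit i w)" if "\<forall>j<Suc k. v j = w j" for v w
  proof -
    have "v i = w i" using that i by simp
    moreover have "b h (omit i v) = b h (omit i w)" for h
      by (rule multilinear_cong[OF b]) (use that in \<open>simp add: omit_def\<close>)
    ultimately show ?thesis by simp
  qed
  fix v :: "nat \<Rightarrow> 'e" and j assume j: "j < Suc k"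
  show "linear (\<lambda>u. b ((v(j := u)) i) (omit i (v(j := u))))"
  proof (cases "j = i")
    case True
    have "omit i (v(i := u)) = omit i v" for u by (auto simp: omit_def)
    then show ?thesis using lin True by simp
  next
    case False
    define j' where "j' = (if j < i then j else j - 1)"
    have "omit i (v(j := u)) = (omit i v)(j' := u)" for u
      using False by (auto simp: omit_def j'_def fun_eq_iff)
    moreover have "j' < k" using False j i by (auto simp: j'_def)
    ultimately show ?thesis using False multilinear_linear[OF b] by simp
  qed
qed

text \<open>The dichotomy behind all later sums over omitted arguments: omission costs at most one
  leafwise argument, and a non-leafwise one costs none, which leaves one too many and makes the term
  vanish.\<close>

lemma count_in_omit:
  assumes "i \<le> k"
  shows "count_in T (Suc k) w \<le> Suc (count_in T k (omit i w))"
    and "w i \<notin> T \<Longrightarrow> count_in T (Suc k) w \<le> count_in T k (omit i w)"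
proof -
  let ?s = "\<lambda>j. if j < i then j else Suc j"
  let ?J = "{j. j < k \<and> omit i w j \<in> T}"
  have sub: "{j. j < Suc k \<and> w j \<in> T} - {i} \<subseteq> ?s ` ?J"
  proof
    fix j assume j: "j \<in> {j. j < Suc k \<and> w j \<in> T} - {i}"
    show "j \<in> ?s ` ?J"
      by (rule image_eqI[of _ _ "if j < i then j else j - 1"]) (use j assms in \<open>auto simp: omit_def\<close>)
  qed
  have "card (?s ` ?J) \<le> count_in T k (omit i w)"
    unfolding count_in_def by (rule card_image_le) simp
  then have le: "card ({j. j < Suc k \<and> w j \<in> T} - {i}) \<le> count_in T k (omit i w)"
    using card_mono[OF _ sub] by simp
  show "count_in T (Suc k) w \<le> Suc (count_in T k (omit i w))"
  proof -
    have "count_in T (Suc k) w \<le> Suc (card ({j. j < Suc k \<and> w j \<in> T} - {i}))"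
      unfolding count_in_def by (cases "i \<in> {j. j < Suc k \<and> w j \<in> T}") (simp_all add: card_Diff_singleton)
    then show ?thesis using le by simp
  qed
  show "count_in T (Suc k) w \<le> count_in T k (omit i w)" if "w i \<notin> T"
  proof -
    have "{j. j < Suc k \<and> w j \<in> T} - {i} = {j. j < Suc k \<and> w j \<in> T}" using that by auto
    then show ?thesis using le by (simp add: count_in_def)
  qed
qed

lemma count_in_mono:
  assumes "\<And>i. i < k \<Longrightarrow> w i \<in> T \<Longrightarrow> w' i \<in> T'"
  shows "count_in T k w \<le> count_in T' k w'"
  unfolding count_in_def by (rule card_mono) (use assms in auto)

lemma count_in_split_args:
  assumes P: "\<And>x. P x \<in> T" and S: "S \<subseteq> {..<k}" "card S = u"
  shows "k - u \<le> count_in T k (split_args P S w)"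
proof -
  have "card ({..<k} - S) = k - u"
    using S finite_subset[OF S(1)] by (simp add: card_Diff_subset)
  moreover have "{..<k} - S \<subseteq> {i. i < k \<and> split_args P S w i \<in> T}"
    using P by (auto simp: split_args_def)
  ultimately show ?thesis
    unfolding count_in_def using card_mono[of "{i. i < k \<and> split_args P S w i \<in> T}" "{..<k} - S"] by simp
qed

context foliated_riemannian
begin

lemma form_has_derivative:
  assumes \<alpha>: "differential_form A k \<alpha>" and c: "c \<in> A" "x \<in> cdom c"
  shows "((\<lambda>z. \<alpha> c (chart_inv c z) w) has_derivative
    frechet_derivative (\<lambda>z. \<alpha> c (chart_inv c z) w) (at (coord c x))) (at (coord c x))"
  by (rule smooth_on_has_derivative[OF differential_form_smooth[OF \<alpha> c(1)] smooth_atlas_open(2)[OF atlas c(1)]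
        coord_in_crange[OF c(2)]])

lemma ext_deriv_multilinear:
  assumes \<alpha>: "differential_form A k \<alpha>" and c: "c \<in> A" "x \<in> cdom c"
  shows "multilinear_form (Suc k) (ext_deriv A k \<alpha> c x)"
proof -
  let ?b = "\<lambda>h w. frechet_derivative (\<lambda>z. \<alpha> c (chart_inv c z) w) (at (coord c x)) h"
  have m: "multilinear_form k (?b h)" for h
    by (rule multilinear_derivative[OF smooth_atlas_open(2)[OF atlas c(1)] coord_in_crange[OF c(2)],
          where a = "\<lambda>z w. \<alpha> c (chart_inv c z) w"])
      (rule alternating_imp_multilinear[OF differential_form_alternating[OF \<alpha> c(1) smooth_atlas_inv_in[OF atlas c(1)]]],
        assumption, rule form_has_derivative[OF \<alpha> c])
  have l: "linear (\<lambda>h. ?b h w)" for w using form_has_derivative[OF \<alpha> c] by (rule has_derivative_linear)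
  have "multilinear_form (Suc k) (\<lambda>v. \<Sum>i\<le>k. (-1) ^ i * ?b (v i) (omit i v))"
    by (intro multilinear_form_sum multilinear_form_scale multilinear_form_omit[where b = ?b, OF m l]) simp
  then show ?thesis unfolding ext_deriv_def using c by simp
qed

lemma wedge1_multilinear:
  assumes \<omega>: "differential_form A 1 \<omega>" and \<alpha>: "differential_form A k \<alpha>" and c: "c \<in> A" "x \<in> cdom c"
  shows "multilinear_form (Suc k) (wedge1 \<omega> k \<alpha> c x)"
proof -
  let ?b = "\<lambda>h w. \<omega> c x (\<lambda>_. h) * \<alpha> c x w"
  note m\<omega> = alternating_imp_multilinear[OF differential_form_alternating[OF \<omega> c]]
  note m\<alpha> = alternating_imp_multilinear[OF differential_form_alternating[OF \<alpha> c]]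
  have m: "multilinear_form k (?b h)" for h by (rule multilinear_form_scale[OF m\<alpha>])
  have l: "linear (\<lambda>h. ?b h w)" for w
  proof -
    have "\<omega> c x (\<lambda>_. h) = \<omega> c x ((\<lambda>_. 0)(0 := h))" for h by (rule multilinear_cong[OF m\<omega>]) simp
    then have "linear (\<lambda>h. \<omega> c x (\<lambda>_. h))" using multilinear_linear[OF m\<omega>, of 0 "\<lambda>_. 0"] by simp
    then have "linear (\<lambda>h. \<alpha> c x w *\<^sub>R \<omega> c x (\<lambda>_. h))" by (rule linear_compose_scale_right)
    then show ?thesis by (simp add: mult.commute)
  qed
  have "multilinear_form (Suc k) (\<lambda>v. \<Sum>i\<le>k. (-1) ^ i * ?b (v i) (omit i v))"
    by (intro multilinear_form_sum multilinear_form_scale multilinear_form_omit[where b = ?b, OF m l]) simp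
  then show ?thesis by (simp add: wedge1_def[abs_def] mult.assoc)
qed

text \<open>After one omission more than \<open>v\<close> leafwise arguments remain, so the
  functions to be differentiated vanish on the whole chart.\<close>

lemma ext_deriv_count_zero:
  assumes \<alpha>: "\<alpha> \<in> Omega A g u v" and c: "c \<in> A" "x \<in> cdom c"
    and w: "count_in tangent_space (Suc (u + v)) w > Suc v"
  shows "ext_deriv A (u + v) \<alpha> c x w = 0"
proof -
  have "frechet_derivative (\<lambda>z. \<alpha> c (chart_inv c z) (omit i w)) (at (coord c x)) (w i) = 0" if i: "i \<le> u + v" for i
  proof -
    have "count_in tangent_space (u + v) (omit i w) > v" using count_in_omit(1)[OF i, of tangent_space w] w by simp
    then have "frechet_derivative (\<lambda>z. \<alpha> c (chart_inv c z) (omit i w)) (at (coord c x))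
        = frechet_derivative (\<lambda>z. 0) (at (coord c x))"
      by (intro frechet_derivative_cong_open[OF smooth_atlas_open(2)[OF atlas c(1)] coord_in_crange[OF c(2)]]
          Omega_count_zero[OF \<alpha> c(1) smooth_atlas_inv_in[OF atlas c(1)]])
    then show ?thesis by simp
  qed
  then show ?thesis by (simp add: ext_deriv_def)
qed

lemma d_leaf_of_count:
  assumes \<alpha>: "\<alpha> \<in> Omega A g u v" and c: "c \<in> A" "x \<in> cdom c"
    and w: "count_in tangent_space (Suc (u + v)) w \<ge> Suc v"
  shows "d_leaf A g u v \<alpha> c x w = ext_deriv A (u + v) \<alpha> c x w"
  unfolding d_leaf_def
  by (rule bidegree_part_eq_of_count[OF c])
    (use ext_deriv_multilinear[OF Omega_form[OF \<alpha>] c] ext_deriv_count_zero[OF \<alpha> c] w in simp_all)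

lemma Omega_split_args_zero:
  assumes \<alpha>: "\<alpha> \<in> Omega A g u v" and c: "c \<in> A" "x \<in> cdom c"
    and S: "S \<subseteq> {..<u + v}" "card S \<noteq> u"
  shows "\<alpha> c x (split_args (tangential_part g c x) S w) = 0"
proof -
  let ?P = "tangential_part g c x"
  have z: "?P (y - ?P y) = 0" for y
    by (simp add: linear_diff[OF tangential_part_linear[OF c]] tangential_part_idem[OF c])
  have "\<alpha> c x (split_args ?P S' (split_args ?P S w)) = 0" if S': "S' \<subseteq> {..<u + v}" "card S' = u" for S'
  proof -
    have "S' \<noteq> S" using S S' by auto
    then obtain i where "i < u + v" "(i \<in> S') \<noteq> (i \<in> S)" using S S' by blast
    then show ?thesis
      by (intro multilinear_zero[OF Omega_multilinear[OF \<alpha> c], of i])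
        (auto simp: split_args_def z tangential_part_idem[OF c])
  qed
  then have "component_at ?P u (u + v) (\<alpha> c x) (split_args ?P S w) = 0"
    unfolding component_at_split_args by (intro sum.neutral) simp
  then show ?thesis by (simp add: Omega_component[OF \<alpha> c])
qed

text \<open>\<omega> kills normal vectors, so multiplication by it raises only the leafwise degree.
  The product may therefore be put under the projection that belongs to \<open>d_leaf\<close>, which
  makes \<open>d_MN\<close> a single component.\<close>

lemma wedge1_component:
  assumes \<omega>: "\<omega> \<in> Omega A g 0 1" and \<alpha>: "\<alpha> \<in> Omega A g u v" and c: "c \<in> A" "x \<in> cdom c"
  shows "component_at (tangential_part g c x) u (Suc (u + v)) (wedge1 \<omega> (u + v) \<alpha> c x) w
    = wedge1 \<omega> (u + v) \<alpha> c x w"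
proof (rule component_at_eq_self)
  let ?P = "tangential_part g c x"
  show "multilinear_form (Suc (u + v)) (wedge1 \<omega> (u + v) \<alpha> c x)"
    using wedge1_multilinear[OF _ Omega_form[OF \<alpha>] c] Omega_form[OF \<omega>] by simp
  fix S assume S: "S \<subseteq> {..<Suc (u + v)}" "card S \<noteq> u"
  have fin: "finite S" using S(1) finite_subset by blast
  have "\<omega> c x (\<lambda>_. split_args ?P S w i) * \<alpha> c x (omit i (split_args ?P S w)) = 0" if i: "i \<le> u + v" for i
  proof (cases "i \<in> S")
    case True
    have "\<omega> c x (\<lambda>_. split_args ?P S w i) = \<omega> c x (split_args ?P {0} (\<lambda>_. w i))"
      by (rule multilinear_cong[OF Omega_multilinear[OF \<omega> c]]) (use True in \<open>simp add: split_args_def\<close>)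
    also have "\<dots> = 0" by (rule Omega_split_args_zero[OF \<omega> c]) auto
    finally show ?thesis by simp
  next
    case False
    let ?s = "\<lambda>j. if j < i then j else Suc j"
    \<comment> \<open>\<open>S\<close> in the numbering after the omission. As \<open>i\<close> is
      not in \<open>S\<close>, no element is lost and the size still differs from
      \<open>u\<close>.\<close>
    define S' where "S' = {j. ?s j \<in> S}"
    have om: "omit i (split_args ?P S w) = split_args ?P S' (omit i w)"
      by (auto simp: omit_def split_args_def S'_def fun_eq_iff)
    have img: "S = ?s ` S'"
    proof
      show "S \<subseteq> ?s ` S'"
      proof
        fix j assume "j \<in> S"
        moreover have "j \<noteq> i" using False \<open>j \<in> S\<close> by auto
        ultimately show "j \<in> ?s ` S'"
          by (intro image_eqI[of _ _ "if j < i then j else j - 1"]) (auto simp: S'_def)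
      qed
      show "?s ` S' \<subseteq> S" by (auto simp: S'_def)
    qed
    have "card (?s ` S') = card S'" by (rule card_image) (auto simp: inj_on_def split: if_splits)
    then have "card S' = card S" by (simp only: img[symmetric])
    moreover have "S' \<subseteq> {..<u + v}"
    proof
      fix j assume "j \<in> S'"
      then have "?s j < Suc (u + v)" using S(1) by (auto simp: S'_def simp del: less_Suc_eq)
      then show "j \<in> {..<u + v}" using i by (auto split: if_splits)
    qed
    ultimately show ?thesis
      using Omega_split_args_zero[OF \<alpha> c, of S' "omit i w"] S(2) om by simp
  qed
  then show "wedge1 \<omega> (u + v) \<alpha> c x (split_args ?P S w) = 0"
    by (simp add: wedge1_def mult.assoc sum.neutral)
qed

lemma d_MN_component:
  assumes \<omega>: "\<omega> \<in> Omega A g 0 1" and \<alpha>: "\<alpha> \<in> Omega A g u v" and c: "c \<in> A" "x \<in> cdom c"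
  shows "d_MN A g \<omega> u v \<alpha> c x = component_at (tangential_part g c x) u (Suc (u + v))
    (\<lambda>w. ext_deriv A (u + v) \<alpha> c x w + wedge1 \<omega> (u + v) \<alpha> c x w)"
  by (rule ext)
    (simp add: d_MN_def d_leaf_def bidegree_part_def component_at_add wedge1_component[OF assms])

lemma d_MN_outside:
  assumes \<alpha>: "\<alpha> \<in> Omega A g u v" and c: "\<not> (c \<in> A \<and> x \<in> cdom c)"
  shows "d_MN A g \<omega> u v \<alpha> c x w = 0"
proof -
  have "ext_deriv A (u + v) \<alpha> c x w = 0" for w unfolding ext_deriv_def using c by (rule if_not_P)
  moreover have "\<alpha> c x w = 0" for w by (rule Omega_outside[OF \<alpha> c])
  ultimately show ?thesis
    by (simp add: d_MN_def d_leaf_def bidegree_part_def component_at_def wedge1_def)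
qed

lemma d_MN_of_count:
  assumes \<alpha>: "\<alpha> \<in> Omega A g u v" and c: "c \<in> A" "x \<in> cdom c"
    and w: "count_in tangent_space (Suc (u + v)) w \<ge> Suc v"
  shows "d_MN A g \<omega> u v \<alpha> c x w = ext_deriv A (u + v) \<alpha> c x w + wedge1 \<omega> (u + v) \<alpha> c x w"
  by (simp add: d_MN_def d_leaf_of_count[OF assms])

lemma d_MN_multilinear:
  assumes \<omega>: "\<omega> \<in> Omega A g 0 1" and \<alpha>: "\<alpha> \<in> Omega A g u v" and c: "c \<in> A" "x \<in> cdom c"
  shows "multilinear_form (Suc (u + v)) (d_MN A g \<omega> u v \<alpha> c x)"
  unfolding d_MN_component[OF assms]
  using wedge1_multilinear[OF _ Omega_form[OF \<alpha>] c, of \<omega>] Omega_form[OF \<omega>]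
  by (intro multilinear_form_component_at[OF _ tangential_part_linear[OF c]] multilinear_form_add
      ext_deriv_multilinear[OF Omega_form[OF \<alpha>] c]) simp

lemma d_MN_count_zero:
  assumes \<omega>: "\<omega> \<in> Omega A g 0 1" and \<alpha>: "\<alpha> \<in> Omega A g u v" and c: "c \<in> A" "x \<in> cdom c"
    and w: "count_in tangent_space (Suc (u + v)) w > Suc v"
  shows "d_MN A g \<omega> u v \<alpha> c x w = 0"
proof -
  have "multilinear_form (u + Suc v) (\<lambda>w. ext_deriv A (u + v) \<alpha> c x w + wedge1 \<omega> (u + v) \<alpha> c x w)"
    using wedge1_multilinear[OF _ Omega_form[OF \<alpha>] c, of \<omega>] Omega_form[OF \<omega>]
      ext_deriv_multilinear[OF Omega_form[OF \<alpha>] c] by (simp add: multilinear_form_add)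
  then have "component_at (tangential_part g c x) u (u + Suc v)
      (\<lambda>w. ext_deriv A (u + v) \<alpha> c x w + wedge1 \<omega> (u + v) \<alpha> c x w) w = 0"
    by (rule component_at_count[OF _ tangential_part_tangent[OF c]]) (use w in simp_all)
  then show ?thesis by (simp add: d_MN_component[OF \<omega> \<alpha> c])
qed

text \<open>The projection in \<open>d_MN\<close> evaluates only arguments with \<open>u\<close>
  normal parts, hence with at least \<open>Suc v\<close> leafwise ones. Comparing the unprojected
  expression with \<gamma> on such arguments is therefore enough.\<close>

lemma d_MN_eqI:
  assumes \<omega>: "\<omega> \<in> Omega A g 0 1" and \<alpha>: "\<alpha> \<in> Omega A g u v"
    and \<gamma>: "\<And>c x. c \<in> A \<Longrightarrow> x \<in> cdom c \<Longrightarrow>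
      component_at (tangential_part g c x) u (Suc (u + v)) (\<gamma> c x) = \<gamma> c x"
    and out: "\<And>c x w. \<not> (c \<in> A \<and> x \<in> cdom c) \<Longrightarrow> \<gamma> c x w = 0"
    and eq: "\<And>c x w. c \<in> A \<Longrightarrow> x \<in> cdom c \<Longrightarrow> count_in tangent_space (Suc (u + v)) w \<ge> Suc v \<Longrightarrow>
      ext_deriv A (u + v) \<alpha> c x w + wedge1 \<omega> (u + v) \<alpha> c x w = \<gamma> c x w"
  shows "d_MN A g \<omega> u v \<alpha> = \<gamma>"
proof (intro ext)
  fix c x w
  show "d_MN A g \<omega> u v \<alpha> c x w = \<gamma> c x w"
  proof (cases "c \<in> A \<and> x \<in> cdom c")
    case True
    then have c: "c \<in> A" "x \<in> cdom c" by auto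
    have "component_at (tangential_part g c x) u (Suc (u + v))
        (\<lambda>w. ext_deriv A (u + v) \<alpha> c x w + wedge1 \<omega> (u + v) \<alpha> c x w) w
      = component_at (tangential_part g c x) u (Suc (u + v)) (\<gamma> c x) w"
    proof (rule component_at_cong)
      fix S assume S: "S \<subseteq> {..<Suc (u + v)}" "card S = u"
      have "Suc v \<le> count_in tangent_space (Suc (u + v)) (split_args (tangential_part g c x) S w)"
        using count_in_split_args[OF tangential_part_in(1)[OF c] S] by simp
      then show "ext_deriv A (u + v) \<alpha> c x (split_args (tangential_part g c x) S w)
          + wedge1 \<omega> (u + v) \<alpha> c x (split_args (tangential_part g c x) S w)
        = \<gamma> c x (split_args (tangential_part g c x) S w)" by (rule eq[OF c])
    qed
    then show ?thesis by (simp add: d_MN_component[OF \<omega> \<alpha> c] \<gamma>[OF c])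
  qed (simp add: d_MN_outside[OF \<alpha>] out)
qed

lemma Omega_zero: "zero_form \<in> Omega A g u v"
  unfolding Omega_iff differential_form_def
  by (simp add: zero_form_def alternating_form_zero smooth_on_const component_at_def[abs_def])

lemma differential_form_diff:
  assumes \<alpha>: "differential_form A k \<alpha>" and \<beta>: "differential_form A k \<beta>"
  shows "differential_form A k (\<lambda>c x w. \<alpha> c x w - \<beta> c x w)"
  unfolding differential_form_def
proof (intro conjI ballI allI impI)
  show "alternating_form k (\<lambda>w. \<alpha> c x w - \<beta> c x w)" if c: "c \<in> A" "x \<in> cdom c" for c x
    using alternating_form_add[OF differential_form_alternating[OF \<alpha> c]
        alternating_form_scale[OF differential_form_alternating[OF \<beta> c], of "-1"]] by simp
  show "\<alpha> c x w - \<beta> c x w = \<alpha> c' x (\<lambda>i. chart_deriv id c c' x (w i)) - \<beta> c' x (\<lambda>i. chart_deriv id c c' x (w i))"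
    if "c \<in> A" "c' \<in> A" "x \<in> cdom c \<inter> cdom c'" for c c' x w
    using differential_form_change[OF \<alpha>, of c c' x w] differential_form_change[OF \<beta>, of c c' x w] that by simp
  show "smooth_on (crange c) (\<lambda>z. \<alpha> c (chart_inv c z) w - \<beta> c (chart_inv c z) w)" if "c \<in> A" for c w
    by (intro smooth_on_diff differential_form_smooth[OF \<alpha> that] differential_form_smooth[OF \<beta> that])
  show "\<alpha> c x w - \<beta> c x w = 0" if "\<not> (c \<in> A \<and> x \<in> cdom c)" for c x w
    by (simp add: differential_form_outside[OF \<alpha> that] differential_form_outside[OF \<beta> that])
qed

lemma Omega_diff:
  assumes \<alpha>: "\<alpha> \<in> Omega A g u v" and \<beta>: "\<beta> \<in> Omega A g u v"
  shows "(\<lambda>c x w. \<alpha> c x w - \<beta> c x w) \<in> Omega A g u v"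
  unfolding Omega_iff
  using differential_form_diff[OF Omega_form[OF \<alpha>] Omega_form[OF \<beta>]]
  by (auto simp: component_at_diff fun_eq_iff Omega_component[OF \<alpha>] Omega_component[OF \<beta>])

lemma Omega_scale:
  assumes h: "smooth_function A h" and \<alpha>: "\<alpha> \<in> Omega A g u v"
  shows "scale_form h \<alpha> \<in> Omega A g u v"
  unfolding Omega_iff differential_form_def scale_form_def
proof (intro conjI ballI allI impI)
  note \<alpha>' = Omega_form[OF \<alpha>]
  show "alternating_form (u + v) (\<lambda>w. h x * \<alpha> c x w)" if c: "c \<in> A" "x \<in> cdom c" for c x
    by (rule alternating_form_scale[OF differential_form_alternating[OF \<alpha>' c]])
  show "h x * \<alpha> c x w = h x * \<alpha> c' x (\<lambda>i. chart_deriv id c c' x (w i))"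
    if "c \<in> A" "c' \<in> A" "x \<in> cdom c \<inter> cdom c'" for c c' x w
    using differential_form_change[OF \<alpha>', of c c' x w] that by simp
  show "smooth_on (crange c) (\<lambda>z. h (chart_inv c z) * \<alpha> c (chart_inv c z) w)" if c: "c \<in> A" for c w
    using h c by (intro smooth_on_mult differential_form_smooth[OF \<alpha>']) (simp_all add: smooth_function_def comp_def)
  show "h x * \<alpha> c x w = 0" if "\<not> (c \<in> A \<and> x \<in> cdom c)" for c x w
    by (simp add: Omega_outside[OF \<alpha> that])
  show "component_at (tangential_part g c x) u (u + v) (\<lambda>w. h x * \<alpha> c x w) = (\<lambda>w. h x * \<alpha> c x w)"
    if "c \<in> A" "x \<in> cdom c" for c x
    by (simp add: fun_eq_iff component_at_scale Omega_component[OF \<alpha> that])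
qed

lemma ext_deriv_diff:
  assumes \<alpha>: "differential_form A k \<alpha>" and \<beta>: "differential_form A k \<beta>"
  shows "ext_deriv A k (\<lambda>c x w. \<alpha> c x w - \<beta> c x w) c x w = ext_deriv A k \<alpha> c x w - ext_deriv A k \<beta> c x w"
proof (cases "c \<in> A \<and> x \<in> cdom c")
  case True
  then have c: "c \<in> A" "x \<in> cdom c" by auto
  have "frechet_derivative (\<lambda>z. \<alpha> c (chart_inv c z) y - \<beta> c (chart_inv c z) y) (at (coord c x)) h
    = frechet_derivative (\<lambda>z. \<alpha> c (chart_inv c z) y) (at (coord c x)) h
      - frechet_derivative (\<lambda>z. \<beta> c (chart_inv c z) y) (at (coord c x)) h" for y h
    by (rule frechet_derivative_at_eq)
      (rule has_derivative_diff[OF form_has_derivative[OF \<alpha> c] form_has_derivative[OF \<beta> c]])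
  then show ?thesis by (simp add: ext_deriv_def right_diff_distrib sum_subtractf)
qed (auto simp: ext_deriv_def)

lemma d_MN_diff:
  assumes \<alpha>: "\<alpha> \<in> Omega A g u v" and \<beta>: "\<beta> \<in> Omega A g u v"
  shows "d_MN A g \<omega> u v (\<lambda>c x w. \<alpha> c x w - \<beta> c x w) c x w = d_MN A g \<omega> u v \<alpha> c x w - d_MN A g \<omega> u v \<beta> c x w"
proof -
  have "ext_deriv A (u + v) (\<lambda>c x w. \<alpha> c x w - \<beta> c x w) c x
      = (\<lambda>w. ext_deriv A (u + v) \<alpha> c x w - ext_deriv A (u + v) \<beta> c x w)"
    by (rule ext) (rule ext_deriv_diff[OF Omega_form[OF \<alpha>] Omega_form[OF \<beta>]])
  then show ?thesis
    by (simp add: d_MN_def d_leaf_def bidegree_part_def component_at_diff wedge1_def right_diff_distrib sum_subtractf)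
qed

end

section \<open>Foliated pullbacks\<close>

text \<open>\<open>T\<close> is the same at every point, because leaf directions are constant in
  foliated coordinates. It will be \<open>tangent_space\<close> for maps in a chart and
  \<open>time_tangent\<close> for the homotopy.\<close>

definition tangential_plot ::
  "('n::topological_space, 'r::real_normed_vector \<times> 's::real_normed_vector) chart set \<Rightarrow>
   'x::real_normed_vector set \<Rightarrow> ('x \<Rightarrow> 'n) \<Rightarrow> 'x set \<Rightarrow> bool" where
  "tangential_plot B S G T \<longleftrightarrow> plot B S G \<and>
     (\<forall>p\<in>S. \<forall>c\<in>B. G p \<in> cdom c \<longrightarrow> (\<forall>u\<in>T. plot_deriv c G p u \<in> tangent_space))"

lemma tangential_plotD:
  assumes "tangential_plot B S G T"
  shows tangential_plot_plot: "plot B S G"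
    and tangential_plot_deriv: "p \<in> S \<Longrightarrow> c \<in> B \<Longrightarrow> G p \<in> cdom c \<Longrightarrow> u \<in> T \<Longrightarrow> plot_deriv c G p u \<in> tangent_space"
  using assms unfolding tangential_plot_def by blast+

lemma pull_cong_open:
  fixes B :: "('n, 'e::real_normed_vector) chart set"
  assumes S: "open S" "p \<in> S" and eq: "\<And>q. q \<in> S \<Longrightarrow> G q = G' q"
  shows "pull B G \<alpha> p w = pull B G' \<alpha> p w"
proof -
  have "plot_deriv c G p = plot_deriv c G' p" for c :: "('n, 'e) chart"
    unfolding plot_deriv_def by (rule frechet_derivative_cong_open[OF S]) (simp add: eq)
  then show ?thesis by (simp add: pull_def Let_def eq[OF S(2)])
qed

context foliated_riemannian
begin

lemma pull_count_zero:
  assumes \<alpha>: "\<alpha> \<in> Omega A g u v" and G: "tangential_plot A S G T" and p: "p \<in> S"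
    and w: "count_in T (u + v) w > v"
  shows "pull A G \<alpha> p w = 0"
proof -
  note c = chart_exists[OF atlas, of "G p"]
  show ?thesis
    unfolding pull_def Let_def
    by (rule Omega_count_zero[OF \<alpha> c])
      (rule less_le_trans[OF w count_in_mono], rule tangential_plot_deriv[OF G p c])
qed

text \<open>The plot turns vectors of \<open>T\<close> into leafwise ones, so the count removes the
  projection from \<open>d_MN\<close> in the target, and \<open>pull_ext_deriv\<close> applies. The
  right-hand side is the twisted derivative of the pulled-back forms, in coordinates and without any
  metric.\<close>

lemma pull_d_MN:
  assumes \<alpha>: "\<alpha> \<in> Omega A g u v" and G: "tangential_plot A S G T" and p: "p \<in> S"
    and w: "count_in T (Suc (u + v)) w \<ge> Suc v"
  shows "pull A G (d_MN A g \<omega> u v \<alpha>) p w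
    = (\<Sum>i\<le>u + v. (-1) ^ i * frechet_derivative (\<lambda>q. pull A G \<alpha> q (omit i w)) (at p) (w i))
      + (\<Sum>i\<le>u + v. (-1) ^ i * pull A G \<omega> p (\<lambda>_. w i) * pull A G \<alpha> p (omit i w))"
proof -
  define c where "c = (SOME c. c \<in> A \<and> G p \<in> cdom c)"
  have c: "c \<in> A" "G p \<in> cdom c" unfolding c_def by (rule chart_exists[OF atlas])+
  let ?D = "plot_deriv c G p"
  have count: "count_in tangent_space (Suc (u + v)) (\<lambda>i. ?D (w i)) \<ge> Suc v"
    by (rule order_trans[OF w count_in_mono]) (rule tangential_plot_deriv[OF G p c])
  have pull: "pull A G \<gamma> p y = \<gamma> c (G p) (\<lambda>i. ?D (y i))" for \<gamma> y
    by (simp add: pull_def c_def[symmetric])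
  have om: "omit i (\<lambda>j. ?D (w j)) = (\<lambda>j. ?D (omit i w j))" for i by (simp add: omit_def fun_eq_iff)
  have "pull A G (d_MN A g \<omega> u v \<alpha>) p w
      = ext_deriv A (u + v) \<alpha> c (G p) (\<lambda>i. ?D (w i)) + wedge1 \<omega> (u + v) \<alpha> c (G p) (\<lambda>i. ?D (w i))"
    by (simp only: pull d_MN_of_count[OF \<alpha> c count])
  also have "ext_deriv A (u + v) \<alpha> c (G p) (\<lambda>i. ?D (w i))
      = (\<Sum>i\<le>u + v. (-1) ^ i * frechet_derivative (\<lambda>q. pull A G \<alpha> q (omit i w)) (at p) (w i))"
    by (rule pull_ext_deriv[OF atlas c(1) tangential_plot_plot[OF G] p c(2) Omega_form[OF \<alpha>], symmetric])
  also have "wedge1 \<omega> (u + v) \<alpha> c (G p) (\<lambda>i. ?D (w i))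
      = (\<Sum>i\<le>u + v. (-1) ^ i * pull A G \<omega> p (\<lambda>_. w i) * pull A G \<alpha> p (omit i w))"
    by (simp only: wedge1_def pull om)
  finally show ?thesis .
qed

lemma pull_d_leaf:
  assumes \<alpha>: "\<alpha> \<in> Omega A g u v" and G: "tangential_plot A S G T" and p: "p \<in> S"
    and w: "count_in T (Suc (u + v)) w \<ge> Suc v"
  shows "pull A G (d_leaf A g u v \<alpha>) p w
    = (\<Sum>i\<le>u + v. (-1) ^ i * frechet_derivative (\<lambda>q. pull A G \<alpha> q (omit i w)) (at p) (w i))"
proof -
  have "d_MN A g zero_form u v \<alpha> = d_leaf A g u v \<alpha>"
    by (simp add: d_MN_def wedge1_def zero_form_def)
  moreover have "pull A G zero_form p y = 0" for y by (simp add: pull_def zero_form_def)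
  ultimately show ?thesis using pull_d_MN[OF assms, of zero_form] by simp
qed

text \<open>One omission leaves at least \<open>v\<close> leafwise arguments. On these a projected
  form \<beta> may be replaced by an unprojected expression \<Phi> throughout the chart, hence also
  under the derivative.\<close>

lemma ext_deriv_of_count:
  assumes c: "c \<in> A" "x \<in> cdom c"
    and \<Phi>: "\<And>z y. z \<in> crange c \<Longrightarrow> count_in tangent_space k y \<ge> v \<Longrightarrow> \<beta> c (chart_inv c z) y = \<Phi> z y"
    and w: "count_in tangent_space (Suc k) w \<ge> Suc v"
  shows "ext_deriv A k \<beta> c x w
    = (\<Sum>i\<le>k. (-1) ^ i * frechet_derivative (\<lambda>z. \<Phi> z (omit i w)) (at (coord c x)) (w i))"
proof -
  have "frechet_derivative (\<lambda>z. \<beta> c (chart_inv c z) (omit i w)) (at (coord c x))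
      = frechet_derivative (\<lambda>z. \<Phi> z (omit i w)) (at (coord c x))" if i: "i \<le> k" for i
    by (rule frechet_derivative_cong_open[OF smooth_atlas_open(2)[OF atlas c(1)] coord_in_crange[OF c(2)]])
      (rule \<Phi>, assumption, use count_in_omit(1)[OF i, of tangent_space w] w in simp)
  then show ?thesis using c by (simp add: ext_deriv_def)
qed

end

locale foliated_pair =
  M: foliated_riemannian A gM + N: foliated_riemannian B gN
  for A :: "('m::{t2_space,second_countable_topology}, 'p::real_normed_vector \<times> 'q::real_normed_vector) chart set"
    and gM and B :: "('n::{t2_space,second_countable_topology}, 'r::real_normed_vector \<times> 's::real_normed_vector) chart set"
    and gN
begin

lemma smooth_map_plot:
  assumes f: "smooth_map A B f" and c: "c \<in> A"
  shows "plot B (crange c) (\<lambda>z. f (chart_inv c z))"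
  unfolding plot_def
proof (intro conjI ballI)
  show "open (crange c)" by (rule smooth_atlas_open(2)[OF M.atlas c])
  show "continuous_on (crange c) (\<lambda>z. f (chart_inv c z))"
    by (rule continuous_on_compose2[of UNIV f]) (use f smooth_atlas_continuous(2)[OF M.atlas c] in \<open>simp_all add: smooth_map_def\<close>)
  fix c' assume c': "c' \<in> B"
  have "{p \<in> crange c. f (chart_inv c p) \<in> cdom c'} \<subseteq> coord c ` {x \<in> cdom c. f x \<in> cdom c'}"
  proof
    fix p assume "p \<in> {p \<in> crange c. f (chart_inv c p) \<in> cdom c'}"
    then show "p \<in> coord c ` {x \<in> cdom c. f x \<in> cdom c'}"
      using smooth_atlas_inv(2)[OF M.atlas c] smooth_atlas_inv_in[OF M.atlas c]
      by (intro image_eqI[of _ _ "chart_inv c p"]) auto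
  qed
  moreover have "smooth_on (coord c ` {x \<in> cdom c. f x \<in> cdom c'}) (in_charts f c c')"
    using f c c' by (simp add: smooth_map_def)
  ultimately have "smooth_on {p \<in> crange c. f (chart_inv c p) \<in> cdom c'} (in_charts f c c')"
    by (rule smooth_on_subset[rotated])
  then show "smooth_on {p \<in> crange c. f (chart_inv c p) \<in> cdom c'} (coord c' \<circ> (\<lambda>z. f (chart_inv c z)))"
    by (simp add: in_charts_def comp_def)
qed

lemma foliated_map_plot:
  assumes f: "foliated_map A B f" and c: "c \<in> A"
  shows "tangential_plot B (crange c) (\<lambda>z. f (chart_inv c z)) tangent_space"
  unfolding tangential_plot_def
proof (intro conjI ballI impI)
  show plot: "plot B (crange c) (\<lambda>z. f (chart_inv c z))"
    using f c by (simp add: foliated_map_def smooth_map_plot)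
  fix z c' u
  assume z: "z \<in> crange c" and c': "c' \<in> B" "f (chart_inv c z) \<in> cdom c'"
    and u: "u \<in> (tangent_space :: ('p \<times> 'q) set)"
  obtain e where e: "e > 0"
    "\<forall>s. \<bar>s\<bar> < e \<longrightarrow> z + s *\<^sub>R u \<in> crange c \<and> chart_inv c (z + s *\<^sub>R u) \<in> leaf A (chart_inv c z)"
    using leaf_line[OF M.atlas c z u] by blast
  obtain y where y: "f ` leaf A (chart_inv c z) \<subseteq> leaf B y"
    using f by (auto simp: foliated_map_def maps_leaves_into_leaves_def)
  show "plot_deriv c' (\<lambda>z. f (chart_inv c z)) z u \<in> tangent_space"
    by (rule plot_deriv_tangent[OF N.foliated c'(1) plot z c'(2) e(1)]) (use e(2) y in blast)
qed

lemma pullback_form_pull: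
  "pullback_form A B f \<alpha> c x w
    = (if c \<in> A \<and> x \<in> cdom c then pull B (\<lambda>z. f (chart_inv c z)) \<alpha> (coord c x) w else 0)"
proof (cases "c \<in> A \<and> x \<in> cdom c")
  case True
  then have "chart_inv c (coord c x) = x" using smooth_atlas_inv(1)[OF M.atlas] by simp
  then show ?thesis
    using True by (simp add: pullback_form_def pull_def plot_deriv_def chart_deriv_def in_charts_def comp_def)
qed (auto simp: pullback_form_def)

lemma pull_transition:
  assumes f: "smooth_map A B f" and c: "c \<in> A" "c' \<in> A" and x: "x \<in> cdom c" "x \<in> cdom c'"
  shows "pull B (\<lambda>z. f (chart_inv c z)) \<alpha> (coord c x) w
    = pull B (\<lambda>z. f (chart_inv c' z)) \<alpha> (coord c' x) (\<lambda>i. chart_deriv id c c' x (w i))"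
proof -
  let ?\<psi> = "in_charts id c c'"
  have \<psi>: "?\<psi> (coord c y) = coord c' y" if "y \<in> cdom c" for y
    using smooth_atlas_inv(1)[OF M.atlas c(1) that] by (simp add: in_charts_def)
  have "pull B (\<lambda>z. f (chart_inv c z)) \<alpha> (coord c x) w = pull B (\<lambda>z. f (chart_inv c' (?\<psi> z))) \<alpha> (coord c x) w"
    by (rule pull_cong_open[OF open_coord_image[OF M.atlas c(1) smooth_atlas_open(1)[OF M.atlas c(2)]]])
      (use x \<psi> smooth_atlas_inv(1)[OF M.atlas c(1)] smooth_atlas_inv(1)[OF M.atlas c(2)] in auto)
  also have "\<dots> = pull B (\<lambda>z. f (chart_inv c' z)) \<alpha> (?\<psi> (coord c x)) (\<lambda>i. chart_deriv id c c' x (w i))"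
    by (rule pull_compose[OF N.atlas smooth_map_plot[OF f c(2)] has_derivative_transition[OF M.atlas c x]])
      (simp add: \<psi>[OF x(1)] coord_in_crange[OF x(2)])
  finally show ?thesis by (simp add: \<psi>[OF x(1)])
qed

lemma differential_form_pullback:
  assumes f: "smooth_map A B f" and \<alpha>: "differential_form B k \<alpha>"
  shows "differential_form A k (pullback_form A B f \<alpha>)"
  unfolding differential_form_def
proof (intro conjI ballI allI impI)
  show "alternating_form k (pullback_form A B f \<alpha> c x)" if c: "c \<in> A" "x \<in> cdom c" for c x
    using pull_alternating[OF N.atlas smooth_map_plot[OF f c(1)] coord_in_crange[OF c(2)] \<alpha>] c
    by (simp add: pullback_form_pull[abs_def])
  show "pullback_form A B f \<alpha> c x w = pullback_form A B f \<alpha> c' x (\<lambda>i. chart_deriv id c c' x (w i))"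
    if "c \<in> A" "c' \<in> A" "x \<in> cdom c \<inter> cdom c'" for c c' x w
    using pull_transition[OF f, of c c' x \<alpha> w] that by (simp add: pullback_form_pull)
  show "smooth_on (crange c) (\<lambda>z. pullback_form A B f \<alpha> c (chart_inv c z) w)" if c: "c \<in> A" for c w
    by (rule smooth_on_cong[OF _ pull_smooth[OF N.atlas smooth_map_plot[OF f c] \<alpha>, of w]])
      (simp add: pullback_form_pull c smooth_atlas_inv_in[OF M.atlas c] smooth_atlas_inv(2)[OF M.atlas c])
  show "pullback_form A B f \<alpha> c x w = 0" if "\<not> (c \<in> A \<and> x \<in> cdom c)" for c x w
    unfolding pullback_form_pull using that by (rule if_not_P)
qed

lemma foliated_pullback_Omega:
  assumes f: "foliated_map A B f" and \<alpha>: "\<alpha> \<in> Omega B gN u v"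
  shows "foliated_pullback A gM B f u v \<alpha> \<in> Omega A gM u v"
  unfolding foliated_pullback_def
  by (rule M.bidegree_part_Omega, rule differential_form_pullback[OF _ N.Omega_form[OF \<alpha>]])
    (use f in \<open>simp add: foliated_map_def\<close>)

lemma foliated_pullback_of_count:
  assumes f: "foliated_map A B f" and \<alpha>: "\<alpha> \<in> Omega B gN u v" and c: "c \<in> A" "x \<in> cdom c"
    and w: "count_in tangent_space (u + v) w \<ge> v"
  shows "foliated_pullback A gM B f u v \<alpha> c x w = pull B (\<lambda>z. f (chart_inv c z)) \<alpha> (coord c x) w"
proof -
  have sf: "smooth_map A B f" using f by (simp add: foliated_map_def)
  have "bidegree_part gM u v (pullback_form A B f \<alpha>) c x w = pullback_form A B f \<alpha> c x w"
  proof (rule M.bidegree_part_eq_of_count[OF c _ _ w])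
    show "multilinear_form (u + v) (pullback_form A B f \<alpha> c x)"
      by (rule alternating_imp_multilinear[OF differential_form_alternating[OF
            differential_form_pullback[OF sf N.Omega_form[OF \<alpha>]] c]])
    show "pullback_form A B f \<alpha> c x y = 0" if "count_in tangent_space (u + v) y > v" for y
      using N.pull_count_zero[OF \<alpha> foliated_map_plot[OF f c(1)] coord_in_crange[OF c(2)] that] c
      by (simp add: pullback_form_pull)
  qed
  then show ?thesis using c by (simp add: foliated_pullback_def pullback_form_pull)
qed

text \<open>
  If the \<open>i\<close>-th argument is not leafwise, then the \<open>i\<close>-th terms on both sides vanish, because the
  remaining arguments are leafwise too often.
\<close>

lemma wedge1_foliated_pullback:
  assumes f: "foliated_map A B f" and \<omega>: "\<omega> \<in> Omega B gN 0 1"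
    and c: "c \<in> A" "x \<in> cdom c" and w: "count_in tangent_space (Suc (u + v)) w \<ge> Suc v"
    and \<beta>: "\<And>y. count_in tangent_space (u + v) y \<ge> v \<Longrightarrow> \<beta> c x y = b y"
    and b: "\<And>y. count_in tangent_space (u + v) y > v \<Longrightarrow> b y = 0"
  shows "wedge1 (foliated_pullback A gM B f 0 1 \<omega>) (u + v) \<beta> c x w
    = (\<Sum>i\<le>u + v. (-1) ^ i * pull B (\<lambda>z. f (chart_inv c z)) \<omega> (coord c x) (\<lambda>_. w i) * b (omit i w))"
  unfolding wedge1_def
proof (rule sum.cong[OF refl])
  fix i assume "i \<in> {..u + v}"
  then have i: "i \<le> u + v" by simp
  have om: "count_in tangent_space (u + v) (omit i w) \<ge> v"
    using count_in_omit(1)[OF i, of tangent_space w] w by simp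
  show "(-1) ^ i * foliated_pullback A gM B f 0 1 \<omega> c x (\<lambda>_. w i) * \<beta> c x (omit i w)
      = (-1) ^ i * pull B (\<lambda>z. f (chart_inv c z)) \<omega> (coord c x) (\<lambda>_. w i) * b (omit i w)"
  proof (cases "w i \<in> tangent_space")
    case True
    then have "count_in tangent_space (0 + 1) (\<lambda>_. w i) \<ge> 1" by (simp add: count_in_def)
    then show ?thesis using foliated_pullback_of_count[OF f \<omega> c] \<beta>[OF om] by simp
  next
    case False
    then have "count_in tangent_space (u + v) (omit i w) > v"
      using count_in_omit(2)[OF i, of w tangent_space] w by simp
    then have "b (omit i w) = 0" by (rule b)
    then show ?thesis using \<beta>[OF om] by simp
  qed
qed

text \<open>Pullback is a cochain map. Both sides have bidegree \<open>(u, Suc v)\<close>, so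
  \<open>d_MN_eqI\<close> leaves only arguments with at least \<open>Suc v\<close> leafwise ones, on
  which every projection disappears and \<open>pull_d_MN\<close> gives the identity.\<close>

lemma d_MN_foliated_pullback:
  assumes f: "foliated_map A B f" and \<omega>: "\<omega> \<in> Omega B gN 0 1" and \<alpha>: "\<alpha> \<in> Omega B gN u v"
  shows "d_MN A gM (foliated_pullback A gM B f 0 1 \<omega>) u v (foliated_pullback A gM B f u v \<alpha>)
    = foliated_pullback A gM B f u (Suc v) (d_MN B gN \<omega> u v \<alpha>)"
proof (rule M.d_MN_eqI)
  let ?G = "\<lambda>c z. f (chart_inv c z)"
  let ?d = "d_MN B gN \<omega> u v \<alpha>"
  show "foliated_pullback A gM B f 0 1 \<omega> \<in> Omega A gM 0 1"
    "foliated_pullback A gM B f u v \<alpha> \<in> Omega A gM u v"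
    by (rule foliated_pullback_Omega[OF f \<omega>], rule foliated_pullback_Omega[OF f \<alpha>])
  \<comment> \<open>\<open>d_MN\<close> is available here as a multilinear form in each chart rather
    than as a differential form, so its pullback is examined in the one chart that
    \<open>pull\<close> selects.\<close>
  have mult: "multilinear_form (Suc (u + v)) (pullback_form A B f ?d c x)"
    if c: "c \<in> A" "x \<in> cdom c" for c x
  proof -
    let ?c' = "SOME c'. c' \<in> B \<and> f x \<in> cdom c'"
    have x: "chart_inv c (coord c x) = x" by (rule smooth_atlas_inv(1)[OF M.atlas c])
    note c' = chart_exists[OF N.atlas, of "f x"]
    have "linear (plot_deriv ?c' (?G c) (coord c x))"
      by (rule plot_deriv_linear[OF N.atlas c'(1) tangential_plot_plot[OF foliated_map_plot[OF f c(1)]] coord_in_crange[OF c(2)]])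
        (simp add: x c'(2))
    from multilinear_form_compose[OF N.d_MN_multilinear[OF \<omega> \<alpha> c'] this]
    show ?thesis using c by (simp add: pullback_form_pull[abs_def] pull_def Let_def x)
  qed
  show "component_at (tangential_part gM c x) u (Suc (u + v)) (foliated_pullback A gM B f u (Suc v) ?d c x)
      = foliated_pullback A gM B f u (Suc v) ?d c x" if c: "c \<in> A" "x \<in> cdom c" for c x
    unfolding foliated_pullback_def bidegree_part_def add_Suc_right
    by (rule component_at_idem[OF mult[OF c] M.tangential_part_linear[OF c] M.tangential_part_idem[OF c]])
  show "foliated_pullback A gM B f u (Suc v) ?d c x w = 0" if "\<not> (c \<in> A \<and> x \<in> cdom c)" for c x w
  proof -
    have "pullback_form A B f ?d c x y = 0" for y unfolding pullback_form_pull using that by (rule if_not_P)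
    then show ?thesis by (simp add: foliated_pullback_def bidegree_part_def component_at_def)
  qed
  fix c x and w :: "nat \<Rightarrow> 'p \<times> 'q"
  assume c: "c \<in> A" "x \<in> cdom c" and w: "count_in tangent_space (Suc (u + v)) w \<ge> Suc v"
  note G = foliated_map_plot[OF f c(1)] and p = coord_in_crange[OF c(2)]
  have inv: "z \<in> crange c \<Longrightarrow> coord c (chart_inv c z) = z" for z by (rule smooth_atlas_inv(2)[OF M.atlas c(1)])
  have fp: "foliated_pullback A gM B f u v \<alpha> c (chart_inv c z) y = pull B (?G c) \<alpha> z y"
    if "z \<in> crange c" "count_in tangent_space (u + v) y \<ge> v" for z y
    using foliated_pullback_of_count[OF f \<alpha> c(1) smooth_atlas_inv_in[OF M.atlas c(1) that(1)] that(2)] inv[OF that(1)]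
    by simp
  have "ext_deriv A (u + v) (foliated_pullback A gM B f u v \<alpha>) c x w
      + wedge1 (foliated_pullback A gM B f 0 1 \<omega>) (u + v) (foliated_pullback A gM B f u v \<alpha>) c x w
    = pull B (?G c) ?d (coord c x) w"
    unfolding N.pull_d_MN[OF \<alpha> G p w]
    by (intro arg_cong2[where f = "(+)"]
        M.ext_deriv_of_count[where \<Phi> = "pull B (?G c) \<alpha>" and v = v, OF c _ w] fp
        wedge1_foliated_pullback[where b = "pull B (?G c) \<alpha> (coord c x)", OF f \<omega> c w]
        foliated_pullback_of_count[OF f \<alpha> c] N.pull_count_zero[OF \<alpha> G p])
  also have "\<dots> = pullback_form A B f ?d c x w" using c by (simp add: pullback_form_pull)
  also have "\<dots> = foliated_pullback A gM B f u (Suc v) ?d c x w"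
    unfolding foliated_pullback_def
  proof (rule M.bidegree_part_eq_of_count[OF c, symmetric])
    show "multilinear_form (u + Suc v) (pullback_form A B f ?d c x)" using mult[OF c] by simp
    show "Suc v \<le> count_in tangent_space (u + Suc v) w" using w by simp
    fix y :: "nat \<Rightarrow> 'p \<times> 'q" assume y: "Suc v < count_in tangent_space (u + Suc v) y"
    note c' = chart_exists[OF N.atlas, of "?G c (coord c x)"]
    have "pull B (?G c) ?d (coord c x) y = 0"
      unfolding pull_def Let_def
      by (rule N.d_MN_count_zero[OF \<omega> \<alpha> c'])
        (rule less_le_trans[OF _ count_in_mono], use y in simp, rule tangential_plot_deriv[OF G p c'])
    then show "pullback_form A B f ?d c x y = 0" using c by (simp add: pullback_form_pull)
  qed
  finally show "ext_deriv A (u + v) (foliated_pullback A gM B f u v \<alpha>) c x w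
      + wedge1 (foliated_pullback A gM B f 0 1 \<omega>) (u + v) (foliated_pullback A gM B f u v \<alpha>) c x w
    = foliated_pullback A gM B f u (Suc v) ?d c x w" .
qed

end

section \<open>Primitives along the parameter of a homotopy\<close>

lemma integral_eq_of_real_derivative:
  fixes F f :: "real \<Rightarrow> real"
  assumes "\<And>s. (F has_real_derivative f s) (at s)"
  shows "integral {0..1} f = F 1 - F 0"
proof (rule integral_unique, rule fundamental_theorem_of_calculus)
  show "(F has_vector_derivative f s) (at s within {0..1})" for s
    by (rule has_vector_derivative_at_within)
      (rule assms[unfolded has_real_derivative_iff_has_vector_derivative])
qed simp

lemma smooth_on_curve_derivative:
  fixes \<phi> :: "'e::real_normed_vector \<times> real \<Rightarrow> real"
  assumes U: "open U" and \<phi>: "smooth_on (U \<times> UNIV) \<phi>" and z: "z \<in> U"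
  shows "((\<lambda>s. \<phi> (z, t * s)) has_real_derivative t * frechet_derivative \<phi> (at (z, t * s)) (0, 1)) (at s)"
proof -
  have UU: "open (U \<times> (UNIV :: real set))" using U by (simp add: open_Times)
  have D: "(\<phi> has_derivative frechet_derivative \<phi> (at (z, t * s))) (at (z, t * s))"
    by (rule smooth_on_has_derivative[OF \<phi> UU]) (use z in simp)
  have "((\<lambda>s. \<phi> (z, t * s)) has_derivative (\<lambda>r. frechet_derivative \<phi> (at (z, t * s)) (0, t * r))) (at s)"
    by (rule has_derivative_compose[where f = "\<lambda>s. (z, t * s)" and g = \<phi>, OF _ D])
      (auto intro!: derivative_eq_intros)
  moreover have "frechet_derivative \<phi> (at (z, t * s)) (0, t * r) = (t * frechet_derivative \<phi> (at (z, t * s)) (0, 1)) * r" for r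
    using linear_scale[OF has_derivative_linear[OF D], of "t * r" "(0, 1)"] by simp
  ultimately show ?thesis by (simp add: has_field_derivative_def)
qed

text \<open>
  \<open>t \<integral>\<^sub>0\<^sup>1 \<theta>(z, ts) ds\<close> is the primitive \<open>\<integral>\<^sub>0\<^sup>t \<theta>(z, s) ds\<close>, written such that it is visibly smooth
  in \<open>(z, t)\<close>.
\<close>

definition parameter_primitive :: "('e \<times> real \<Rightarrow> real) \<Rightarrow> 'e \<times> real \<Rightarrow> real" where
  "parameter_primitive \<theta> p = snd p * integral {0..1} (\<lambda>s. \<theta> (fst p, snd p * s))"

lemma parameter_primitive_zero: "parameter_primitive \<theta> (z, 0) = 0"
  by (simp add: parameter_primitive_def)

context
  fixes U :: "'e::real_normed_vector set" and \<theta> :: "'e \<times> real \<Rightarrow> real"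
  assumes fd: "finite_dimensional TYPE('e)" and U: "open U" and \<theta>: "smooth_on (U \<times> UNIV) \<theta>"
begin

lemma open_times_UNIV: "open (U \<times> (UNIV :: real set))"
  using U by (simp add: open_Times)

lemma finite_dimensional_times_real: "finite_dimensional TYPE('e \<times> real)"
  by (rule finite_dimensional_prod[OF fd finite_dimensional_real])

lemma primitive_integrand_smooth:
  "smooth_on ((U \<times> UNIV) \<times> UNIV) (\<lambda>x. \<theta> (fst (fst x), snd (fst x) * snd x))"
proof (rule smooth_on_compose[OF finite_dimensional_times_real \<theta>, where \<psi> = "\<lambda>x. (fst (fst x), snd (fst x) * snd x)"])
  let ?S = "(U \<times> (UNIV :: real set)) \<times> (UNIV :: real set)"
  have fst: "smooth_on ?S fst" by (rule smooth_on_bounded_linear[OF bounded_linear_fst smooth_on_id])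
  have snd: "smooth_on ?S snd" by (rule smooth_on_bounded_linear[OF bounded_linear_snd smooth_on_id])
  show "smooth_on ?S (\<lambda>x. (fst (fst x), snd (fst x) * snd x))"
    by (intro smooth_on_Pair smooth_on_mult smooth_on_bounded_linear[OF bounded_linear_fst fst]
        smooth_on_bounded_linear[OF bounded_linear_snd fst] snd)
qed auto

lemma parameter_primitive_smooth: "smooth_on (U \<times> UNIV) (parameter_primitive \<theta>)"
proof -
  have "smooth_on (U \<times> UNIV) (\<lambda>p. integral {0..1} (\<lambda>s. \<theta> (fst p, snd p * s)))"
    using smooth_on_integral_parameter[OF finite_dimensional_times_real open_times_UNIV primitive_integrand_smooth] by simp
  then show ?thesis
    unfolding parameter_primitive_def
    by (intro smooth_on_mult smooth_on_bounded_linear[OF bounded_linear_snd smooth_on_id])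
qed

lemma parameter_primitive_derivative:
  assumes z: "z \<in> U"
  shows "frechet_derivative (parameter_primitive \<theta>) (at (z, t)) (w, r)
    = r * integral {0..1} (\<lambda>s. \<theta> (z, t * s))
      + t * integral {0..1} (\<lambda>s. frechet_derivative \<theta> (at (z, t * s)) (w, r * s))"
proof -
  let ?\<phi> = "\<lambda>x. \<theta> (fst (fst x), snd (fst x) * snd x)"
  let ?I = "\<lambda>p. integral {0..1} (\<lambda>s. ?\<phi> (p, s))"
  have zt: "(z, t) \<in> U \<times> UNIV" using z by simp
  have D\<phi>: "frechet_derivative ?\<phi> (at ((z, t), s)) ((w, r), 0) = frechet_derivative \<theta> (at (z, t * s)) (w, r * s)" for s w r
  proof (rule frechet_derivative_at_eq[THEN trans])
    show "(?\<phi> has_derivative (\<lambda>h. frechet_derivative \<theta> (at (z, t * s))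
        (fst (fst h), t * snd h + snd (fst h) * s))) (at ((z, t), s))"
    proof (rule has_derivative_compose[where f = "\<lambda>x. (fst (fst x), snd (fst x) * snd x)" and g = \<theta>])
      show "((\<lambda>x. (fst (fst x), snd (fst x) * snd x)) has_derivative
          (\<lambda>h. (fst (fst h), t * snd h + snd (fst h) * s))) (at ((z, t), s))"
        by (auto intro!: derivative_eq_intros)
      show "(\<theta> has_derivative frechet_derivative \<theta> (at (z, t * s)))
          (at (fst (fst ((z, t), s)), snd (fst ((z, t), s)) * snd ((z, t), s)))"
        using smooth_on_has_derivative[OF \<theta> open_times_UNIV, of "(z, t * s)"] z by simp
    qed
  qed simp
  have "(?I has_derivative (\<lambda>v. integral {0..1} (\<lambda>s. frechet_derivative ?\<phi> (at ((z, t), s)) (v, 0)))) (at (z, t))"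
    by (rule has_derivative_integral_parameter[OF finite_dimensional_times_real open_times_UNIV primitive_integrand_smooth zt])
  from has_derivative_mult[OF has_derivative_snd[OF has_derivative_ident] this]
  have "(parameter_primitive \<theta> has_derivative (\<lambda>v. t * integral {0..1} (\<lambda>s. frechet_derivative ?\<phi> (at ((z, t), s)) (v, 0))
      + snd v * ?I (z, t))) (at (z, t))"
    by (simp add: parameter_primitive_def[abs_def])
  then have "frechet_derivative (parameter_primitive \<theta>) (at (z, t)) (w, r)
      = t * integral {0..1} (\<lambda>s. frechet_derivative ?\<phi> (at ((z, t), s)) ((w, r), 0)) + r * ?I (z, t)"
    using frechet_derivative_at_eq by fastforce
  then show ?thesis unfolding D\<phi> by simp
qed

text \<open>The product rule for the factor \<open>t\<close> produces the integral of the derivative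
  of \<open>s * \<theta> (z, t * s)\<close> with respect to \<open>s\<close>.\<close>

lemma parameter_primitive_derivative_parameter:
  assumes z: "z \<in> U"
  shows "frechet_derivative (parameter_primitive \<theta>) (at (z, t)) (0, 1) = \<theta> (z, t)"
proof -
  note D = smooth_on_curve_derivative[OF U \<theta> z, of t]
  have lin: "frechet_derivative \<theta> (at (z, t * s)) (0, 1 * s) = s * frechet_derivative \<theta> (at (z, t * s)) (0, 1)" for s
  proof -
    have "linear (frechet_derivative \<theta> (at (z, t * s)))"
      using smooth_on_has_derivative[OF \<theta> open_times_UNIV, of "(z, t * s)"] z has_derivative_linear by auto
    from linear_scale[OF this, of s "(0, 1)"] show ?thesis by simp
  qed
  have cont: "continuous_on {0..1} (\<lambda>s. \<theta> (z, t * s))"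
    using DERIV_isCont[OF D] by (simp add: continuous_at_imp_continuous_on)
  have contD: "continuous_on {0..1} (\<lambda>s. frechet_derivative \<theta> (at (z, t * s)) (0, 1))"
    by (rule continuous_on_compose2[OF smooth_on_imp_continuous_on[OF smooth_on_frechet_derivative[OF \<theta> open_times_UNIV]],
          where f = "\<lambda>s. (z, t * s)"])
      (use z in \<open>auto intro!: continuous_intros\<close>)
  have "integral {0..1} (\<lambda>s. \<theta> (z, t * s) + t * (s * frechet_derivative \<theta> (at (z, t * s)) (0, 1)))
      = 1 * \<theta> (z, t * 1) - 0 * \<theta> (z, t * 0)"
  proof (rule integral_eq_of_real_derivative[where F = "\<lambda>s. s * \<theta> (z, t * s)"])
    show "((\<lambda>s. s * \<theta> (z, t * s)) has_real_derivative
        \<theta> (z, t * s) + t * (s * frechet_derivative \<theta> (at (z, t * s)) (0, 1))) (at s)" for s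
      using DERIV_mult[OF DERIV_ident D[of s]] by (simp add: algebra_simps)
  qed
  moreover have "integral {0..1} (\<lambda>s. \<theta> (z, t * s) + t * (s * frechet_derivative \<theta> (at (z, t * s)) (0, 1)))
      = integral {0..1} (\<lambda>s. \<theta> (z, t * s)) + integral {0..1} (\<lambda>s. t * (s * frechet_derivative \<theta> (at (z, t * s)) (0, 1)))"
    by (intro integral_add integrable_continuous_interval continuous_intros cont contD)
  ultimately show ?thesis
    unfolding parameter_primitive_derivative[OF z] lin by simp
qed

text \<open>By \<open>eq\<close> the integrand is the derivative of \<open>W (z, t * s)\<close> with
  respect to \<open>s\<close>. In the application \<theta> and \<open>W\<close> are the values of
  \<omega> on the time direction and on a leaf direction \<open>w\<close>, and \<open>eq\<close> is
  the leafwise closedness of \<omega>.\<close>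

lemma parameter_primitive_derivative_space:
  assumes z: "z \<in> U" and W: "smooth_on (U \<times> UNIV) W"
    and eq: "\<And>t. frechet_derivative W (at (z, t)) (0, 1) = frechet_derivative \<theta> (at (z, t)) (w, 0)"
  shows "frechet_derivative (parameter_primitive \<theta>) (at (z, t)) (w, 0) = W (z, t) - W (z, 0)"
proof -
  have "integral {0..1} (\<lambda>s. t * frechet_derivative W (at (z, t * s)) (0, 1)) = W (z, t * 1) - W (z, t * 0)"
    by (rule integral_eq_of_real_derivative) (rule smooth_on_curve_derivative[OF U W z])
  then show ?thesis unfolding parameter_primitive_derivative[OF z] by (simp add: eq)
qed

end

lemma alternating_form_integral:
  assumes a: "\<And>t. alternating_form k (a t)" and cont: "\<And>w. continuous_on {0..1} (\<lambda>t. a t w)"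
  shows "alternating_form k (\<lambda>w. integral {0..1::real} (\<lambda>t. a t w))"
proof (rule alternating_formI)
  note m = alternating_imp_multilinear[OF a]
  show "multilinear_form k (\<lambda>w. integral {0..1} (\<lambda>t. a t w))"
    unfolding multilinear_form_def
  proof (intro conjI allI impI linearI)
    show "integral {0..1} (\<lambda>t. a t v) = integral {0..1} (\<lambda>t. a t w)" if "\<forall>i<k. v i = w i" for v w
    proof -
      have "a t v = a t w" for t by (rule multilinear_cong[OF m]) (use that in simp)
      then show ?thesis by simp
    qed
    fix v :: "nat \<Rightarrow> 'a" and i x y assume i: "i < k"
    show "integral {0..1} (\<lambda>t. a t (v(i := x + y)))
        = integral {0..1} (\<lambda>t. a t (v(i := x))) + integral {0..1} (\<lambda>t. a t (v(i := y)))"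
      unfolding multilinear_add[OF m i]
      by (intro integral_add integrable_continuous_interval cont)
    fix r :: real
    have "a t (v(i := r *\<^sub>R x)) = r * a t (v(i := x))" for t
      using linear_scale[OF multilinear_linear[OF m i]] by simp
    then show "integral {0..1} (\<lambda>t. a t (v(i := r *\<^sub>R x))) = r *\<^sub>R integral {0..1} (\<lambda>t. a t (v(i := x)))"
      by simp
  qed
  show "integral {0..1} (\<lambda>t. a t v) = 0" if "i < k" "j < k" "i \<noteq> j" "v i = v j" for v i j
  proof -
    have "a t v = 0" for t by (rule alternating_zero[OF a that])
    then show ?thesis by simp
  qed
qed

definition cons_arg :: "'e \<Rightarrow> (nat \<Rightarrow> 'e) \<Rightarrow> nat \<Rightarrow> 'e" where
  "cons_arg s w = case_nat s w"

lemma cons_arg_simps [simp]: "cons_arg s w 0 = s" "cons_arg s w (Suc i) = w i"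
  by (simp_all add: cons_arg_def)

lemma omit_cons_arg: "omit 0 (cons_arg s w) = w" "omit (Suc j) (cons_arg s w) = cons_arg s (omit j w)"
  by (auto simp: omit_def cons_arg_def fun_eq_iff split: nat.splits)

lemma alternating_form_cons_arg:
  assumes a: "alternating_form (Suc k) a" and L: "linear L"
  shows "alternating_form k (\<lambda>w. a (cons_arg s (\<lambda>i. L (w i))))"
proof (rule alternating_formI)
  note m = alternating_imp_multilinear[OF a]
  show "multilinear_form k (\<lambda>w. a (cons_arg s (\<lambda>i. L (w i))))"
    unfolding multilinear_form_def
  proof (intro conjI allI impI)
    show "a (cons_arg s (\<lambda>i. L (v i))) = a (cons_arg s (\<lambda>i. L (w i)))" if "\<forall>i<k. v i = w i" for v w
      by (rule multilinear_cong[OF m]) (use that in \<open>auto simp: cons_arg_def split: nat.splits\<close>)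
    fix v :: "nat \<Rightarrow> 'b" and i assume i: "i < k"
    have "cons_arg s (\<lambda>j. L ((v(i := x)) j)) = (cons_arg s (\<lambda>j. L (v j)))(Suc i := L x)" for x
      by (auto simp: cons_arg_def fun_eq_iff split: nat.splits)
    then show "linear (\<lambda>x. a (cons_arg s (\<lambda>j. L ((v(i := x)) j))))"
      using linear_compose[OF L multilinear_linear[OF m, of "Suc i" "cons_arg s (\<lambda>j. L (v j))"]] i
      by (simp add: comp_def)
  qed
  show "a (cons_arg s (\<lambda>i. L (v i))) = 0" if "i < k" "j < k" "i \<noteq> j" "v i = v j" for v i j
    by (rule alternating_zero[OF a, of "Suc i" "Suc j"]) (use that in simp_all)
qed

lemma count_in_cons_arg:
  assumes "s \<in> T" shows "count_in T (Suc k) (cons_arg s w) = Suc (count_in T k w)"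
proof -
  have "{i. i < Suc k \<and> cons_arg s w i \<in> T} = insert 0 (Suc ` {i. i < k \<and> w i \<in> T})"
  proof (rule set_eqI)
    show "i \<in> {i. i < Suc k \<and> cons_arg s w i \<in> T} \<longleftrightarrow> i \<in> insert 0 (Suc ` {i. i < k \<and> w i \<in> T})" for i
      using assms by (cases i) auto
  qed
  moreover have "card (Suc ` {i. i < k \<and> w i \<in> T}) = card {i. i < k \<and> w i \<in> T}"
    by (rule card_image) simp
  ultimately show ?thesis by (simp add: count_in_def)
qed

section \<open>The homotopy operator\<close>

locale leafwise_homotopy = foliated_pair A gM B gN
  for A :: "('m::{t2_space,second_countable_topology}, 'p::real_normed_vector \<times> 'q::real_normed_vector) chart set"
    and gM and B :: "('n::{t2_space,second_countable_topology}, 'r::real_normed_vector \<times> 's::real_normed_vector) chart set"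
    and gN +
  fixes F :: "'m \<times> real \<Rightarrow> 'n" and \<omega> :: "('n, 'r \<times> 's) form"
  assumes homotopy: "smooth_homotopy A B F"
    and start_foliated: "foliated_map A B (\<lambda>x. F (x, 0))" and end_foliated: "foliated_map A B (\<lambda>x. F (x, 1))"
    and track: "\<And>x t. t \<in> {0..1} \<Longrightarrow> F (x, t) \<in> leaf B (F (x, 0))"
    and closed: "leafwise_closed B gN \<omega>"
begin

text \<open>
  Reparametrizing the time by \<open>sin\<^sup>2 (\<pi> t / 2)\<close> extends the homotopy smoothly to all real times,
  so that no one-sided derivatives occur.
\<close>

definition clock :: "real \<Rightarrow> real" where "clock t = sin (pi / 2 * t) * sin (pi / 2 * t)"

lemma clock_range: "clock t \<in> {0..1}"
proof -
  have "clock t = (sin (pi / 2 * t))\<^sup>2" by (simp add: clock_def power2_eq_square)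
  moreover have "(sin (pi / 2 * t))\<^sup>2 \<le> 1" by (simp add: abs_square_le_1)
  ultimately show ?thesis by simp
qed

lemma clock_simps [simp]: "clock 0 = 0" "clock 1 = 1"
  by (simp_all add: clock_def)

lemma clock_smooth: "smooth_on S clock"
proof -
  have l: "bounded_linear (\<lambda>t. pi / 2 * t)" by (rule bounded_linear_mult_right)
  have sin: "smooth_on UNIV (sin :: real \<Rightarrow> real)" by (simp add: smooth_on_def Ck_on_sin_cos)
  have "smooth_on S (\<lambda>t. sin (pi / 2 * t))"
    by (rule smooth_on_compose[OF finite_dimensional_real sin smooth_on_bounded_linear[OF l smooth_on_id]]) simp
  then have "smooth_on S (\<lambda>t. sin (pi / 2 * t) * sin (pi / 2 * t))" by (intro smooth_on_mult)
  then show ?thesis by (simp add: clock_def[abs_def])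
qed

definition homotopy_plot :: "('m, 'p \<times> 'q) chart \<Rightarrow> ('p \<times> 'q) \<times> real \<Rightarrow> 'n" where
  "homotopy_plot c p = F (chart_inv c (fst p), clock (snd p))"

text \<open>The tangent space of a leaf times the time line. Time counts as leafwise because the
  track of each point stays in a leaf.\<close>

definition time_tangent :: "(('p \<times> 'q) \<times> real) set" where
  "time_tangent = {u. fst u \<in> tangent_space}"

abbreviation \<tau> :: "('p \<times> 'q) \<times> real" where "\<tau> \<equiv> (0, 1)"

lemma fd_source: "finite_dimensional TYPE('p \<times> 'q)"
  by (rule smooth_atlas_finite_dimensional[OF M.atlas])

lemma fd_source_time: "finite_dimensional TYPE(('p \<times> 'q) \<times> real)"
  by (rule finite_dimensional_prod[OF fd_source finite_dimensional_real])

lemma open_chart_time: "c \<in> A \<Longrightarrow> open (crange c \<times> (UNIV :: real set))"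
  using smooth_atlas_open(2)[OF M.atlas] by (simp add: open_Times)

lemma homotopy_plot_plot:
  assumes c: "c \<in> A"
  shows "plot B (crange c \<times> UNIV) (homotopy_plot c)"
  unfolding plot_def
proof (intro conjI ballI)
  show "open (crange c \<times> (UNIV :: real set))" by (rule open_chart_time[OF c])
  have cont: "continuous_on (crange c \<times> UNIV) (\<lambda>p. (chart_inv c (fst p), clock (snd p)))"
  proof (rule continuous_on_Pair)
    show "continuous_on (crange c \<times> UNIV) (\<lambda>p. chart_inv c (fst p))"
      by (rule continuous_on_compose2[OF smooth_atlas_continuous(2)[OF M.atlas c] continuous_on_fst[OF continuous_on_id]]) auto
    show "continuous_on (crange c \<times> UNIV) (\<lambda>p. clock (snd p))"
      by (rule continuous_on_compose2[OF smooth_on_imp_continuous_on[OF clock_smooth] continuous_on_snd[OF continuous_on_id]]) auto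
  qed
  have "continuous_on (UNIV \<times> {0..1}) F" using homotopy by (simp add: smooth_homotopy_def)
  then show "continuous_on (crange c \<times> UNIV) (homotopy_plot c)"
    unfolding homotopy_plot_def[abs_def]
    by (rule continuous_on_compose2[OF _ cont]) (use clock_range in auto)
  fix c' assume c': "c' \<in> B"
  let ?T = "{(coord c x, t) | x t. x \<in> cdom c \<and> t \<in> {0..1} \<and> F (x, t) \<in> cdom c'}"
  let ?\<psi> = "\<lambda>p :: ('p \<times> 'q) \<times> real. (fst p, clock (snd p))"
  have "smooth_on {p \<in> crange c \<times> UNIV. homotopy_plot c p \<in> cdom c'}
      (\<lambda>p. (\<lambda>(z, t). coord c' (F (chart_inv c z, t))) (?\<psi> p))"
  proof (rule smooth_on_compose[OF fd_source_time, where T = ?T])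
    show "smooth_on ?T (\<lambda>(z, t). coord c' (F (chart_inv c z, t)))"
      using homotopy c c' by (simp add: smooth_homotopy_def)
    have "smooth_on S (\<lambda>p. clock (snd p))" for S :: "(('p \<times> 'q) \<times> real) set"
      by (rule smooth_on_compose[OF finite_dimensional_real clock_smooth[of UNIV]
            smooth_on_bounded_linear[OF bounded_linear_snd smooth_on_id]]) simp
    then show "smooth_on {p \<in> crange c \<times> UNIV. homotopy_plot c p \<in> cdom c'} ?\<psi>"
      by (intro smooth_on_Pair smooth_on_bounded_linear[OF bounded_linear_fst smooth_on_id])
    fix p assume p: "p \<in> {p \<in> crange c \<times> UNIV. homotopy_plot c p \<in> cdom c'}"
    then have z: "fst p \<in> crange c" by auto
    show "?\<psi> p \<in> ?T"
      using p smooth_atlas_inv_in[OF M.atlas c z] smooth_atlas_inv(2)[OF M.atlas c z] clock_range[of "snd p"]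
      by (intro CollectI exI[of _ "chart_inv c (fst p)"] exI[of _ "clock (snd p)"]) (simp add: homotopy_plot_def)
  qed
  then show "smooth_on {p \<in> crange c \<times> UNIV. homotopy_plot c p \<in> cdom c'} (coord c' \<circ> homotopy_plot c)"
    by (simp add: comp_def homotopy_plot_def)
qed

text \<open>\<open>start_foliated\<close> puts the points \<open>F (x, 0)\<close>, for
  \<open>x\<close> in one leaf, into one leaf, and \<open>track\<close> keeps them there at all
  times. So a line may move in leaf and time directions simultaneously.\<close>

lemma homotopy_plot_tangential:
  assumes c: "c \<in> A"
  shows "tangential_plot B (crange c \<times> UNIV) (homotopy_plot c) time_tangent"
  unfolding tangential_plot_def
proof (intro conjI ballI impI homotopy_plot_plot[OF c])
  fix p c' u
  assume p: "p \<in> crange c \<times> UNIV" and c': "c' \<in> B" "homotopy_plot c p \<in> cdom c'" and u: "u \<in> time_tangent"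
  have z: "fst p \<in> crange c" using p by auto
  have w: "fst u \<in> tangent_space" using u by (simp add: time_tangent_def)
  obtain e where e: "e > 0" "\<forall>s. \<bar>s\<bar> < e \<longrightarrow> fst p + s *\<^sub>R fst u \<in> crange c \<and>
      chart_inv c (fst p + s *\<^sub>R fst u) \<in> leaf A (chart_inv c (fst p))"
    using leaf_line[OF M.atlas c z w] by blast
  obtain y where y: "(\<lambda>x. F (x, 0)) ` leaf A (chart_inv c (fst p)) \<subseteq> leaf B y"
    using start_foliated by (auto simp: foliated_map_def maps_leaves_into_leaves_def)
  show "plot_deriv c' (homotopy_plot c) p u \<in> tangent_space"
  proof (rule plot_deriv_tangent[OF N.foliated c'(1) homotopy_plot_plot[OF c] p c'(2) e(1)])
    fix s :: real assume "\<bar>s\<bar> < e"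
    then have start: "F (chart_inv c (fst p + s *\<^sub>R fst u), 0) \<in> leaf B y" using e(2) y by blast
    have "homotopy_plot c (p + s *\<^sub>R u) = F (chart_inv c (fst p + s *\<^sub>R fst u), clock (snd p + s * snd u))"
      by (simp add: homotopy_plot_def)
    then show "homotopy_plot c (p + s *\<^sub>R u) \<in> leaf B y"
      using leaf_trans[OF start track[OF clock_range]] by simp
  qed
qed

lemma pull_homotopy_slice:
  assumes c: "c \<in> A" and z: "z \<in> crange c"
  shows "pull B (homotopy_plot c) \<alpha> (z, t) (\<lambda>i. (w i, 0)) = pull B (\<lambda>z. F (chart_inv c z, clock t)) \<alpha> z w"
proof -
  have "((\<lambda>z. (z, t)) has_derivative (\<lambda>w. (w, 0))) (at z)" by (auto intro!: derivative_eq_intros)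
  from pull_compose[OF N.atlas homotopy_plot_plot[OF c] this, of \<alpha> w] z
  show ?thesis by (simp add: homotopy_plot_def)
qed

section \<open>The exponential factor and its derivatives\<close>

lemma omega: "\<omega> \<in> Omega B gN 0 1"
  using closed by (simp add: leafwise_closed_def)

lemma omega_form: "differential_form B 1 \<omega>"
  using N.Omega_form[OF omega] by simp

text \<open>The function \<theta> in reparametrized time. It is taken along the track of
  \<open>x\<close> without a chart of the source, so that \<open>factor\<close> is a function on the
  manifold; \<open>chart_speed\<close> is its coordinate expression.\<close>

definition speed :: "'m \<Rightarrow> real \<Rightarrow> real" where
  "speed x t = pull B (\<lambda>s. F (x, clock s)) \<omega> t (\<lambda>_. 1)"

definition chart_speed :: "('m, 'p \<times> 'q) chart \<Rightarrow> ('p \<times> 'q) \<times> real \<Rightarrow> real" where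
  "chart_speed c p = pull B (homotopy_plot c) \<omega> p (\<lambda>_. \<tau>)"

definition omega_along :: "('m, 'p \<times> 'q) chart \<Rightarrow> 'p \<times> 'q \<Rightarrow> ('p \<times> 'q) \<times> real \<Rightarrow> real" where
  "omega_along c w p = pull B (homotopy_plot c) \<omega> p (\<lambda>_. (w, 0))"

text \<open>The function \<open>h_t\<close>. The primitive is formed over the one-point parameter
  space \<open>unit\<close>, again to avoid charts.\<close>

definition factor :: "'m \<Rightarrow> real \<Rightarrow> real" where
  "factor x t = exp (parameter_primitive (\<lambda>p. speed x (snd p)) ((), t))"

definition chart_factor :: "('m, 'p \<times> 'q) chart \<Rightarrow> ('p \<times> 'q) \<times> real \<Rightarrow> real" where
  "chart_factor c p = exp (parameter_primitive (chart_speed c) p)"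

lemma speed_chart:
  assumes c: "c \<in> A" "x \<in> cdom c"
  shows "speed x t = chart_speed c (coord c x, t)"
proof -
  have "((\<lambda>s. (coord c x, s)) has_derivative (\<lambda>r. (0, r))) (at t)" by (auto intro!: derivative_eq_intros)
  from pull_compose[OF N.atlas homotopy_plot_plot[OF c(1)] this, of \<omega> "\<lambda>_. 1"] coord_in_crange[OF c(2)]
  show ?thesis
    by (simp add: speed_def chart_speed_def homotopy_plot_def smooth_atlas_inv(1)[OF M.atlas c])
qed

lemma factor_chart:
  assumes c: "c \<in> A" "x \<in> cdom c"
  shows "factor x t = chart_factor c (coord c x, t)"
  by (simp add: factor_def chart_factor_def parameter_primitive_def speed_chart[OF c])

lemma chart_speed_smooth: "c \<in> A \<Longrightarrow> smooth_on (crange c \<times> UNIV) (chart_speed c)"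
  unfolding chart_speed_def[abs_def] by (rule pull_smooth[OF N.atlas homotopy_plot_plot omega_form])

lemma omega_along_smooth: "c \<in> A \<Longrightarrow> smooth_on (crange c \<times> UNIV) (omega_along c w)"
  unfolding omega_along_def[abs_def] by (rule pull_smooth[OF N.atlas homotopy_plot_plot omega_form])

lemma chart_primitive_smooth:
  assumes "c \<in> A" shows "smooth_on (crange c \<times> UNIV) (parameter_primitive (chart_speed c))"
  by (rule parameter_primitive_smooth[OF fd_source smooth_atlas_open(2)[OF M.atlas assms] chart_speed_smooth[OF assms]])

lemma chart_factor_smooth:
  assumes "c \<in> A" shows "smooth_on (crange c \<times> UNIV) (chart_factor c)"
  unfolding chart_factor_def[abs_def] by (rule smooth_on_exp[OF chart_primitive_smooth[OF assms]])

lemma chart_factor_zero: "chart_factor c (z, 0) = 1"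
  by (simp add: chart_factor_def parameter_primitive_zero)

lemma time_tangent_simps [simp]: "\<tau> \<in> time_tangent" "(w, 0) \<in> time_tangent \<longleftrightarrow> w \<in> tangent_space"
  by (simp_all add: time_tangent_def mem_tangent_space)

lemma count_in_time_tangent: "count_in time_tangent k (\<lambda>i. (w i, 0)) = count_in tangent_space k w"
  by (simp add: count_in_def)

text \<open>Leafwise closedness of \<omega>, pulled back to chart times time and evaluated on \<tau>
  and \<open>w\<close>. Both are leafwise, so the projection in \<open>d_leaf\<close> has no
  effect.\<close>

lemma omega_along_time_derivative:
  assumes c: "c \<in> A" and z: "z \<in> crange c" and w: "w \<in> tangent_space"
  shows "frechet_derivative (omega_along c w) (at (z, t)) \<tau> = frechet_derivative (chart_speed c) (at (z, t)) (w, 0)"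
proof -
  have p: "(z, t) \<in> crange c \<times> UNIV" using z by simp
  let ?V = "cons_arg \<tau> (\<lambda>i. (w, 0))"
  have "count_in tangent_space (Suc 0) (\<lambda>i. w) = 1" using w by (simp add: count_in_def)
  then have count: "count_in time_tangent (Suc (0 + 1)) ?V \<ge> Suc 1"
    by (simp add: count_in_cons_arg count_in_time_tangent)
  \<comment> \<open>A 1-form reads argument 0 only; this brings the arguments left by
    \<open>omit\<close> into the constant form used in the definitions.\<close>
  have pull1: "pull B (homotopy_plot c) \<omega> q (\<lambda>_. y 0) = pull B (homotopy_plot c) \<omega> q y"
    if "q \<in> crange c \<times> UNIV" for q y
    by (rule multilinear_cong[OF alternating_imp_multilinear[OF
          pull_alternating[OF N.atlas homotopy_plot_plot[OF c] that omega_form]]]) simp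
  have d: "frechet_derivative (\<lambda>q. pull B (homotopy_plot c) \<omega> q y) (at (z, t))
      = frechet_derivative (\<lambda>q. pull B (homotopy_plot c) \<omega> q (\<lambda>_. y 0)) (at (z, t))" for y
    by (rule frechet_derivative_cong_open[OF open_chart_time[OF c] p]) (simp add: pull1)
  have "(\<Sum>i\<le>0 + 1. (-1) ^ i * frechet_derivative (\<lambda>q. pull B (homotopy_plot c) \<omega> q (omit i ?V)) (at (z, t)) (?V i))
      = pull B (homotopy_plot c) (d_leaf B gN 0 1 \<omega>) (z, t) ?V"
    by (rule N.pull_d_leaf[OF omega homotopy_plot_tangential[OF c] p count, symmetric])
  also have "\<dots> = 0"
    using closed by (simp add: leafwise_closed_def pull_def zero_form_def)
  finally show ?thesis
    unfolding d[of "omit _ ?V"]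
    by (simp add: omega_along_def[abs_def] chart_speed_def[abs_def] omit_def)
qed

lemma chart_factor_derivative:
  assumes c: "c \<in> A" and p: "p \<in> crange c \<times> UNIV"
  shows "frechet_derivative (chart_factor c) (at p) h
    = chart_factor c p * frechet_derivative (parameter_primitive (chart_speed c)) (at p) h"
proof (rule frechet_derivative_at_eq)
  have "(parameter_primitive (chart_speed c) has_derivative
      frechet_derivative (parameter_primitive (chart_speed c)) (at p)) (at p)"
    by (rule smooth_on_has_derivative[OF chart_primitive_smooth[OF c] open_chart_time[OF c] p])
  from has_derivative_exp[OF this]
  show "(chart_factor c has_derivative
      (\<lambda>h. chart_factor c p * frechet_derivative (parameter_primitive (chart_speed c)) (at p) h)) (at p)"
    by (simp add: chart_factor_def[abs_def] mult.commute)
qed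

lemma chart_factor_time_derivative:
  assumes c: "c \<in> A" and z: "z \<in> crange c"
  shows "frechet_derivative (chart_factor c) (at (z, t)) \<tau> = chart_factor c (z, t) * chart_speed c (z, t)"
  using chart_factor_derivative[OF c, of "(z, t)" \<tau>] z
    parameter_primitive_derivative_parameter[OF fd_source smooth_atlas_open(2)[OF M.atlas c] chart_speed_smooth[OF c] z]
  by simp

text \<open>The value at time 0 comes from the lower end of the time integral. It is this term that
  moves the twist from time \<open>t\<close> to time 0.\<close>

lemma chart_factor_space_derivative:
  assumes c: "c \<in> A" and z: "z \<in> crange c" and w: "w \<in> tangent_space"
  shows "frechet_derivative (chart_factor c) (at (z, t)) (w, 0)
    = chart_factor c (z, t) * (omega_along c w (z, t) - omega_along c w (z, 0))"
  using chart_factor_derivative[OF c, of "(z, t)" "(w, 0)"] z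
    parameter_primitive_derivative_space[OF fd_source smooth_atlas_open(2)[OF M.atlas c] chart_speed_smooth[OF c] z
      omega_along_smooth[OF c] omega_along_time_derivative[OF c z w]]
  by simp

section \<open>The homotopy formula in a chart\<close>

definition slice_form :: "('n, 'r \<times> 's) form \<Rightarrow> ('m, 'p \<times> 'q) chart \<Rightarrow> (nat \<Rightarrow> 'p \<times> 'q) \<Rightarrow> ('p \<times> 'q) \<times> real \<Rightarrow> real" where
  "slice_form \<alpha> c w p = pull B (homotopy_plot c) \<alpha> p (\<lambda>i. (w i, 0))"

text \<open>The contraction \<iota> of the pullback of \<alpha> with the time direction, on
  arguments without time component.\<close>

definition contracted_form :: "('n, 'r \<times> 's) form \<Rightarrow> ('m, 'p \<times> 'q) chart \<Rightarrow> (nat \<Rightarrow> 'p \<times> 'q) \<Rightarrow> ('p \<times> 'q) \<times> real \<Rightarrow> real" where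
  "contracted_form \<alpha> c w p = pull B (homotopy_plot c) \<alpha> p (cons_arg \<tau> (\<lambda>i. (w i, 0)))"

text \<open>The homotopy operator in coordinates, before projection to a bidegree: the time integral
  of \<open>h_t\<close> times \<iota>.\<close>

definition chart_homotopy :: "('n, 'r \<times> 's) form \<Rightarrow> ('m, 'p \<times> 'q) chart \<Rightarrow> (nat \<Rightarrow> 'p \<times> 'q) \<Rightarrow> 'p \<times> 'q \<Rightarrow> real" where
  "chart_homotopy \<alpha> c w z = integral {0..1} (\<lambda>t. chart_factor c (z, t) * contracted_form \<alpha> c w (z, t))"

lemma smooth_product_derivative:
  fixes f g :: "'x::real_normed_vector \<Rightarrow> real"
  assumes "open S" "p \<in> S" "smooth_on S f" "smooth_on S g"
  shows "frechet_derivative (\<lambda>q. f q * g q) (at p) h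
    = f p * frechet_derivative g (at p) h + frechet_derivative f (at p) h * g p"
  by (rule frechet_derivative_at_eq)
    (rule has_derivative_mult[OF smooth_on_has_derivative[OF assms(3,1,2)] smooth_on_has_derivative[OF assms(4,1,2)]])

context
  fixes \<alpha> and u v :: nat
  assumes \<alpha>: "\<alpha> \<in> Omega B gN u v"
begin

lemma slice_form_smooth: "c \<in> A \<Longrightarrow> smooth_on (crange c \<times> UNIV) (slice_form \<alpha> c w)"
  unfolding slice_form_def[abs_def] by (rule pull_smooth[OF N.atlas homotopy_plot_plot N.Omega_form[OF \<alpha>]])

lemma contracted_form_smooth: "c \<in> A \<Longrightarrow> smooth_on (crange c \<times> UNIV) (contracted_form \<alpha> c w)"
  unfolding contracted_form_def[abs_def] by (rule pull_smooth[OF N.atlas homotopy_plot_plot N.Omega_form[OF \<alpha>]])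

text \<open>\<tau> counts as leafwise and raises the count above \<open>v\<close>.\<close>

lemma contracted_form_zero:
  assumes c: "c \<in> A" and p: "p \<in> crange c \<times> UNIV" and k: "u + v = Suc k"
    and w: "count_in tangent_space k w \<ge> v"
  shows "contracted_form \<alpha> c w p = 0"
  unfolding contracted_form_def
  by (rule N.pull_count_zero[OF \<alpha> homotopy_plot_tangential[OF c] p])
    (use w in \<open>simp add: k count_in_cons_arg count_in_time_tangent\<close>)

text \<open>The pulled-back closedness of \<alpha>, evaluated on \<tau> followed by
  \<open>w\<close>. Omitting \<tau> gives the time derivative of \<open>slice_form\<close> and a
  term with \<open>chart_speed\<close>; omitting \<open>w j\<close> gives the contraction with the
  opposite sign. Multiplication by the factor absorbs \<open>chart_speed\<close> into the time
  derivative and replaces \<omega> at time \<open>t\<close> by \<omega> at time 0.\<close>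

lemma homotopy_formula:
  assumes cl: "d_MN B gN \<omega> u v \<alpha> = zero_form" and c: "c \<in> A" and z: "z \<in> crange c"
    and w: "count_in tangent_space (u + v) w \<ge> v"
  shows "frechet_derivative (\<lambda>p. chart_factor c p * slice_form \<alpha> c w p) (at (z, t)) \<tau>
    = (\<Sum>j<u + v. (-1) ^ j * (frechet_derivative (\<lambda>p. chart_factor c p * contracted_form \<alpha> c (omit j w) p) (at (z, t)) (w j, 0)
        + omega_along c (w j) (z, 0) * (chart_factor c (z, t) * contracted_form \<alpha> c (omit j w) (z, t))))"
proof -
  let ?S = "crange c \<times> (UNIV :: real set)"
  let ?p = "(z, t)"
  let ?E = "chart_factor c" and ?G = "homotopy_plot c"
  let ?D = "\<lambda>f h. frechet_derivative f (at ?p) h"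
  have p: "?p \<in> ?S" using z by simp
  note S = open_chart_time[OF c] p
  let ?V = "cons_arg \<tau> (\<lambda>i. (w i, 0))"
  have count: "count_in time_tangent (Suc (u + v)) ?V \<ge> Suc v"
    using w by (simp add: count_in_cons_arg count_in_time_tangent)
  have om: "omit (Suc j) ?V = cons_arg \<tau> (\<lambda>i. (omit j w i, 0))" for j
    unfolding omit_cons_arg by (simp add: omit_def fun_eq_iff cons_arg_def split: nat.splits)
  have "pull B ?G (d_MN B gN \<omega> u v \<alpha>) ?p ?V = 0" by (simp add: cl pull_def zero_form_def)
  then have "0 = (\<Sum>i<Suc (u + v). (-1) ^ i * ?D (\<lambda>q. pull B ?G \<alpha> q (omit i ?V)) (?V i))
      + (\<Sum>i<Suc (u + v). (-1) ^ i * pull B ?G \<omega> ?p (\<lambda>_. ?V i) * pull B ?G \<alpha> ?p (omit i ?V))"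
    unfolding N.pull_d_MN[OF \<alpha> homotopy_plot_tangential[OF c] p count] lessThan_Suc_atMost by simp
  also have "\<dots> = ?D (slice_form \<alpha> c w) \<tau> + chart_speed c ?p * slice_form \<alpha> c w ?p
      - (\<Sum>j<u + v. (-1) ^ j * (?D (contracted_form \<alpha> c (omit j w)) (w j, 0)
          + omega_along c (w j) ?p * contracted_form \<alpha> c (omit j w) ?p))"
    unfolding sum.lessThan_Suc_shift om
    by (simp add: omit_cons_arg slice_form_def[abs_def] contracted_form_def[abs_def] chart_speed_def
        omega_along_def sum.distrib sum_negf distrib_left mult.assoc)
  finally have main: "?D (slice_form \<alpha> c w) \<tau> + chart_speed c ?p * slice_form \<alpha> c w ?p
      = (\<Sum>j<u + v. (-1) ^ j * (?D (contracted_form \<alpha> c (omit j w)) (w j, 0)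
          + omega_along c (w j) ?p * contracted_form \<alpha> c (omit j w) ?p))" by simp
  \<comment> \<open>The derivative of the factor is known in leaf directions only. If
    \<open>w j\<close> is not leafwise, the contraction on the other arguments vanishes identically,
    and so do both sides.\<close>
  have step: "?E ?p * (?D (contracted_form \<alpha> c (omit j w)) (w j, 0) + omega_along c (w j) ?p * contracted_form \<alpha> c (omit j w) ?p)
      = ?D (\<lambda>p. ?E p * contracted_form \<alpha> c (omit j w) p) (w j, 0)
        + omega_along c (w j) (z, 0) * (?E ?p * contracted_form \<alpha> c (omit j w) ?p)" if j: "j < u + v" for j
  proof (cases "w j \<in> tangent_space")
    case True
    show ?thesis
      unfolding smooth_product_derivative[OF S chart_factor_smooth[OF c] contracted_form_smooth[OF c]]
        chart_factor_space_derivative[OF c z True]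
      by (simp add: algebra_simps)
  next
    case False
    obtain k where k: "u + v = Suc k" using j by (cases "u + v") auto
    have "count_in tangent_space k (omit j w) \<ge> v"
      using count_in_omit(2)[of j k w tangent_space] False j w k by simp
    then have zero: "contracted_form \<alpha> c (omit j w) q = 0" if "q \<in> ?S" for q
      using contracted_form_zero[OF c that k] by blast
    have "?D (contracted_form \<alpha> c (omit j w)) (w j, 0) = 0"
      using frechet_derivative_cong_open[OF S, of "contracted_form \<alpha> c (omit j w)" "\<lambda>_. 0"] zero by simp
    moreover have "?D (\<lambda>p. ?E p * contracted_form \<alpha> c (omit j w) p) (w j, 0) = 0"
      using frechet_derivative_cong_open[OF S, of "\<lambda>p. ?E p * contracted_form \<alpha> c (omit j w) p" "\<lambda>_. 0"] zero by simp
    ultimately show ?thesis using zero[OF p] by simp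
  qed
  have "?D (\<lambda>p. ?E p * slice_form \<alpha> c w p) \<tau>
      = ?E ?p * (?D (slice_form \<alpha> c w) \<tau> + chart_speed c ?p * slice_form \<alpha> c w ?p)"
    unfolding smooth_product_derivative[OF S chart_factor_smooth[OF c] slice_form_smooth[OF c]]
      chart_factor_time_derivative[OF c z] by (simp add: algebra_simps)
  also have "\<dots> = (\<Sum>j<u + v. (-1) ^ j * (?E ?p * (?D (contracted_form \<alpha> c (omit j w)) (w j, 0)
          + omega_along c (w j) ?p * contracted_form \<alpha> c (omit j w) ?p)))"
    unfolding main sum_distrib_left by (simp only: mult.left_commute)
  also have "\<dots> = (\<Sum>j<u + v. (-1) ^ j * (?D (\<lambda>p. ?E p * contracted_form \<alpha> c (omit j w) p) (w j, 0)
        + omega_along c (w j) (z, 0) * (?E ?p * contracted_form \<alpha> c (omit j w) ?p)))"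
    by (rule sum.cong[OF refl]) (simp only: lessThan_iff step)
  finally show ?thesis .
qed

lemma integrand_smooth:
  "c \<in> A \<Longrightarrow> smooth_on (crange c \<times> UNIV) (\<lambda>p. chart_factor c p * contracted_form \<alpha> c w p)"
  by (intro smooth_on_mult chart_factor_smooth contracted_form_smooth)

lemma continuous_on_time:
  assumes c: "c \<in> A" and z: "z \<in> crange c" and f: "smooth_on (crange c \<times> UNIV) f"
  shows "continuous_on T (\<lambda>t. f (z, t))"
  by (rule continuous_on_compose2[OF smooth_on_imp_continuous_on[OF f], where f = "\<lambda>t. (z, t)"])
    (use z in \<open>auto intro!: continuous_intros\<close>)

text \<open>The time derivative integrates to the difference of the two ends, with factor 1 at time
  0. On the right the space derivative leaves the integral, and the coefficient with \<omega> does
  so because it no longer depends on time.\<close>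

lemma integrated_homotopy_formula:
  assumes cl: "d_MN B gN \<omega> u v \<alpha> = zero_form" and c: "c \<in> A" and z: "z \<in> crange c"
    and w: "count_in tangent_space (u + v) w \<ge> v"
  shows "chart_factor c (z, 1) * slice_form \<alpha> c w (z, 1) - slice_form \<alpha> c w (z, 0)
    = (\<Sum>j<u + v. (-1) ^ j * (frechet_derivative (chart_homotopy \<alpha> c (omit j w)) (at z) (w j)
        + omega_along c (w j) (z, 0) * chart_homotopy \<alpha> c (omit j w) z))"
proof -
  let ?S = "crange c \<times> (UNIV :: real set)"
  note U = smooth_atlas_open(2)[OF M.atlas c] and S = open_chart_time[OF c]
  let ?f = "\<lambda>p. chart_factor c p * slice_form \<alpha> c w p"
  let ?k = "\<lambda>j p. chart_factor c p * contracted_form \<alpha> c (omit j w) p"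
  have smf: "smooth_on ?S ?f" by (intro smooth_on_mult chart_factor_smooth[OF c] slice_form_smooth[OF c])
  have "integral {0..1} (\<lambda>t. frechet_derivative ?f (at (z, t)) \<tau>) = ?f (z, 1) - ?f (z, 0)"
    using integral_eq_of_real_derivative[OF smooth_on_curve_derivative[OF U smf z, of 1]] by simp
  then have lhs: "chart_factor c (z, 1) * slice_form \<alpha> c w (z, 1) - slice_form \<alpha> c w (z, 0)
      = integral {0..1} (\<lambda>t. frechet_derivative ?f (at (z, t)) \<tau>)"
    by (simp add: chart_factor_zero)
  have i1: "(\<lambda>t. frechet_derivative (?k j) (at (z, t)) (w j, 0)) integrable_on {0..1}" for j
    by (rule integrable_continuous_interval[OF continuous_on_time[OF c z
            smooth_on_frechet_derivative[OF integrand_smooth[OF c] S]]])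
  have i2: "(\<lambda>t. ?k j (z, t)) integrable_on {0..1}" for j
    by (rule integrable_continuous_interval[OF continuous_on_time[OF c z integrand_smooth[OF c]]])
  have i3: "(\<lambda>t. omega_along c (w j) (z, 0) * ?k j (z, t)) integrable_on {0..1}" for j
    by (rule integrable_on_mult_right[OF i2])
  have "integral {0..1} (\<lambda>t. frechet_derivative ?f (at (z, t)) \<tau>)
      = integral {0..1} (\<lambda>t. \<Sum>j<u + v. (-1) ^ j * (frechet_derivative (?k j) (at (z, t)) (w j, 0)
          + omega_along c (w j) (z, 0) * ?k j (z, t)))"
    by (simp only: homotopy_formula[OF cl c z w])
  also have "\<dots> = (\<Sum>j<u + v. integral {0..1} (\<lambda>t. (-1) ^ j * (frechet_derivative (?k j) (at (z, t)) (w j, 0)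
          + omega_along c (w j) (z, 0) * ?k j (z, t))))"
    by (rule integral_sum) (auto intro!: integrable_on_mult_right integrable_add i1 i3)
  also have "\<dots> = (\<Sum>j<u + v. (-1) ^ j * (frechet_derivative (chart_homotopy \<alpha> c (omit j w)) (at z) (w j)
        + omega_along c (w j) (z, 0) * chart_homotopy \<alpha> c (omit j w) z))"
  proof (rule sum.cong[OF refl])
    fix j
    have d: "frechet_derivative (chart_homotopy \<alpha> c (omit j w)) (at z) (w j)
        = integral {0..1} (\<lambda>t. frechet_derivative (?k j) (at (z, t)) (w j, 0))"
      unfolding chart_homotopy_def[abs_def]
      by (rule frechet_derivative_at_eq) (rule has_derivative_integral_parameter[OF fd_source U integrand_smooth[OF c] z])
    show "integral {0..1} (\<lambda>t. (-1) ^ j * (frechet_derivative (?k j) (at (z, t)) (w j, 0)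
          + omega_along c (w j) (z, 0) * ?k j (z, t)))
      = (-1) ^ j * (frechet_derivative (chart_homotopy \<alpha> c (omit j w)) (at z) (w j)
        + omega_along c (w j) (z, 0) * chart_homotopy \<alpha> c (omit j w) z)"
      unfolding d by (simp only: integral_mult_right integral_add[OF i1 i3] chart_homotopy_def)
  qed
  finally show ?thesis using lhs by simp
qed

end

section \<open>The homotopy operator on the source manifold\<close>

abbreviation start :: "'m \<Rightarrow> 'n" where "start \<equiv> \<lambda>x. F (x, 0)"
abbreviation final :: "'m \<Rightarrow> 'n" where "final \<equiv> \<lambda>x. F (x, 1)"

lemma slice_form_start:
  "c \<in> A \<Longrightarrow> z \<in> crange c \<Longrightarrow> slice_form \<alpha> c w (z, 0) = pull B (\<lambda>z. F (chart_inv c z, 0)) \<alpha> z w"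
  using pull_homotopy_slice[of c z \<alpha> 0 w] by (simp add: slice_form_def)

lemma slice_form_end:
  "c \<in> A \<Longrightarrow> z \<in> crange c \<Longrightarrow> slice_form \<alpha> c w (z, 1) = pull B (\<lambda>z. F (chart_inv c z, 1)) \<alpha> z w"
  using pull_homotopy_slice[of c z \<alpha> 1 w] by (simp add: slice_form_def)

lemma omega_along_start:
  "c \<in> A \<Longrightarrow> z \<in> crange c \<Longrightarrow> omega_along c w (z, 0) = pull B (\<lambda>z. F (chart_inv c z, 0)) \<omega> z (\<lambda>_. w)"
  using pull_homotopy_slice[of c z \<omega> 0 "\<lambda>_. w"] by (simp add: omega_along_def)

lemma omega_along_end:
  "c \<in> A \<Longrightarrow> z \<in> crange c \<Longrightarrow> omega_along c w (z, 1) = pull B (\<lambda>z. F (chart_inv c z, 1)) \<omega> z (\<lambda>_. w)"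
  using pull_homotopy_slice[of c z \<omega> 1 "\<lambda>_. w"] by (simp add: omega_along_def)

text \<open>Written with \<open>factor\<close>, so that only the contraction refers to the chart and
  compatibility with transitions reduces to \<open>contracted_form_change\<close>.\<close>

definition homotopy_form :: "('n, 'r \<times> 's) form \<Rightarrow> ('m, 'p \<times> 'q) form" where
  "homotopy_form \<alpha> = (\<lambda>c x w. if c \<in> A \<and> x \<in> cdom c
     then integral {0..1} (\<lambda>t. factor x t * contracted_form \<alpha> c w (coord c x, t)) else 0)"

lemma homotopy_form_chart:
  "c \<in> A \<Longrightarrow> x \<in> cdom c \<Longrightarrow> homotopy_form \<alpha> c x w = chart_homotopy \<alpha> c w (coord c x)"
  by (simp add: homotopy_form_def chart_homotopy_def factor_chart)

text \<open>The transition, extended by the identity in time, fixes \<tau> and maps vectors without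
  time component to such vectors.\<close>

lemma contracted_form_change:
  assumes c: "c \<in> A" "c' \<in> A" and x: "x \<in> cdom c" "x \<in> cdom c'"
  shows "contracted_form \<alpha> c w (coord c x, t) = contracted_form \<alpha> c' (\<lambda>i. chart_deriv id c c' x (w i)) (coord c' x, t)"
proof -
  let ?\<psi> = "in_charts id c c'" and ?L = "chart_deriv id c c' x"
  let ?\<Psi> = "\<lambda>p :: ('p \<times> 'q) \<times> real. (?\<psi> (fst p), snd p)"
  let ?S = "coord c ` (cdom c \<inter> cdom c') \<times> (UNIV :: real set)"
  have \<psi>: "?\<psi> (coord c y) = coord c' y" if "y \<in> cdom c" for y
    using smooth_atlas_inv(1)[OF M.atlas c(1) that] by (simp add: in_charts_def)
  have S: "open ?S" "(coord c x, t) \<in> ?S"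
    using open_coord_image[OF M.atlas c(1) smooth_atlas_open(1)[OF M.atlas c(2)]] x by (auto simp: open_Times)
  have D: "(?\<Psi> has_derivative (\<lambda>h. (?L (fst h), snd h))) (at (coord c x, t))"
  proof (rule has_derivative_Pair)
    show "((\<lambda>p. ?\<psi> (fst p)) has_derivative (\<lambda>h. ?L (fst h))) (at (coord c x, t))"
      by (rule has_derivative_compose[where f = fst and g = ?\<psi>, OF has_derivative_fst[OF has_derivative_ident]])
        (use has_derivative_transition[OF M.atlas c x] in \<open>simp only: fst_conv\<close>)
    show "(snd has_derivative snd) (at (coord c x, t))" by (rule has_derivative_snd[OF has_derivative_ident])
  qed
  have "pull B (homotopy_plot c) \<alpha> (coord c x, t) y = pull B (\<lambda>p. homotopy_plot c' (?\<Psi> p)) \<alpha> (coord c x, t) y" for y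
    by (rule pull_cong_open[OF S])
      (use \<psi> smooth_atlas_inv(1)[OF M.atlas c(1)] smooth_atlas_inv(1)[OF M.atlas c(2)] in \<open>auto simp: homotopy_plot_def\<close>)
  also have "pull B (\<lambda>p. homotopy_plot c' (?\<Psi> p)) \<alpha> (coord c x, t) y
      = pull B (homotopy_plot c') \<alpha> (?\<Psi> (coord c x, t)) (\<lambda>i. (?L (fst (y i)), snd (y i)))" for y
    by (rule pull_compose[where G = "homotopy_plot c'" and \<psi> = ?\<Psi>, OF N.atlas homotopy_plot_plot[OF c(2)] D])
      (simp add: \<psi>[OF x(1)] coord_in_crange[OF x(2)])
  finally have "contracted_form \<alpha> c w (coord c x, t) = pull B (homotopy_plot c') \<alpha> (?\<Psi> (coord c x, t))
      (\<lambda>i. (?L (fst (cons_arg \<tau> (\<lambda>i. (w i, 0)) i)), snd (cons_arg \<tau> (\<lambda>i. (w i, 0)) i)))"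
    by (simp add: contracted_form_def)
  moreover have "(\<lambda>i. (?L (fst (cons_arg \<tau> (\<lambda>i. (w i, 0)) i)), snd (cons_arg \<tau> (\<lambda>i. (w i, 0)) i)))
      = cons_arg \<tau> (\<lambda>i. (?L (w i), 0))"
    using linear_0[OF M.transition_linear[OF c x]] by (simp add: cons_arg_def fun_eq_iff split: nat.splits)
  ultimately show ?thesis by (simp add: contracted_form_def \<psi>[OF x(1)])
qed

lemma differential_form_homotopy_form:
  assumes \<alpha>: "\<alpha> \<in> Omega B gN u v" and k: "u + v = Suc k"
  shows "differential_form A k (homotopy_form \<alpha>)"
  unfolding differential_form_def
proof (intro conjI ballI allI impI)
  show "alternating_form k (homotopy_form \<alpha> c x)" if c: "c \<in> A" "x \<in> cdom c" for c x
  proof -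
    let ?z = "coord c x"
    have z: "?z \<in> crange c" by (rule coord_in_crange[OF c(2)])
    have "alternating_form k (\<lambda>w. integral {0..1} (\<lambda>t. chart_factor c (?z, t) * contracted_form \<alpha> c w (?z, t)))"
    proof (rule alternating_form_integral)
      show "alternating_form k (\<lambda>w. chart_factor c (?z, t) * contracted_form \<alpha> c w (?z, t))" for t
        unfolding contracted_form_def
      proof (intro alternating_form_scale alternating_form_cons_arg)
        have "alternating_form (u + v) (pull B (homotopy_plot c) \<alpha> (?z, t))"
          by (rule pull_alternating[OF N.atlas homotopy_plot_plot[OF c(1)] _ N.Omega_form[OF \<alpha>]]) (simp add: z)
        then show "alternating_form (Suc k) (pull B (homotopy_plot c) \<alpha> (?z, t))" by (simp add: k)
      qed (auto intro!: linearI)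
      show "continuous_on {0..1} (\<lambda>t. chart_factor c (?z, t) * contracted_form \<alpha> c w (?z, t))" for w
        by (rule continuous_on_time[OF \<alpha> c(1) z integrand_smooth[OF \<alpha> c(1)]])
    qed
    then show ?thesis by (simp add: homotopy_form_chart[OF c, abs_def] chart_homotopy_def)
  qed
  show "homotopy_form \<alpha> c x w = homotopy_form \<alpha> c' x (\<lambda>i. chart_deriv id c c' x (w i))"
    if "c \<in> A" "c' \<in> A" "x \<in> cdom c \<inter> cdom c'" for c c' x w
    using that contracted_form_change[of c c' x \<alpha> w] by (simp add: homotopy_form_def)
  show "smooth_on (crange c) (\<lambda>z. homotopy_form \<alpha> c (chart_inv c z) w)" if c: "c \<in> A" for c w
  proof (rule smooth_on_cong)
    show "smooth_on (crange c) (chart_homotopy \<alpha> c w)"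
      unfolding chart_homotopy_def[abs_def]
      by (rule smooth_on_integral_parameter[OF fd_source smooth_atlas_open(2)[OF M.atlas c] integrand_smooth[OF \<alpha> c]])
    show "chart_homotopy \<alpha> c w z = homotopy_form \<alpha> c (chart_inv c z) w" if "z \<in> crange c" for z
      using homotopy_form_chart[OF c smooth_atlas_inv_in[OF M.atlas c that]] smooth_atlas_inv(2)[OF M.atlas c that] by simp
  qed
  show "homotopy_form \<alpha> c x w = 0" if "\<not> (c \<in> A \<and> x \<in> cdom c)" for c x w
    unfolding homotopy_form_def using that by (rule if_not_P)
qed

lemma chart_homotopy_zero:
  assumes \<alpha>: "\<alpha> \<in> Omega B gN u v" and c: "c \<in> A" and z: "z \<in> crange c" and k: "u + v = Suc k"
    and w: "count_in tangent_space k w \<ge> v"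
  shows "chart_homotopy \<alpha> c w z = 0"
proof -
  have "contracted_form \<alpha> c w (z, t) = 0" for t
    by (rule contracted_form_zero[OF \<alpha> c _ k w]) (simp add: z)
  then show ?thesis by (simp add: chart_homotopy_def)
qed

abbreviation scale :: "'m \<Rightarrow> real" where "scale \<equiv> \<lambda>x. factor x 1"

lemma scale_pos: "scale x > 0"
  by (simp add: factor_def)

lemma scale_chart: "c \<in> A \<Longrightarrow> z \<in> crange c \<Longrightarrow> scale (chart_inv c z) = chart_factor c (z, 1)"
  using factor_chart[of c "chart_inv c z" 1] smooth_atlas_inv_in[OF M.atlas] smooth_atlas_inv(2)[OF M.atlas] by simp

lemma chart_scale_smooth:
  assumes c: "c \<in> A" shows "smooth_on (crange c) (\<lambda>z. chart_factor c (z, 1))"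
  by (rule smooth_on_compose[OF fd_source_time chart_factor_smooth[OF c]])
    (auto intro!: smooth_on_Pair smooth_on_id smooth_on_const)

lemma scale_smooth: "smooth_function A scale"
  unfolding smooth_function_def
proof
  fix c assume c: "c \<in> A"
  show "smooth_on (crange c) (scale \<circ> chart_inv c)"
    by (rule smooth_on_cong[OF _ chart_scale_smooth[OF c]]) (simp add: scale_chart[OF c])
qed

lemma chart_scale_derivative:
  assumes c: "c \<in> A" and z: "z \<in> crange c" and w: "w \<in> tangent_space"
  shows "frechet_derivative (\<lambda>z. chart_factor c (z, 1)) (at z) w
    = chart_factor c (z, 1) * (omega_along c w (z, 1) - omega_along c w (z, 0))"
proof -
  have "((\<lambda>z. chart_factor c (z, 1)) has_derivative (\<lambda>w. frechet_derivative (chart_factor c) (at (z, 1)) (w, 0))) (at z)"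
  proof (rule has_derivative_compose[where f = "\<lambda>z. (z, 1)" and g = "chart_factor c"])
    show "((\<lambda>z. (z, 1)) has_derivative (\<lambda>w. (w, 0))) (at z)" by (auto intro!: derivative_eq_intros)
    show "(chart_factor c has_derivative frechet_derivative (chart_factor c) (at (z, 1))) (at (z, 1))"
      by (rule smooth_on_has_derivative[OF chart_factor_smooth[OF c] open_chart_time[OF c]]) (simp add: z)
  qed
  from frechet_derivative_at_eq[OF this, of w] show ?thesis
    using chart_factor_space_derivative[OF c z w] by simp
qed

lemmas start_Omega = foliated_pullback_Omega[OF start_foliated]
lemmas end_Omega = foliated_pullback_Omega[OF end_foliated]

text \<open>With \<open>h\<close> for \<open>scale\<close>, the derivative of \<open>h\<close> in
  leaf directions is \<open>h\<close> times the difference of the pullbacks of \<omega> by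
  \<open>final\<close> and \<open>start\<close>. So the derivative twisted at the start, applied to
  \<open>h\<close> times the pullback of \<alpha>, is \<open>h\<close> times the derivative twisted
  at the end, and that one is the pullback of \<open>d_MN\<close> of \<alpha>.\<close>

lemma scaled_pullback_closed:
  assumes \<alpha>: "\<alpha> \<in> Omega B gN u v" and cl: "d_MN B gN \<omega> u v \<alpha> = zero_form"
  shows "d_MN A gM (foliated_pullback A gM B start 0 1 \<omega>) u v
    (scale_form scale (foliated_pullback A gM B final u v \<alpha>)) = zero_form"
proof (rule M.d_MN_eqI[OF start_Omega[OF omega] M.Omega_scale[OF scale_smooth end_Omega[OF \<alpha>]]])
  show "component_at (tangential_part gM c x) u (Suc (u + v)) (zero_form c x) = zero_form c x" for c x
    by (simp add: component_at_def[abs_def] zero_form_def)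
  show "zero_form c x w = 0" for c :: "('m, 'p \<times> 'q) chart" and x w by (simp add: zero_form_def)
  fix c x and w :: "nat \<Rightarrow> 'p \<times> 'q"
  assume c: "c \<in> A" "x \<in> cdom c" and w: "count_in tangent_space (Suc (u + v)) w \<ge> Suc v"
  let ?z = "coord c x" and ?E = "\<lambda>z. chart_factor c (z, 1)"
  let ?P = "pull B (\<lambda>z. final (chart_inv c z)) \<alpha>"
  note z = coord_in_crange[OF c(2)] and U = smooth_atlas_open(2)[OF M.atlas c(1)]
  note G = foliated_map_plot[OF end_foliated c(1)]
  have smP: "smooth_on (crange c) (\<lambda>z. ?P z y)" for y
    by (rule pull_smooth[OF N.atlas tangential_plot_plot[OF G] N.Omega_form[OF \<alpha>]])
  have fp: "scale_form scale (foliated_pullback A gM B final u v \<alpha>) c (chart_inv c z) y = ?E z * ?P z y"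
    if "z \<in> crange c" "count_in tangent_space (u + v) y \<ge> v" for z y
    using foliated_pullback_of_count[OF end_foliated \<alpha> c(1) smooth_atlas_inv_in[OF M.atlas c(1) that(1)] that(2)]
    by (simp add: scale_form_def scale_chart[OF c(1) that(1)] smooth_atlas_inv(2)[OF M.atlas c(1) that(1)])
  \<comment> \<open>As in \<open>homotopy_formula\<close>, a direction \<open>w i\<close> that is
    not leafwise leaves too many leafwise arguments, so the coefficient in front of the uncontrolled
    derivative is 0.\<close>
  have step: "frechet_derivative (\<lambda>z. ?E z * ?P z (omit i w)) (at ?z) (w i)
        + pull B (\<lambda>z. start (chart_inv c z)) \<omega> ?z (\<lambda>_. w i) * (?E ?z * ?P ?z (omit i w))
      = ?E ?z * (frechet_derivative (\<lambda>z. ?P z (omit i w)) (at ?z) (w i)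
        + pull B (\<lambda>z. final (chart_inv c z)) \<omega> ?z (\<lambda>_. w i) * ?P ?z (omit i w))" if i: "i \<le> u + v" for i
  proof (cases "w i \<in> tangent_space")
    case True
    show ?thesis
      unfolding smooth_product_derivative[OF U z chart_scale_smooth[OF c(1)] smP]
        chart_scale_derivative[OF c(1) z True] omega_along_start[OF c(1) z] omega_along_end[OF c(1) z]
      by (simp add: algebra_simps)
  next
    case False
    then have "count_in tangent_space (u + v) (omit i w) > v"
      using count_in_omit(2)[OF i, of w tangent_space] w by simp
    then have "?P ?z (omit i w) = 0" by (rule N.pull_count_zero[OF \<alpha> G z])
    then show ?thesis
      unfolding smooth_product_derivative[OF U z chart_scale_smooth[OF c(1)] smP] by simp
  qed
  have "ext_deriv A (u + v) (scale_form scale (foliated_pullback A gM B final u v \<alpha>)) c x w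
      = (\<Sum>i\<le>u + v. (-1) ^ i * frechet_derivative (\<lambda>z. ?E z * ?P z (omit i w)) (at ?z) (w i))"
    by (rule M.ext_deriv_of_count[where \<Phi> = "\<lambda>z y. ?E z * ?P z y" and v = v, OF c _ w]) (rule fp)
  moreover have "wedge1 (foliated_pullback A gM B start 0 1 \<omega>) (u + v)
        (scale_form scale (foliated_pullback A gM B final u v \<alpha>)) c x w
      = (\<Sum>i\<le>u + v. (-1) ^ i * pull B (\<lambda>z. start (chart_inv c z)) \<omega> ?z (\<lambda>_. w i) * (?E ?z * ?P ?z (omit i w)))"
  proof (rule wedge1_foliated_pullback[where b = "\<lambda>y. ?E ?z * ?P ?z y", OF start_foliated omega c w])
    show "scale_form scale (foliated_pullback A gM B final u v \<alpha>) c x y = ?E ?z * ?P ?z y"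
      if "count_in tangent_space (u + v) y \<ge> v" for y
      using fp[OF z that] smooth_atlas_inv(1)[OF M.atlas c] by simp
    show "?E ?z * ?P ?z y = 0" if "count_in tangent_space (u + v) y > v" for y
      using N.pull_count_zero[OF \<alpha> G z that] by simp
  qed
  ultimately have "ext_deriv A (u + v) (scale_form scale (foliated_pullback A gM B final u v \<alpha>)) c x w
      + wedge1 (foliated_pullback A gM B start 0 1 \<omega>) (u + v)
        (scale_form scale (foliated_pullback A gM B final u v \<alpha>)) c x w
      = (\<Sum>i\<le>u + v. (-1) ^ i * (frechet_derivative (\<lambda>z. ?E z * ?P z (omit i w)) (at ?z) (w i)
        + pull B (\<lambda>z. start (chart_inv c z)) \<omega> ?z (\<lambda>_. w i) * (?E ?z * ?P ?z (omit i w))))"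
    by (simp only: distrib_left sum.distrib mult.assoc)
  also have "\<dots> = (\<Sum>i\<le>u + v. (-1) ^ i * (?E ?z * (frechet_derivative (\<lambda>z. ?P z (omit i w)) (at ?z) (w i)
        + pull B (\<lambda>z. final (chart_inv c z)) \<omega> ?z (\<lambda>_. w i) * ?P ?z (omit i w))))"
    by (rule sum.cong[OF refl]) (simp only: atMost_iff step)
  also have "\<dots> = ?E ?z * pull B (\<lambda>z. final (chart_inv c z)) (d_MN B gN \<omega> u v \<alpha>) ?z w"
    unfolding N.pull_d_MN[OF \<alpha> G z w]
    by (simp only: distrib_left sum.distrib sum_distrib_left mult.assoc mult.left_commute[of "?E ?z"])
  also have "\<dots> = zero_form c x w" by (simp add: cl pull_def zero_form_def)
  finally show "ext_deriv A (u + v) (scale_form scale (foliated_pullback A gM B final u v \<alpha>)) c x w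
      + wedge1 (foliated_pullback A gM B start 0 1 \<omega>) (u + v)
        (scale_form scale (foliated_pullback A gM B final u v \<alpha>)) c x w = zero_form c x w" .
qed

lemma scaled_pullback_difference:
  assumes \<alpha>: "\<alpha> \<in> Omega B gN u v" and cl: "d_MN B gN \<omega> u v \<alpha> = zero_form"
    and c: "c \<in> A" "x \<in> cdom c" and w: "count_in tangent_space (u + v) w \<ge> v"
  shows "scale_form scale (foliated_pullback A gM B final u v \<alpha>) c x w - foliated_pullback A gM B start u v \<alpha> c x w
    = (\<Sum>j<u + v. (-1) ^ j * (frechet_derivative (chart_homotopy \<alpha> c (omit j w)) (at (coord c x)) (w j)
        + omega_along c (w j) (coord c x, 0) * chart_homotopy \<alpha> c (omit j w) (coord c x)))"
  using integrated_homotopy_formula[OF \<alpha> cl c(1) coord_in_crange[OF c(2)] w]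
  by (simp add: scale_form_def factor_chart[OF c] foliated_pullback_of_count[OF start_foliated \<alpha> c w]
      foliated_pullback_of_count[OF end_foliated \<alpha> c w] slice_form_start[OF c(1) coord_in_crange[OF c(2)]]
      slice_form_end[OF c(1) coord_in_crange[OF c(2)]])

text \<open>The integrated formula says that the homotopy form is a primitive on sufficiently
  leafwise arguments. Its projection to bidegree \<open>(u, v)\<close> agrees with it on at least
  \<open>v\<close> leafwise arguments, because contraction with \<tau> vanishes on more than
  \<open>v\<close> of them.\<close>

lemma scaled_pullback_homotopic:
  assumes \<alpha>: "\<alpha> \<in> Omega B gN u (Suc v)" and cl: "d_MN B gN \<omega> u (Suc v) \<alpha> = zero_form"
  shows "bidegree_part gM u v (homotopy_form \<alpha>) \<in> Omega A gM u v"
    and "d_MN A gM (foliated_pullback A gM B start 0 1 \<omega>) u v (bidegree_part gM u v (homotopy_form \<alpha>))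
    = (\<lambda>c x w. scale_form scale (foliated_pullback A gM B final u (Suc v) \<alpha>) c x w
        - foliated_pullback A gM B start u (Suc v) \<alpha> c x w)" (is "_ = ?\<gamma>")
proof -
  have k: "u + Suc v = Suc (u + v)" by simp
  note form = differential_form_homotopy_form[OF \<alpha> k]
  show K: "bidegree_part gM u v (homotopy_form \<alpha>) \<in> Omega A gM u v"
    by (rule M.bidegree_part_Omega[OF form])
  have \<gamma>: "?\<gamma> \<in> Omega A gM u (Suc v)"
    by (rule M.Omega_diff[OF M.Omega_scale[OF scale_smooth end_Omega[OF \<alpha>]] start_Omega[OF \<alpha>]])
  show "d_MN A gM (foliated_pullback A gM B start 0 1 \<omega>) u v (bidegree_part gM u v (homotopy_form \<alpha>)) = ?\<gamma>"
  proof (rule M.d_MN_eqI[OF start_Omega[OF omega] K])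
    show "component_at (tangential_part gM c x) u (Suc (u + v)) (?\<gamma> c x) = ?\<gamma> c x"
      if "c \<in> A" "x \<in> cdom c" for c x
      using M.Omega_component[OF \<gamma> that] by simp
    show "?\<gamma> c x w = 0" if "\<not> (c \<in> A \<and> x \<in> cdom c)" for c x w
      by (rule M.Omega_outside[OF \<gamma> that])
    fix c x and w :: "nat \<Rightarrow> 'p \<times> 'q"
    assume c: "c \<in> A" "x \<in> cdom c" and w: "count_in tangent_space (Suc (u + v)) w \<ge> Suc v"
    let ?z = "coord c x"
    note z = coord_in_crange[OF c(2)]
    \<comment> \<open>Removes the projection, at every point of the chart because the equation is
      differentiated afterwards.\<close>
    have K_chart: "bidegree_part gM u v (homotopy_form \<alpha>) c y y' = chart_homotopy \<alpha> c y' (coord c y)"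
      if y: "y \<in> cdom c" "count_in tangent_space (u + v) y' \<ge> v" for y y'
    proof -
      have "bidegree_part gM u v (homotopy_form \<alpha>) c y y' = homotopy_form \<alpha> c y y'"
      proof (rule M.bidegree_part_eq_of_count[OF c(1) y(1) _ _ y(2)])
        show "multilinear_form (u + v) (homotopy_form \<alpha> c y)"
          by (rule alternating_imp_multilinear[OF differential_form_alternating[OF form c(1) y(1)]])
        show "homotopy_form \<alpha> c y w = 0" if "count_in tangent_space (u + v) w > v" for w
          using chart_homotopy_zero[OF \<alpha> c(1) coord_in_crange[OF y(1)] k, of w] that
          by (simp add: homotopy_form_chart[OF c(1) y(1)])
      qed
      then show ?thesis by (simp add: homotopy_form_chart[OF c(1) y(1)])
    qed
    have "ext_deriv A (u + v) (bidegree_part gM u v (homotopy_form \<alpha>)) c x w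
        = (\<Sum>i\<le>u + v. (-1) ^ i * frechet_derivative (\<lambda>z. chart_homotopy \<alpha> c (omit i w) z) (at ?z) (w i))"
    proof (rule M.ext_deriv_of_count[where \<Phi> = "\<lambda>z y. chart_homotopy \<alpha> c y z" and v = v, OF c _ w])
      show "bidegree_part gM u v (homotopy_form \<alpha>) c (chart_inv c z) y = chart_homotopy \<alpha> c y z"
        if "z \<in> crange c" "count_in tangent_space (u + v) y \<ge> v" for z y
        using K_chart[OF smooth_atlas_inv_in[OF M.atlas c(1) that(1)] that(2)]
          smooth_atlas_inv(2)[OF M.atlas c(1) that(1)] by simp
    qed
    moreover have "wedge1 (foliated_pullback A gM B start 0 1 \<omega>) (u + v) (bidegree_part gM u v (homotopy_form \<alpha>)) c x w
        = (\<Sum>i\<le>u + v. (-1) ^ i * pull B (\<lambda>z. start (chart_inv c z)) \<omega> ?z (\<lambda>_. w i) * chart_homotopy \<alpha> c (omit i w) ?z)"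
    proof (rule wedge1_foliated_pullback[where b = "\<lambda>y. chart_homotopy \<alpha> c y ?z", OF start_foliated omega c w])
      show "bidegree_part gM u v (homotopy_form \<alpha>) c x y = chart_homotopy \<alpha> c y ?z"
        if "count_in tangent_space (u + v) y \<ge> v" for y
        by (rule K_chart[OF c(2) that])
      show "chart_homotopy \<alpha> c y ?z = 0" if "count_in tangent_space (u + v) y > v" for y
        using chart_homotopy_zero[OF \<alpha> c(1) z k, of y] that by simp
    qed
    moreover have "?\<gamma> c x w
      = (\<Sum>j<Suc (u + v). (-1) ^ j * (frechet_derivative (chart_homotopy \<alpha> c (omit j w)) (at ?z) (w j)
        + omega_along c (w j) (?z, 0) * chart_homotopy \<alpha> c (omit j w) ?z))"
      using scaled_pullback_difference[OF \<alpha> cl c, of w] w by simp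
    ultimately show "ext_deriv A (u + v) (bidegree_part gM u v (homotopy_form \<alpha>)) c x w
        + wedge1 (foliated_pullback A gM B start 0 1 \<omega>) (u + v) (bidegree_part gM u v (homotopy_form \<alpha>)) c x w = ?\<gamma> c x w"
      by (simp only: lessThan_Suc_atMost omega_along_start[OF c(1) z] distrib_left sum.distrib mult.assoc)
  qed
qed

text \<open>In leafwise degree 0 the only coboundary is \<open>zero_form\<close>, so equality of
  forms is required. It holds because \<tau> is leafwise: contraction with it kills a form of
  bidegree \<open>(u, 0)\<close>, and the integrated formula has right-hand side 0.\<close>

lemma scaled_pullback_eq_degree_zero:
  assumes \<alpha>: "\<alpha> \<in> Omega B gN u 0" and cl: "d_MN B gN \<omega> u 0 \<alpha> = zero_form"
  shows "scale_form scale (foliated_pullback A gM B final u 0 \<alpha>) = foliated_pullback A gM B start u 0 \<alpha>"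
proof (intro ext)
  fix c x w
  show "scale_form scale (foliated_pullback A gM B final u 0 \<alpha>) c x w = foliated_pullback A gM B start u 0 \<alpha> c x w"
  proof (cases "c \<in> A \<and> x \<in> cdom c")
    case True
    then have c: "c \<in> A" "x \<in> cdom c" by auto
    note z = coord_in_crange[OF c(2)]
    have "(-1) ^ j * (frechet_derivative (chart_homotopy \<alpha> c (omit j w)) (at (coord c x)) (w j)
        + omega_along c (w j) (coord c x, 0) * chart_homotopy \<alpha> c (omit j w) (coord c x)) = 0" if j: "j < u + 0" for j
    proof -
      obtain k where k: "u + 0 = Suc k" using j by (cases u) auto
      have zero: "chart_homotopy \<alpha> c (omit j w) z = 0" if "z \<in> crange c" for z
        by (rule chart_homotopy_zero[OF \<alpha> c(1) that k]) simp
      have "frechet_derivative (chart_homotopy \<alpha> c (omit j w)) (at (coord c x)) = frechet_derivative (\<lambda>_. 0) (at (coord c x))"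
        by (rule frechet_derivative_cong_open[OF smooth_atlas_open(2)[OF M.atlas c(1)] z zero])
      then show ?thesis using zero[OF z] by simp
    qed
    then have "scale_form scale (foliated_pullback A gM B final u 0 \<alpha>) c x w - foliated_pullback A gM B start u 0 \<alpha> c x w = 0"
      unfolding scaled_pullback_difference[OF \<alpha> cl c le0] by (intro sum.neutral) simp
    then show ?thesis by simp
  next
    case False
    then show ?thesis
      using M.Omega_outside[OF M.Omega_scale[OF scale_smooth end_Omega[OF \<alpha>]]] M.Omega_outside[OF start_Omega[OF \<alpha>]]
      by metis
  qed
qed

end

section \<open>Induced maps on cohomology\<close>

context foliated_riemannian
begin

lemma MN_coboundaries_diff:
  assumes p: "p \<in> MN_coboundaries A g \<eta> u v" and q: "q \<in> MN_coboundaries A g \<eta> u v"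
  shows "(\<lambda>c x w. p c x w - q c x w) \<in> MN_coboundaries A g \<eta> u v"
proof (cases v)
  case 0
  then show ?thesis using p q by (simp add: MN_coboundaries_def zero_form_def)
next
  case (Suc v')
  then obtain \<beta> \<gamma> where \<beta>: "\<beta> \<in> Omega A g u v'" "p = d_MN A g \<eta> u v' \<beta>"
    and \<gamma>: "\<gamma> \<in> Omega A g u v'" "q = d_MN A g \<eta> u v' \<gamma>"
    using p q by (auto simp: MN_coboundaries_def)
  have "(\<lambda>c x w. p c x w - q c x w) = d_MN A g \<eta> u v' (\<lambda>c x w. \<beta> c x w - \<gamma> c x w)"
    unfolding \<beta>(2) \<gamma>(2) by (intro ext) (rule d_MN_diff[OF \<beta>(1) \<gamma>(1), symmetric])
  then show ?thesis
    using Omega_diff[OF \<beta>(1) \<gamma>(1)] Suc by (simp add: MN_coboundaries_def)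
qed

lemma MN_coboundaries_zero: "zero_form \<in> MN_coboundaries A g \<eta> u v"
proof (cases v)
  case 0
  then show ?thesis by (simp add: MN_coboundaries_def)
next
  case (Suc v')
  \<comment> \<open>Subtracting this coboundary from itself avoids the computation of
    \<open>d_MN\<close> on \<open>zero_form\<close>.\<close>
  then have "d_MN A g \<eta> u v' zero_form \<in> MN_coboundaries A g \<eta> u v"
    using Omega_zero by (simp add: MN_coboundaries_def)
  from MN_coboundaries_diff[OF this this] show ?thesis by (simp add: zero_form_def)
qed

lemma MN_class_self: "\<alpha> \<in> MN_cocycles A g \<eta> u v \<Longrightarrow> \<alpha> \<in> MN_class A g \<eta> u v \<alpha>"
  using MN_coboundaries_zero[of \<eta> u v] by (simp add: MN_class_def zero_form_def)

lemma MN_class_eqI: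
  assumes "(\<lambda>c x w. \<alpha> c x w - \<beta> c x w) \<in> MN_coboundaries A g \<eta> u v"
  shows "MN_class A g \<eta> u v \<alpha> = MN_class A g \<eta> u v \<beta>"
proof -
  have neg: "(\<lambda>c x w. \<beta> c x w - \<alpha> c x w) \<in> MN_coboundaries A g \<eta> u v"
    using MN_coboundaries_diff[OF MN_coboundaries_zero assms] by (simp add: zero_form_def)
  have "(\<lambda>c x w. \<gamma> c x w - \<beta> c x w) \<in> MN_coboundaries A g \<eta> u v \<longleftrightarrow>
      (\<lambda>c x w. \<gamma> c x w - \<alpha> c x w) \<in> MN_coboundaries A g \<eta> u v" for \<gamma>
    using MN_coboundaries_diff[of "\<lambda>c x w. \<gamma> c x w - \<beta> c x w" \<eta> u v "\<lambda>c x w. \<alpha> c x w - \<beta> c x w"]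
      MN_coboundaries_diff[of "\<lambda>c x w. \<gamma> c x w - \<alpha> c x w" \<eta> u v "\<lambda>c x w. \<beta> c x w - \<alpha> c x w"] assms neg
    by auto
  then show ?thesis unfolding MN_class_def by blast
qed

end

context foliated_pair
begin

text \<open>A map on classes is defined through chosen representatives; \<open>exact\<close> makes
  the result independent of the choice.\<close>

lemma induces_on_cohomology_exists:
  assumes closed: "\<And>\<alpha>. \<alpha> \<in> MN_cocycles B gN \<omega> u v \<Longrightarrow> \<Phi> \<alpha> \<in> MN_cocycles A gM \<eta> u v"
    and exact: "\<And>\<alpha> \<beta>. \<alpha> \<in> MN_cocycles B gN \<omega> u v \<Longrightarrow> \<beta> \<in> MN_cocycles B gN \<omega> u v \<Longrightarrow>
      (\<lambda>c x w. \<alpha> c x w - \<beta> c x w) \<in> MN_coboundaries B gN \<omega> u v \<Longrightarrow>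
      (\<lambda>c x w. \<Phi> \<alpha> c x w - \<Phi> \<beta> c x w) \<in> MN_coboundaries A gM \<eta> u v"
  shows "\<exists>\<phi>. induces_on_cohomology B gN \<omega> A gM \<eta> u v \<Phi> \<phi>"
proof -
  define r where "r X = (SOME \<alpha>. \<alpha> \<in> MN_cocycles B gN \<omega> u v \<and> MN_class B gN \<omega> u v \<alpha> = X)" for X
  define \<phi> where "\<phi> X = MN_class A gM \<eta> u v (\<Phi> (r X))" for X
  have r: "r X \<in> MN_cocycles B gN \<omega> u v \<and> MN_class B gN \<omega> u v (r X) = X" if "X \<in> MN_cohomology B gN \<omega> u v" for X
  proof -
    have "\<exists>\<alpha>. \<alpha> \<in> MN_cocycles B gN \<omega> u v \<and> MN_class B gN \<omega> u v \<alpha> = X"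
      using that unfolding MN_cohomology_def by blast
    then show ?thesis unfolding r_def by (rule someI_ex)
  qed
  have "\<phi> (MN_class B gN \<omega> u v \<alpha>) = MN_class A gM \<eta> u v (\<Phi> \<alpha>)" if \<alpha>: "\<alpha> \<in> MN_cocycles B gN \<omega> u v" for \<alpha>
  proof -
    let ?\<beta> = "r (MN_class B gN \<omega> u v \<alpha>)"
    have \<beta>: "?\<beta> \<in> MN_cocycles B gN \<omega> u v" "MN_class B gN \<omega> u v ?\<beta> = MN_class B gN \<omega> u v \<alpha>"
      using r[of "MN_class B gN \<omega> u v \<alpha>"] \<alpha> by (auto simp: MN_cohomology_def)
    have "?\<beta> \<in> MN_class B gN \<omega> u v \<alpha>" using N.MN_class_self[OF \<beta>(1)] \<beta>(2) by simp
    then have "(\<lambda>c x w. ?\<beta> c x w - \<alpha> c x w) \<in> MN_coboundaries B gN \<omega> u v" by (simp add: MN_class_def)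
    from exact[OF \<beta>(1) \<alpha> this] show ?thesis unfolding \<phi>_def by (rule M.MN_class_eqI)
  qed
  moreover have "\<phi> \<in> MN_cohomology B gN \<omega> u v \<rightarrow> MN_cohomology A gM \<eta> u v"
    using r closed by (auto simp: \<phi>_def MN_cohomology_def)
  ultimately have "induces_on_cohomology B gN \<omega> A gM \<eta> u v \<Phi> \<phi>"
    using closed by (simp add: induces_on_cohomology_def)
  then show ?thesis by (rule exI[of _ \<phi>])
qed

lemma induces_on_cohomology_cong:
  assumes \<phi>: "induces_on_cohomology B gN \<omega> A gM \<eta> u v \<Phi> \<phi>"
    and closed: "\<And>\<alpha>. \<alpha> \<in> MN_cocycles B gN \<omega> u v \<Longrightarrow> \<Psi> \<alpha> \<in> MN_cocycles A gM \<eta> u v"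
    and eq: "\<And>\<alpha>. \<alpha> \<in> MN_cocycles B gN \<omega> u v \<Longrightarrow>
      (\<lambda>c x w. \<Psi> \<alpha> c x w - \<Phi> \<alpha> c x w) \<in> MN_coboundaries A gM \<eta> u v"
  shows "induces_on_cohomology B gN \<omega> A gM \<eta> u v \<Psi> \<phi>"
  using \<phi> closed M.MN_class_eqI[OF eq] by (simp add: induces_on_cohomology_def)

lemma pullback_form_diff:
  "pullback_form A B f (\<lambda>c x w. \<alpha> c x w - \<beta> c x w) c x
    = (\<lambda>w. pullback_form A B f \<alpha> c x w - pullback_form A B f \<beta> c x w)"
  by (rule ext) (simp add: pullback_form_def Let_def)

lemma foliated_pullback_diff:
  "foliated_pullback A gM B f u v (\<lambda>c x w. \<alpha> c x w - \<beta> c x w) c x w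
    = foliated_pullback A gM B f u v \<alpha> c x w - foliated_pullback A gM B f u v \<beta> c x w"
  by (simp add: foliated_pullback_def bidegree_part_def pullback_form_diff component_at_diff)

lemma foliated_pullback_zero: "foliated_pullback A gM B f u v zero_form = zero_form"
  by (simp add: foliated_pullback_def bidegree_part_def component_at_def[abs_def] pullback_form_def zero_form_def fun_eq_iff)

lemma foliated_pullback_cocycles:
  assumes f: "foliated_map A B f" and \<omega>: "\<omega> \<in> Omega B gN 0 1" and \<alpha>: "\<alpha> \<in> MN_cocycles B gN \<omega> u v"
  shows "foliated_pullback A gM B f u v \<alpha> \<in> MN_cocycles A gM (foliated_pullback A gM B f 0 1 \<omega>) u v"
  using \<alpha> foliated_pullback_Omega[OF f] d_MN_foliated_pullback[OF f \<omega>]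
  by (simp add: MN_cocycles_def foliated_pullback_zero)

lemma foliated_pullback_coboundaries:
  assumes f: "foliated_map A B f" and \<omega>: "\<omega> \<in> Omega B gN 0 1" and \<alpha>: "\<alpha> \<in> MN_coboundaries B gN \<omega> u v"
  shows "foliated_pullback A gM B f u v \<alpha> \<in> MN_coboundaries A gM (foliated_pullback A gM B f 0 1 \<omega>) u v"
proof (cases v)
  case 0
  then show ?thesis using \<alpha> by (simp add: MN_coboundaries_def foliated_pullback_zero)
next
  case (Suc v')
  then obtain \<beta> where \<beta>: "\<beta> \<in> Omega B gN u v'" "\<alpha> = d_MN B gN \<omega> u v' \<beta>"
    using \<alpha> by (auto simp: MN_coboundaries_def)
  show ?thesis
    using d_MN_foliated_pullback[OF f \<omega> \<beta>(1), symmetric] foliated_pullback_Omega[OF f \<beta>(1)] Suc \<beta>(2)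
    by (simp add: MN_coboundaries_def)
qed

end

section \<open>The maps induced by the two ends of the homotopy\<close>

context leafwise_homotopy
begin

lemma scaled_pullback_cohomologous:
  assumes \<alpha>: "\<alpha> \<in> MN_cocycles B gN \<omega> u v"
  shows "(\<lambda>c x w. scale_form scale (foliated_pullback A gM B final u v \<alpha>) c x w
      - foliated_pullback A gM B start u v \<alpha> c x w)
    \<in> MN_coboundaries A gM (foliated_pullback A gM B start 0 1 \<omega>) u v"
proof (cases v)
  case 0
  then show ?thesis
    using scaled_pullback_eq_degree_zero[of \<alpha> u] \<alpha> by (simp add: MN_cocycles_def MN_coboundaries_def zero_form_def)
next
  case (Suc v')
  then have \<alpha>': "\<alpha> \<in> Omega B gN u (Suc v')" "d_MN B gN \<omega> u (Suc v') \<alpha> = zero_form"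
    using \<alpha> by (simp_all add: MN_cocycles_def)
  show ?thesis
    using imageI[OF scaled_pullback_homotopic(1)[OF \<alpha>'], of "d_MN A gM (foliated_pullback A gM B start 0 1 \<omega>) u v'"]
    unfolding scaled_pullback_homotopic(2)[OF \<alpha>'] by (simp add: MN_coboundaries_def Suc)
qed

lemma induced_maps_agree:
  "\<exists>\<phi>. induces_on_cohomology B gN \<omega> A gM (foliated_pullback A gM B start 0 1 \<omega>) u v
      (foliated_pullback A gM B start u v) \<phi> \<and>
    induces_on_cohomology B gN \<omega> A gM (foliated_pullback A gM B start 0 1 \<omega>) u v
      (\<lambda>\<alpha>. scale_form scale (foliated_pullback A gM B final u v \<alpha>)) \<phi>"
proof -
  have "\<exists>\<phi>. induces_on_cohomology B gN \<omega> A gM (foliated_pullback A gM B start 0 1 \<omega>) u v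
      (foliated_pullback A gM B start u v) \<phi>"
  proof (rule induces_on_cohomology_exists)
    fix \<alpha> \<beta> assume "(\<lambda>c x w. \<alpha> c x w - \<beta> c x w) \<in> MN_coboundaries B gN \<omega> u v"
    from foliated_pullback_coboundaries[OF start_foliated omega this]
    show "(\<lambda>c x w. foliated_pullback A gM B start u v \<alpha> c x w - foliated_pullback A gM B start u v \<beta> c x w)
      \<in> MN_coboundaries A gM (foliated_pullback A gM B start 0 1 \<omega>) u v"
      by (simp add: foliated_pullback_diff[abs_def])
  qed (rule foliated_pullback_cocycles[OF start_foliated omega])
  then obtain \<phi> where \<phi>: "induces_on_cohomology B gN \<omega> A gM (foliated_pullback A gM B start 0 1 \<omega>) u v
      (foliated_pullback A gM B start u v) \<phi>" by blast
  have "induces_on_cohomology B gN \<omega> A gM (foliated_pullback A gM B start 0 1 \<omega>) u v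
      (\<lambda>\<alpha>. scale_form scale (foliated_pullback A gM B final u v \<alpha>)) \<phi>"
  proof (rule induces_on_cohomology_cong[OF \<phi> _ scaled_pullback_cohomologous])
    fix \<alpha> assume "\<alpha> \<in> MN_cocycles B gN \<omega> u v"
    then have "\<alpha> \<in> Omega B gN u v" "d_MN B gN \<omega> u v \<alpha> = zero_form" by (simp_all add: MN_cocycles_def)
    then show "scale_form scale (foliated_pullback A gM B final u v \<alpha>)
        \<in> MN_cocycles A gM (foliated_pullback A gM B start 0 1 \<omega>) u v"
      using scaled_pullback_closed M.Omega_scale[OF scale_smooth end_Omega] by (simp add: MN_cocycles_def)
  qed
  with \<phi> show ?thesis by blast
qed

end

theorem proposition5p3:
  fixes A :: "('m::{t2_space,second_countable_topology},
               'p::real_normed_vector \<times> 'q::real_normed_vector) chart set"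
    and B :: "('n::{t2_space,second_countable_topology},
               'r::real_normed_vector \<times> 's::real_normed_vector) chart set"
    and gM :: "('m, 'p \<times> 'q) metric_field" and gN :: "('n, 'r \<times> 's) metric_field"
    and \<mu>M :: "('m, 'p \<times> 'q) form" and \<mu>N :: "('n, 'r \<times> 's) form"
    and f g :: "'m \<Rightarrow> 'n"
    and \<omega> :: "('n, 'r \<times> 's) form"
  assumes "compact (UNIV :: 'm set)" and "compact (UNIV :: 'n set)"
    and "riemannian_foliation A" and "riemannian_foliation B"
    and "orientation_form A \<mu>M" and "orientation_form B \<mu>N"
    and "bundle_like A gM" and "bundle_like B gN"
    and "foliated_map A B f" and "foliated_map A B g"
    and "foliated_homotopic A B f g"
    and "leafwise_closed B gN \<omega>"
  shows "\<exists>h :: 'm \<Rightarrow> real. smooth_function A h \<and> (\<forall>x. h x > 0) \<and>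
    (\<forall>l k. \<exists>\<phi>.
       induces_on_cohomology B gN \<omega> A gM (foliated_pullback A gM B f 0 1 \<omega>) l k
         (foliated_pullback A gM B f l k) \<phi> \<and>
       induces_on_cohomology B gN \<omega> A gM (foliated_pullback A gM B f 0 1 \<omega>) l k
         (\<lambda>\<alpha>. scale_form h (foliated_pullback A gM B g l k \<alpha>)) \<phi>)"
proof -
  obtain F where F: "smooth_homotopy A B F" "\<forall>x. F (x, 0) = f x" "\<forall>x. F (x, 1) = g x"
    "\<forall>x. \<forall>t\<^sub>1\<in>{0..1}. \<forall>t\<^sub>2\<in>{0..1}. F (x, t\<^sub>2) \<in> leaf B (F (x, t\<^sub>1))"
    using assms(11) unfolding foliated_homotopic_def by blast
  have f: "(\<lambda>x. F (x, 0)) = f" and g: "(\<lambda>x. F (x, 1)) = g" using F(2,3) by auto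
  interpret leafwise_homotopy A gM B gN F \<omega>
  proof
    show "foliated_atlas A" "foliated_atlas B"
      using assms(3,4) by (simp_all add: riemannian_foliation_def)
    show "riemannian_metric A gM" "riemannian_metric B gN"
      using assms(7,8) by (simp_all add: bundle_like_def)
    show "smooth_homotopy A B F" by (rule F(1))
    show "foliated_map A B (\<lambda>x. F (x, 0))" "foliated_map A B (\<lambda>x. F (x, 1))"
      unfolding f g using assms(9,10) by blast+
    show "F (x, t) \<in> leaf B (F (x, 0))" if "t \<in> {0..1}" for x t
      using F(4) that by simp
    show "leafwise_closed B gN \<omega>" by (rule assms(12))
  qed
  \<comment> \<open>\<open>scale x\<close> is the exponential of the integral of \<omega> along the
    reparametrized track from \<open>f x\<close> to \<open>g x\<close>; it does not depend on the
    degrees \<open>l\<close> and \<open>k\<close>.\<close>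
  show ?thesis
    using scale_smooth scale_pos induced_maps_agree unfolding f g by (intro exI[of _ scale]) blast
qed

end
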